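(* Let $K$ be the Tonelli Hamiltonian on the annulus $T^*\mathcal{C}_D=\mathcal{C}_D\times\mathbb{R}$ and let $\mathcal{C}$ be the closed curve constructed in the context, for parameters $\beta>0$, $\alpha\in(\beta,2\beta)$. Then $\mathcal{C}$ is the global attractor of the conformal Hamiltonian vector field $X_K^\alpha=(\partial_yK,-\partial_xK-\alpha y)$, and then $X_K^\alpha$ is $C^1$-integrable with an attractor that is not a graph.
   Context: Construction. Let $\beta>0$ and $\alpha\in(\beta,2\beta)$, and let $H(x,y)=y^2-\beta xy$ on $\mathbb{R}^2$. Choose two large real numbers $B>A>0$ and a smooth even function $V:\mathbb{R}\to[-1,0]$ with support in $[-B,B]$, $V=-1$ on $[-A,A]$, $V$ non-increasing on $[-B,-A]$ and non-decreasing on $[A,B]$. Consider the system $$\dot x=-\beta x+2y,\qquad\dot y=-V'(x)+(\beta-\alpha)y.$$ Its orbit that coincides with the $x$-axis for $x\le-B$ and its orbit that coincides with the $x$-axis for $x\ge B$ both tend to $(0,0)$ as time tends to $+\infty$. Let $\Gamma$ be the union of these two orbits and of $\{(0,0)\}$ (an invariant curve that is not a graph over the $x$-axis). Choose $D>C>B$ with $\frac{2(\alpha-\beta)}{\beta}\log\frac CB>1$. Let $X:\mathbb{R}\to\mathbb{R}$ be a smooth odd vector field such that: $X(x)=-\beta x$ for $x\in[-\frac{D+C}2,-B]\cup[B,\frac{C+D}2]$; $X(-D)=X(D)=0$ and all derivatives of $X$ are the same at $-D$ and $D$; $X'(x)\in[-\beta,\beta)$ on $[-D,-B]$; $(-D,-B]$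 (resp. $[B,D)$) is a piece of unstable manifold of the equilibrium $-D$ (resp. $D$) of $X$. Thus $X$ defines a vector field on the circle $\mathcal{C}_D=[-D,D]/(D\sim-D)$. Let $H_X(x,y)=\frac12y(y+2X(x))$. Let $\eta:\mathbb{R}\to[0,1]$ be a smooth even bump function with support in $[-C,C]$, equal to $1$ on $[-B,B]$, with $0\le\eta'(x)<\frac{2(\alpha-\beta)}{-\beta x}$ for $x\in[-C,-B]$. Define $$K(x,y)=(1-\eta(x))H_X(x,y)+\eta(x)\big(H(x,y)+V(x)\big),$$ which defines a Tonelli Hamiltonian on $\mathcal{C}_D\times\mathbb{R}$ (i.e. $C^2$, with positive definite second derivative in $y$ and superlinear in $y$). The curve $\mathcal{C}$ is the union of $([-D,-B]\cup[B,D])\times\{0\}$ and of the part of $\Gamma$ between $x=-B$ and $x=B$; it is invariant under the flow of $(\partial_yK,-\partial_xK-\alpha y)$. Definitions. For a flow $(\varphi_t)$ defined for $t\ge0$ on a manifold $N$, a non-empty compact $Q\subset N$ is an attractor if there is an open set $U\supset Q$ with $\varphi_t(\overline U)\subset U$ for all $t>0$ and $Q=\bigcap_{t>0}\varphi_t(U)$; it is the global attractor if moreover for every neighborhood $W$ of $Q$ and every $z\in N$ there is $t\in\mathbb{R}$ such that $\varphi_t(z)\in W$. The vector field is $C^1$-integrable if there is a global attractor that is a $C^1$ submanifold symplectically isotopic to the zero section. "Graph" means graph of a function over the base circle $\mathcal{C}_D$.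
   Formalization: The condition X'(x) ∈ [-β,β) on [-D,-B] contradicts the other conditions on X (X(-D)=0 and X=-βx at x=-(C+D)/2 force X'>β somewhere, by the mean value theorem); only the lower bound X' ≥ -β is assumed. *)

theory Defs
  imports "HOL-Analysis.Analysis"
begin

definition smooth :: "(real \<Rightarrow> real) \<Rightarrow> bool" where
  "smooth f \<longleftrightarrow> (\<forall>n x. (deriv ^^ n) f field_differentiable at x)"

definition C1_on ::
  "'a::real_normed_vector set \<Rightarrow> ('a \<Rightarrow> 'b::real_normed_vector) \<Rightarrow> bool" where
  "C1_on S f \<longleftrightarrow>
     (\<exists>f' :: 'a \<Rightarrow> 'a \<Rightarrow>\<^sub>L 'b.
        (\<forall>z\<in>S. (f has_derivative blinfun_apply (f' z)) (at z within S)) \<and> continuous_on S f')"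

definition C2_on ::
  "'a::real_normed_vector set \<Rightarrow> ('a \<Rightarrow> 'b::real_normed_vector) \<Rightarrow> bool" where
  "C2_on S f \<longleftrightarrow>
     (\<exists>f' :: 'a \<Rightarrow> 'a \<Rightarrow>\<^sub>L 'b.
        (\<forall>z\<in>S. (f has_derivative blinfun_apply (f' z)) (at z within S)) \<and> C1_on S f')"

text \<open>The circle \<open>[-D,D]/(D \<sim> -D)\<close> is realised as the unit circle of the complex plane through
  \<open>x \<mapsto> cis (pi * x / D)\<close>. Topological notions refer to the annulus itself; differential and
  symplectic notions (for the form \<open>dx \<and> dy\<close>) are expressed in the coordinates \<open>(x, y)\<close> of the
  universal cover, in which functions and vector fields on the annulus are \<open>2D\<close>-periodic in \<open>x\<close>.\<close>

definition annulus :: "(complex \<times> real) set" where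
  "annulus = sphere 0 1 \<times> UNIV"

definition cover :: "real \<Rightarrow> real \<times> real \<Rightarrow> complex \<times> real" where
  "cover D = (\<lambda>(x, y). (cis (pi * x / D), y))"

definition wrap :: "real \<Rightarrow> real \<Rightarrow> real" where
  "wrap D x = x - 2 * D * of_int \<lfloor>(x + D) / (2 * D)\<rfloor>"

text \<open>The lift to the plane of the function on the annulus which is given by \<open>K\<close> on the
  fundamental domain \<open>[-D,D) \<times> \<real>\<close>.\<close>

definition periodize :: "real \<Rightarrow> (real \<times> real \<Rightarrow> real) \<Rightarrow> real \<times> real \<Rightarrow> real" where
  "periodize D K = (\<lambda>(x, y). K (wrap D x, y))"

definition is_graph :: "(complex \<times> real) set \<Rightarrow> bool" where
  "is_graph L \<longleftrightarrow> (\<exists>f. L = (\<lambda>c. (c, f c)) ` sphere 0 1)"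

definition tonelli :: "real \<Rightarrow> (real \<times> real \<Rightarrow> real) \<Rightarrow> bool" where
  "tonelli D K \<longleftrightarrow>
     (\<forall>x y. K (x + 2 * D, y) = K (x, y)) \<and>
     C2_on UNIV K \<and>
     (\<forall>x y. (deriv ^^ 2) (\<lambda>v. K (x, v)) y > 0) \<and>
     (\<forall>x. filterlim (\<lambda>y. K (x, y) / \<bar>y\<bar>) at_top at_infinity)"

definition conformal_field ::
  "real \<Rightarrow> (real \<times> real \<Rightarrow> real) \<Rightarrow> real \<times> real \<Rightarrow> real \<times> real" where
  "conformal_field \<alpha> K =
     (\<lambda>(x, y). (deriv (\<lambda>v. K (x, v)) y, - deriv (\<lambda>u. K (u, y)) x - \<alpha> * y))"

text \<open>\<open>\<phi>\<close> is the flow, defined for \<open>t \<ge> 0\<close>, of the vector field on the annulus with lift \<open>F\<close>.\<close>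

definition forward_flow ::
  "real \<Rightarrow> (real \<times> real \<Rightarrow> real \<times> real) \<Rightarrow> (real \<Rightarrow> complex \<times> real \<Rightarrow> complex \<times> real) \<Rightarrow> bool" where
  "forward_flow D F \<phi> \<longleftrightarrow>
     (\<forall>z. \<exists>\<gamma>. \<gamma> 0 = z \<and>
        (\<forall>t\<ge>0. (\<gamma> has_vector_derivative F (\<gamma> t)) (at t within {0..})) \<and>
        (\<forall>t\<ge>0. \<phi> t (cover D z) = cover D (\<gamma> t)))"

definition attractor ::
  "'a::topological_space set \<Rightarrow> (real \<Rightarrow> 'a \<Rightarrow> 'a) \<Rightarrow> 'a set \<Rightarrow> bool" where
  "attractor N \<phi> Q \<longleftrightarrow>
     Q \<subseteq> N \<and> Q \<noteq> {} \<and> compact Q \<and>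
     (\<exists>U. openin (top_of_set N) U \<and> Q \<subseteq> U \<and>
        (\<forall>t>0. \<phi> t ` (top_of_set N closure_of U) \<subseteq> U) \<and>
        Q = (\<Inter>t\<in>{0<..}. \<phi> t ` U))"

definition global_attractor ::
  "'a::topological_space set \<Rightarrow> (real \<Rightarrow> 'a \<Rightarrow> 'a) \<Rightarrow> 'a set \<Rightarrow> bool" where
  "global_attractor N \<phi> Q \<longleftrightarrow>
     attractor N \<phi> Q \<and>
     (\<forall>W z. openin (top_of_set N) W \<longrightarrow> Q \<subseteq> W \<longrightarrow> z \<in> N \<longrightarrow> (\<exists>t\<ge>0. \<phi> t z \<in> W))"

definition is_global_attractor ::
  "real \<Rightarrow> (real \<times> real \<Rightarrow> real \<times> real) \<Rightarrow> (complex \<times> real) set \<Rightarrow> bool" where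
  "is_global_attractor D F Q \<longleftrightarrow> (\<exists>\<phi>. forward_flow D F \<phi> \<and> global_attractor annulus \<phi> Q)"

definition C1_submanifold :: "real \<Rightarrow> (complex \<times> real) set \<Rightarrow> bool" where
  "C1_submanifold D L \<longleftrightarrow>
     L \<subseteq> annulus \<and>
     (\<forall>z. cover D z \<in> L \<longrightarrow>
        (\<exists>W (g :: real \<times> real \<Rightarrow> real).
           open W \<and> z \<in> W \<and> C1_on W g \<and>
           (\<forall>w\<in>W. frechet_derivative g (at w) \<noteq> (\<lambda>_. 0)) \<and>
           (\<forall>w\<in>W. cover D w \<in> L \<longleftrightarrow> g w = 0)))"

definition area_form :: "real \<times> real \<Rightarrow> real \<times> real \<Rightarrow> real" where
  "area_form u v = fst u * snd v - snd u * fst v"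

text \<open>An isotopy of the annulus starting at the identity lifts uniquely to an isotopy of the plane
  which starts at the identity and commutes with the deck translation.\<close>

definition symplectic_isotopy :: "real \<Rightarrow> (real \<Rightarrow> real \<times> real \<Rightarrow> real \<times> real) \<Rightarrow> bool" where
  "symplectic_isotopy D \<Psi> \<longleftrightarrow>
     \<Psi> 0 = id \<and>
     C1_on ({0..1} \<times> UNIV) (\<lambda>(s, z). \<Psi> s z) \<and>
     (\<forall>s\<in>{0..1}.
        bij (\<Psi> s) \<and> C1_on UNIV (inv (\<Psi> s)) \<and>
        (\<forall>x y. \<Psi> s (x + 2 * D, y) = \<Psi> s (x, y) + (2 * D, 0)) \<and>
        (\<forall>z u v. area_form (frechet_derivative (\<Psi> s) (at z) u) (frechet_derivative (\<Psi> s) (at z) v)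
                 = area_form u v))"

definition isotopic_to_zero_section :: "real \<Rightarrow> (complex \<times> real) set \<Rightarrow> bool" where
  "isotopic_to_zero_section D L \<longleftrightarrow>
     (\<exists>\<Psi>. symplectic_isotopy D \<Psi> \<and> L = cover D ` \<Psi> 1 ` (UNIV \<times> {0}))"

definition C1_integrable_with ::
  "real \<Rightarrow> (real \<times> real \<Rightarrow> real \<times> real) \<Rightarrow> (complex \<times> real) set \<Rightarrow> bool" where
  "C1_integrable_with D F Q \<longleftrightarrow>
     is_global_attractor D F Q \<and> C1_submanifold D Q \<and> isotopic_to_zero_section D Q"

definition C1_integrable :: "real \<Rightarrow> (real \<times> real \<Rightarrow> real \<times> real) \<Rightarrow> bool" where
  "C1_integrable D F \<longleftrightarrow> (\<exists>Q. C1_integrable_with D F Q)"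

definition is_potential :: "real \<Rightarrow> real \<Rightarrow> (real \<Rightarrow> real) \<Rightarrow> bool" where
  "is_potential A B V \<longleftrightarrow>
     smooth V \<and> (\<forall>x. V (- x) = V x) \<and> range V \<subseteq> {-1..0} \<and>
     closure {x. V x \<noteq> 0} \<subseteq> {-B..B} \<and> (\<forall>x\<in>{-A..A}. V x = -1) \<and>
     antimono_on {-B..-A} V \<and> mono_on {A..B} V"

definition unstable_manifold :: "(real \<Rightarrow> real) \<Rightarrow> real \<Rightarrow> real set" where
  "unstable_manifold X p =
     {x. \<exists>\<gamma>. \<gamma> 0 = x \<and>
        (\<forall>t\<le>0. (\<gamma> has_real_derivative X (\<gamma> t)) (at t within {..0})) \<and>
        (\<gamma> \<longlongrightarrow> p) at_bot}"

text \<open>No upper bound is imposed on \<open>deriv X\<close>: the condition \<open>deriv X x < \<beta>\<close> on \<open>[-D,-B]\<close>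
  contradicts the other ones, see \<open>circle_field_steep\<close> below.\<close>

definition is_circle_field :: "real \<Rightarrow> real \<Rightarrow> real \<Rightarrow> real \<Rightarrow> (real \<Rightarrow> real) \<Rightarrow> bool" where
  "is_circle_field \<beta> B C D X \<longleftrightarrow>
     smooth X \<and> (\<forall>x. X (- x) = - X x) \<and>
     (\<forall>x \<in> {- ((D + C) / 2)..-B} \<union> {B..(C + D) / 2}. X x = - \<beta> * x) \<and>
     X (- D) = 0 \<and> X D = 0 \<and>
     (\<forall>n. (deriv ^^ n) X (- D) = (deriv ^^ n) X D) \<and>
     (\<forall>x\<in>{-D..-B}. - \<beta> \<le> deriv X x) \<and>
     {-D<..-B} \<subseteq> unstable_manifold X (- D) \<and> {B..<D} \<subseteq> unstable_manifold X D"

lemma circle_field_steep: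
  assumes "0 < \<beta>" "0 < B" "B < C" "C < D" "is_circle_field \<beta> B C D X"
  shows "\<exists>x\<in>{-D..-B}. \<beta> < deriv X x"
proof -
  let ?m = "- ((D + C) / 2)"
  have d: "(X has_real_derivative deriv X x) (at x)" for x
  proof -
    have "(deriv ^^ 0) X field_differentiable at x"
      using assms(5) unfolding is_circle_field_def smooth_def by blast
    then show ?thesis by (simp add: DERIV_deriv_iff_field_differentiable)
  qed
  have "- D < ?m" and mB: "?m < - B" using assms by auto
  then obtain x where x: "- D < x" "x < ?m" "X ?m - X (- D) = (?m - (- D)) * deriv X x"
    using MVT2[of "- D" ?m X "deriv X"] d by blast
  have "X ?m = - \<beta> * ?m" "X (- D) = 0"
    using assms(5) mB unfolding is_circle_field_def by auto
  with x(3) have e: "\<beta> * (D + C) = (D - C) * deriv X x" by (simp add: field_simps)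
  have "\<beta> < deriv X x"
  proof (rule ccontr)
    assume "\<not> \<beta> < deriv X x"
    then have "(D - C) * deriv X x \<le> (D - C) * \<beta>" using assms by (intro mult_left_mono) auto
    moreover have "0 < \<beta> * C" using assms by simp
    ultimately show False using e by (simp add: algebra_simps)
  qed
  moreover have "x \<in> {-D..-B}" using x(1) less_trans[OF x(2) mB] by simp
  ultimately show ?thesis by blast
qed

definition is_bump :: "real \<Rightarrow> real \<Rightarrow> real \<Rightarrow> real \<Rightarrow> (real \<Rightarrow> real) \<Rightarrow> bool" where
  "is_bump \<alpha> \<beta> B C \<eta> \<longleftrightarrow>
     smooth \<eta> \<and> (\<forall>x. \<eta> (- x) = \<eta> x) \<and> range \<eta> \<subseteq> {0..1} \<and>
     closure {x. \<eta> x \<noteq> 0} \<subseteq> {-C..C} \<and> (\<forall>x\<in>{-B..B}. \<eta> x = 1) \<and>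
     (\<forall>x\<in>{-C..-B}. 0 \<le> deriv \<eta> x \<and> deriv \<eta> x < 2 * (\<alpha> - \<beta>) / (- \<beta> * x))"

definition H :: "real \<Rightarrow> real \<times> real \<Rightarrow> real" where
  "H \<beta> = (\<lambda>(x, y). y\<^sup>2 - \<beta> * x * y)"

definition H_field :: "(real \<Rightarrow> real) \<Rightarrow> real \<times> real \<Rightarrow> real" where
  "H_field X = (\<lambda>(x, y). 1 / 2 * y * (y + 2 * X x))"

definition K_plane ::
  "real \<Rightarrow> (real \<Rightarrow> real) \<Rightarrow> (real \<Rightarrow> real) \<Rightarrow> (real \<Rightarrow> real) \<Rightarrow> real \<times> real \<Rightarrow> real" where
  "K_plane \<beta> V X \<eta> =
     (\<lambda>(x, y). (1 - \<eta> x) * H_field X (x, y) + \<eta> x * (H \<beta> (x, y) + V x))"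

definition planar_field :: "real \<Rightarrow> real \<Rightarrow> (real \<Rightarrow> real) \<Rightarrow> real \<times> real \<Rightarrow> real \<times> real" where
  "planar_field \<alpha> \<beta> V = (\<lambda>(x, y). (- \<beta> * x + 2 * y, - deriv V x + (\<beta> - \<alpha>) * y))"

definition orbit :: "(real \<times> real \<Rightarrow> real \<times> real) \<Rightarrow> real \<times> real \<Rightarrow> (real \<times> real) set" where
  "orbit F z =
     {w. \<exists>\<gamma> t. (\<forall>s. (\<gamma> has_vector_derivative F (\<gamma> s)) (at s)) \<and> \<gamma> 0 = z \<and> \<gamma> t = w}"

text \<open>The orbits which coincide with the \<open>x\<close>-axis for \<open>x \<le> -B\<close> and for \<open>x \<ge> B\<close> are those of
  \<open>(-B, 0)\<close> and \<open>(B, 0)\<close>.\<close>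

definition \<Gamma> :: "real \<Rightarrow> real \<Rightarrow> real \<Rightarrow> (real \<Rightarrow> real) \<Rightarrow> (real \<times> real) set" where
  "\<Gamma> \<alpha> \<beta> B V =
     orbit (planar_field \<alpha> \<beta> V) (- B, 0) \<union> orbit (planar_field \<alpha> \<beta> V) (B, 0) \<union> {(0, 0)}"

definition attracting_curve ::
  "real \<Rightarrow> real \<Rightarrow> real \<Rightarrow> real \<Rightarrow> (real \<Rightarrow> real) \<Rightarrow> (complex \<times> real) set" where
  "attracting_curve \<alpha> \<beta> B D V =
     cover D ` (({-D..-B} \<union> {B..D}) \<times> {0} \<union> \<Gamma> \<alpha> \<beta> B V \<inter> {-B..B} \<times> UNIV)"

end

theory Submission
  imports Defs
begin

text \<open>
  Over one period of the base circle the Hamiltonian has the normal form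
  \<open>K(x,y) = m(x) y\<^sup>2/2 + a(x) y + b(x)\<close> with \<open>1 \<le> m \<le> 2\<close>, \<open>m\<close> and \<open>b \<le> 0\<close> even and \<open>a\<close> odd:
  \<open>m = 1 + \<eta>\<close>, \<open>b = V\<close>, and \<open>a\<close> is \<open>-\<beta>x\<close> near the origin and \<open>X\<close> near the
  point \<open>x = D\<close> of the circle. Two dissipation laws govern the conformal flow.

  Convexity in \<open>y\<close> gives \<open>dK/dt = -\<alpha> y K\<^sub>y \<le> -\<alpha> K\<close>. Hence every solution exists for all
  positive time, \<open>{K < 1}\<close> is an absorbing neighbourhood, and complete bounded solutions stay in
  \<open>{K \<le> 0}\<close>. On the fibre \<open>x = D\<close> that set contains only the saddle \<open>(D,0)\<close>, so the
  complete bounded solutions live in a planar strip.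

  In the coordinates \<open>(x, x')\<close> the equation is a damped Newton equation. With
  \<open>P' = a/m\<close>, which has a periodic primitive because \<open>a/m\<close> is odd, the energy
  \<open>E = K - \<alpha>P = x'\<^sup>2/(2m) + W(x)\<close> satisfies \<open>dE/dt = -\<alpha> x'\<^sup>2/m\<close>, and \<open>W\<close> decreases on
  \<open>[-D,0]\<close> and increases on \<open>[0,D]\<close> (lemma \<open>W1_neg\<close>; the bound on \<open>\<eta>'\<close> is what makes this
  true where \<open>\<eta>\<close> varies). The only equilibria are the sink \<open>0\<close> and the saddle. By LaSalle's
  principle (\<open>limit_equilibrium\<close>) every solution accumulates on them in the future. In the past, a
  complete bounded solution other than \<open>0\<close> accumulates on the saddle; then \<open>E\<close> tends to \<open>0\<close>, and since
  \<open>K \<le> 0\<close> means \<open>\<alpha>P \<le> -E\<close>, it stays close to \<open>x = \<plusminus>D\<close>. There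
  \<open>y' = -(\<alpha> + a')y\<close> with \<open>\<alpha> + a' > 0\<close>, so boundedness in the past forces \<open>y = 0\<close>: the solution lies on
  the unstable manifold of the saddle. That manifold together with the two equilibria is exactly the
  curve, which is therefore the global attractor (\<open>curve_is_global_attractor\<close>).

  For the shape of the curve, follow the orbit of \<open>(-B,0)\<close>. While \<open>-B \<le> x \<le> -A\<close> the potential
  kicks \<open>y\<close> up to some \<open>h\<close> with \<open>0 < h \<le> 1/(\<beta>A)\<close>, and the orbit is a graph over \<open>x\<close>; it is steep
  if \<open>B - A\<close> is small. Then it enters the region where the system is linear, with
  a node at \<open>0\<close> whose slow direction has positive slope because \<open>\<alpha> < 2\<beta>\<close>; there it is a graph over
  \<open>y\<close>, \<open>x = \<psi>(y)\<close>, crosses the \<open>y\<close>-axis at some \<open>y > 0\<close> and comes back to \<open>0\<close> along the slow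
  direction. So the curve meets a fibre twice (\<open>loop_not_graph\<close>). It is the image of the zero
  section under three shears: a vertical, a horizontal linear and another vertical one
  (\<open>loop_is_sheared_section\<close>). Undoing the last vertical shear flattens the steep part;
  for large \<open>A\<close> its profile is gentle between \<open>-A\<close> and \<open>A\<close>, so that undoing the linear shear then turns
  what is left into a graph.
  Scaling the shears gives the symplectic isotopy, and its inverse gives \<open>C\<^sup>1\<close> equations for the
  curve.
\<close>

section \<open>Solutions of autonomous differential equations\<close>

definition solves :: "('a::real_normed_vector \<Rightarrow> 'a) \<Rightarrow> (real \<Rightarrow> 'a) \<Rightarrow> real set \<Rightarrow> bool" where
  "solves f \<gamma> S \<longleftrightarrow> (\<forall>t\<in>S. (\<gamma> has_vector_derivative f (\<gamma> t)) (at t within S))"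

lemma solves_subset: "solves f \<gamma> S \<Longrightarrow> T \<subseteq> S \<Longrightarrow> solves f \<gamma> T"
  unfolding solves_def by (meson has_vector_derivative_within_subset subsetD)

lemma solves_continuous_on: "solves f \<gamma> S \<Longrightarrow> continuous_on S \<gamma>"
  unfolding solves_def by (meson continuous_on_vector_derivative)

lemma solves_cong:
  assumes "solves f \<gamma> S" "\<And>t. t \<in> S \<Longrightarrow> f (\<gamma> t) = g (\<gamma> t)"
  shows "solves g \<gamma> S"
  using assms unfolding solves_def by simp

lemma solves_shift:
  assumes "solves f \<gamma> S" "\<And>t. t \<in> T \<Longrightarrow> t + c \<in> S"
  shows "solves f (\<lambda>t. \<gamma> (t + c)) T"
proof -
  have "((\<lambda>t. \<gamma> (t + c)) has_vector_derivative f (\<gamma> (t + c))) (at t within T)" if "t \<in> T" for t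
  proof -
    have 1: "(\<gamma> has_vector_derivative f (\<gamma> (t + c))) (at (t + c) within (\<lambda>t. t + c) ` T)"
      using assms that unfolding solves_def
      by (meson has_vector_derivative_within_subset image_subsetI)
    have 2: "((\<lambda>t. t + c) has_real_derivative 1) (at t within T)"
      by (auto intro!: derivative_eq_intros)
    show ?thesis
      using vector_diff_chain_within[OF 2[unfolded has_real_derivative_iff_has_vector_derivative] 1]
      by (simp add: o_def)
  qed
  then show ?thesis by (simp add: solves_def)
qed

lemma solves_reverse:
  assumes "solves f \<gamma> S"
  shows "solves (\<lambda>x. - f x) (\<lambda>t. \<gamma> (- t)) (uminus ` S)"
proof -
  have "((\<lambda>t. \<gamma> (- t)) has_vector_derivative - f (\<gamma> (- t))) (at t within uminus ` S)"
    if "t \<in> uminus ` S" for t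
  proof -
    have im: "uminus ` uminus ` S = S" by (auto simp: image_image)
    have 1: "(\<gamma> has_vector_derivative f (\<gamma> (- t))) (at (- t) within uminus ` uminus ` S)"
      using assms that unfolding solves_def im by auto
    have 2: "(uminus has_real_derivative - 1) (at t within uminus ` S)"
      by (auto intro!: derivative_eq_intros)
    show ?thesis
      using vector_diff_chain_within[OF 2[unfolded has_real_derivative_iff_has_vector_derivative] 1]
      by (simp add: o_def)
  qed
  then show ?thesis by (simp add: solves_def)
qed

text \<open>The quantity \<open>exp (-2Lt) |\<gamma> - \<delta>|\<^sup>2\<close> is non-increasing. Only the values of the field along the
two solutions are compared, so a field that is Lipschitz on a strip can be treated like a globally Lipschitz one.\<close>

lemma gronwall:
  fixes \<gamma> \<delta> :: "real \<Rightarrow> 'a::real_inner"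
  assumes "solves f \<gamma> {a..b}" "solves f \<delta> {a..b}"
    and lip: "\<And>t. t \<in> {a..b} \<Longrightarrow> norm (f (\<gamma> t) - f (\<delta> t)) \<le> L * norm (\<gamma> t - \<delta> t)"
    and t: "t \<in> {a..b}"
  shows "norm (\<gamma> t - \<delta> t) \<le> exp (L * (t - a)) * norm (\<gamma> a - \<delta> a)"
proof -
  define u where "u s = \<gamma> s - \<delta> s" for s
  define w where "w s = exp (- 2 * L * s) * (u s \<bullet> u s)" for s
  have ud: "(u has_vector_derivative f (\<gamma> s) - f (\<delta> s)) (at s within {a..b})" if "s \<in> {a..b}" for s
    using assms(1,2) that unfolding solves_def u_def by (auto intro!: derivative_intros)
  have wd: "(w has_real_derivative exp (- 2 * L * s) * (2 * (u s \<bullet> (f (\<gamma> s) - f (\<delta> s))) - 2 * L * (u s \<bullet> u s)))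
      (at s within {a..b})" if "s \<in> {a..b}" for s
  proof -
    have "((\<lambda>s. u s \<bullet> u s) has_derivative (\<lambda>h. u s \<bullet> (h *\<^sub>R (f (\<gamma> s) - f (\<delta> s))) +
       (h *\<^sub>R (f (\<gamma> s) - f (\<delta> s))) \<bullet> u s)) (at s within {a..b})"
      using ud[OF that] unfolding has_vector_derivative_def by (intro has_derivative_inner)
    then have "((\<lambda>s. u s \<bullet> u s) has_real_derivative 2 * (u s \<bullet> (f (\<gamma> s) - f (\<delta> s)))) (at s within {a..b})"
      unfolding has_field_derivative_def
      by (rule has_derivative_eq_rhs) (auto simp: fun_eq_iff inner_commute algebra_simps)
    then show ?thesis unfolding w_def
      by (auto intro!: derivative_eq_intros simp: algebra_simps)
  qed
  have neg: "exp (- 2 * L * s) * (2 * (u s \<bullet> (f (\<gamma> s) - f (\<delta> s))) - 2 * L * (u s \<bullet> u s)) \<le> 0"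
    if "s \<in> {a..b}" for s
  proof -
    have "u s \<bullet> (f (\<gamma> s) - f (\<delta> s)) \<le> norm (u s) * norm (f (\<gamma> s) - f (\<delta> s))"
      by (rule norm_cauchy_schwarz)
    also have "\<dots> \<le> norm (u s) * (L * norm (u s))"
      using lip[OF that] by (intro mult_left_mono) (auto simp: u_def)
    finally have "u s \<bullet> (f (\<gamma> s) - f (\<delta> s)) \<le> L * (u s \<bullet> u s)"
      by (simp add: dot_square_norm power2_eq_square algebra_simps)
    then show ?thesis by (intro mult_nonneg_nonpos) auto
  qed
  have "w t \<le> w a"
  proof (rule DERIV_nonpos_imp_decreasing_open[where f = w])
    show "a \<le> t" using t by simp
    show "\<exists>y. (w has_real_derivative y) (at s) \<and> y \<le> 0" if "a < s" "s < t" for s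
    proof -
      have "at s within {a..b} = at s" using that t by (intro at_within_interior) auto
      then show ?thesis using wd[of s] neg[of s] that t by auto
    qed
    have "continuous_on {a..b} w" by (rule DERIV_continuous_on) (use wd in blast)
    then show "continuous_on {a..t} w" by (rule continuous_on_subset) (use t in auto)
  qed
  then have "exp (2 * L * t) * w t \<le> exp (2 * L * t) * w a" by simp
  moreover have "exp (2 * L * t) * w t = (norm (u t))\<^sup>2"
    unfolding w_def mult.assoc[symmetric] exp_add[symmetric] by (simp add: dot_square_norm)
  moreover have "exp (2 * L * t) * w a = (exp (L * (t - a)))\<^sup>2 * (norm (u a))\<^sup>2"
    unfolding w_def mult.assoc[symmetric] exp_add[symmetric] exp_double[symmetric]
    by (simp add: dot_square_norm algebra_simps)
  ultimately have "(norm (u t))\<^sup>2 \<le> (exp (L * (t - a)) * norm (u a))\<^sup>2"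
    by (simp add: power_mult_distrib)
  then show ?thesis unfolding u_def by (rule power2_le_imp_le) auto
qed

lemma solves_unique:
  fixes \<gamma> \<delta> :: "real \<Rightarrow> 'a::real_inner"
  assumes "solves f \<gamma> S" "solves f \<delta> S" "is_interval S" "t0 \<in> S" "t \<in> S" "\<gamma> t0 = \<delta> t0"
    and lip: "\<And>t. t \<in> S \<Longrightarrow> norm (f (\<gamma> t) - f (\<delta> t)) \<le> L * norm (\<gamma> t - \<delta> t)"
  shows "\<gamma> t = \<delta> t"
proof (cases "t0 \<le> t")
  case True
  have sub: "{t0..t} \<subseteq> S" using assms(3,4,5) by (meson atLeastAtMost_iff mem_is_interval_1_I subsetI)
  have "norm (\<gamma> t - \<delta> t) \<le> exp (L * (t - t0)) * norm (\<gamma> t0 - \<delta> t0)"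
    by (rule gronwall[of f \<gamma> t0 t \<delta> L])
       (use True sub assms solves_subset in \<open>auto intro!: lip\<close>)
  then show ?thesis using assms(6) by simp
next
  case False
  have sub: "{t..t0} \<subseteq> S" using assms(3,4,5) by (meson atLeastAtMost_iff mem_is_interval_1_I subsetI)
  have im: "uminus ` {t..t0} = {-t0..-t}" by simp
  have "solves (\<lambda>x. - f x) (\<lambda>t. \<gamma> (- t)) {-t0..-t}" "solves (\<lambda>x. - f x) (\<lambda>t. \<delta> (- t)) {-t0..-t}"
    using solves_reverse[of f _ "{t..t0}"] assms(1,2) sub solves_subset unfolding im by blast+
  moreover have "norm (- f (\<gamma> (- s)) - - f (\<delta> (- s))) \<le> L * norm (\<gamma> (- s) - \<delta> (- s))"
    if "s \<in> {-t0..-t}" for s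
    using lip[of "- s"] sub that by (simp add: norm_minus_commute subset_iff)
  ultimately have "norm (\<gamma> (- (- t)) - \<delta> (- (- t))) \<le> exp (L * (- t - (- t0))) * norm (\<gamma> (- (- t0)) - \<delta> (- (- t0)))"
    using gronwall[of "\<lambda>x. - f x" "\<lambda>t. \<gamma> (- t)" "-t0" "-t" "\<lambda>t. \<delta> (- t)" L "-t"] False by auto
  then show ?thesis using assms(6) by simp
qed

lemma exp_weight_mult_le:
  assumes "0 < (l::real)" "0 \<le> t" shows "exp (- l * t) * t \<le> 1 / l"
proof -
  have "l * t \<le> exp (l * t)" using exp_ge_add_one_self[of "l * t"] by linarith
  then have "exp (- l * t) * (l * t) \<le> exp (- l * t) * exp (l * t)" by (intro mult_left_mono) auto
  also have "exp (- l * t) * exp (l * t) = exp (- l * t + l * t)" by (rule exp_add[symmetric])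
  also have "- l * t + l * t = 0" by simp
  also have "exp 0 = (1::real)" by (rule exp_zero)
  finally have "(exp (- l * t) * t) * l \<le> 1" by (metis mult.assoc mult.commute)
  then show ?thesis using assms by (simp only: pos_le_divide_eq)
qed

lemma exp_weight_integral:
  assumes "0 < (l::real)" "0 \<le> t"
  shows "((\<lambda>s. exp (l * s)) has_integral (exp (l * t) - 1) / l) {0..t}"
proof -
  have "((\<lambda>s. exp (l * s)) has_integral (exp (l * t) / l - exp (l * 0) / l)) {0..t}"
    using assms
    by (intro fundamental_theorem_of_calculus)
       (auto intro!: derivative_eq_intros simp: has_real_derivative_iff_has_vector_derivative[symmetric])
  then show ?thesis by (simp add: diff_divide_distrib)
qed

text \<open>Picard's integral operator, written for \<open>u(t) = exp (-lt) \<gamma>(t)\<close> with \<open>l \<ge> 2L\<close>: the exponential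
weight makes it a contraction on bounded continuous functions on the whole half line, so that no continuation
argument is needed.\<close>

lemma forward_solution_exists:
  fixes f :: "'a::banach \<Rightarrow> 'a"
  assumes lip: "\<And>x y. norm (f x - f y) \<le> L * norm (x - y)"
  shows "\<exists>\<gamma>. \<gamma> 0 = z \<and> solves f \<gamma> {0..}"
proof -
  define l where "l = 2 * (\<bar>L\<bar> + 1)"
  have l: "0 < l" "\<bar>L\<bar> \<le> l / 2" by (auto simp: l_def)
  have lip': "norm (f x - f y) \<le> l / 2 * norm (x - y)" for x y
    by (rule order_trans[OF lip]) (intro mult_right_mono, use l in auto)
  have contf: "continuous_on S f" for S
  proof -
    have "(l/2)-lipschitz_on S f"
      by (rule lipschitz_onI) (use lip' l in \<open>auto simp: dist_norm\<close>)
    then show ?thesis by (rule lipschitz_on_continuous_on)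
  qed
  define e where "e t = exp (- l * max 0 t)" for t :: real
  define I where "I u t = integral {0..t} (\<lambda>s. f (exp (l * s) *\<^sub>R u s))" for u :: "real \<Rightarrow> 'a" and t
  have cont_in: "continuous_on S (\<lambda>s. f (exp (l * s) *\<^sub>R apply_bcontfun u s))" for u S
  proof -
    have "continuous_on S (apply_bcontfun u)" by (rule continuous_on_apply_bcontfun)
    then have "continuous_on S (\<lambda>s. exp (l * s) *\<^sub>R apply_bcontfun u s)"
      by (intro continuous_intros)
    then show ?thesis
      using continuous_on_compose2[OF contf[of UNIV]] by blast
  qed
  have Ider: "((\<lambda>t. I (apply_bcontfun u) t) has_vector_derivative f (exp (l * t) *\<^sub>R apply_bcontfun u t))
      (at t within {0..b})" if "t \<in> {0..b}" for u t b
    unfolding I_def by (rule integral_has_vector_derivative[OF cont_in that])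
  have Icont: "continuous_on UNIV (\<lambda>t. I (apply_bcontfun u) (max 0 t))" for u
  proof -
    have "continuous_on {0..b} (\<lambda>t. I (apply_bcontfun u) t)" for b
      by (rule continuous_on_vector_derivative) (use Ider in blast)
    then have "continuous_on {..<b} (\<lambda>t. I (apply_bcontfun u) (max 0 t))" if "0 < b" for b
      by (rule continuous_on_compose2[where s="{..<b}" and f = "\<lambda>t. max 0 t" and t="{0..b}"]) (use that in \<open>auto intro!: continuous_intros\<close>)
    then have "isCont (\<lambda>t. I (apply_bcontfun u) (max 0 t)) t" for t
      by (rule continuous_on_interior[where S="{..<\<bar>t\<bar>+1}"]) (auto simp: interior_open)
    then show ?thesis by (simp add: continuous_at_imp_continuous_on)
  qed
  have Ibound: "norm (I u t - I v t) \<le> d / 2 * exp (l * t)"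
    if "0 \<le> t" "\<And>s. norm (u s - v s) \<le> d" "continuous_on {0..t} (\<lambda>s. f (exp (l * s) *\<^sub>R u s))"
      "continuous_on {0..t} (\<lambda>s. f (exp (l * s) *\<^sub>R v s))" for u v t d
  proof -
    have d0: "0 \<le> d" using that(2)[of 0] norm_ge_zero order_trans by blast
    have "I u t - I v t = integral {0..t} (\<lambda>s. f (exp (l * s) *\<^sub>R u s) - f (exp (l * s) *\<^sub>R v s))"
      unfolding I_def by (rule integral_diff[symmetric]) (use that in \<open>auto intro!: integrable_continuous_interval\<close>)
    also have "norm \<dots> \<le> integral {0..t} (\<lambda>s. l / 2 * d * exp (l * s))"
    proof (rule integral_norm_bound_integral)
      show "(\<lambda>s. f (exp (l * s) *\<^sub>R u s) - f (exp (l * s) *\<^sub>R v s)) integrable_on {0..t}"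
        using that by (auto intro!: integrable_continuous_interval continuous_intros)
      show "(\<lambda>s. l / 2 * d * exp (l * s)) integrable_on {0..t}"
        by (auto intro!: integrable_continuous_interval continuous_intros)
      show "norm (f (exp (l * s) *\<^sub>R u s) - f (exp (l * s) *\<^sub>R v s)) \<le> l / 2 * d * exp (l * s)" for s
      proof -
        have "norm (f (exp (l * s) *\<^sub>R u s) - f (exp (l * s) *\<^sub>R v s)) \<le> l / 2 * (exp (l * s) * norm (u s - v s))"
          using lip'[of "exp (l * s) *\<^sub>R u s" "exp (l * s) *\<^sub>R v s"]
          by (simp add: scaleR_diff_right[symmetric])
        also have "\<dots> \<le> l / 2 * (exp (l * s) * d)"
          using that(2) l by (intro mult_left_mono) auto
        finally show ?thesis by (simp add: algebra_simps)
      qed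
    qed
    also have "\<dots> = l / 2 * d * ((exp (l * t) - 1) / l)"
      using exp_weight_integral[OF l(1) that(1)] by (simp add: integral_unique)
    also have "\<dots> = d / 2 * (exp (l * t) - 1)" using l by (simp add: field_simps)
    also have "\<dots> \<le> d / 2 * exp (l * t)" using d0 by (intro mult_left_mono) auto
    finally show ?thesis .
  qed
  define G where "G u t = e t *\<^sub>R (z + I (apply_bcontfun u) (max 0 t))" for u t
  have contG: "continuous_on UNIV (G u)" for u
    unfolding G_def e_def by (intro continuous_intros Icont)
  have diff: "norm (G u t - G v t) \<le> dist u v / 2" for u v t
  proof -
    have "norm (I (apply_bcontfun u) (max 0 t) - I (apply_bcontfun v) (max 0 t)) \<le> dist u v / 2 * exp (l * max 0 t)"
      by (rule Ibound) (auto simp: dist_norm[symmetric] intro!: dist_bounded cont_in)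
    then have "e t * norm (I (apply_bcontfun u) (max 0 t) - I (apply_bcontfun v) (max 0 t)) \<le> e t * (dist u v / 2 * exp (l * max 0 t))"
      by (intro mult_left_mono) (auto simp: e_def)
    also have "\<dots> = dist u v / 2" by (simp add: e_def exp_minus field_simps)
    finally show ?thesis by (simp add: G_def scaleR_diff_right[symmetric] e_def)
  qed
  have G0: "norm (G 0 t) \<le> norm z + norm (f 0) / l" for t
  proof -
    have "I (apply_bcontfun 0) (max 0 t) = max 0 t *\<^sub>R f 0" by (simp add: I_def)
    then have "G 0 t = e t *\<^sub>R z + (e t * max 0 t) *\<^sub>R f 0"
      by (simp add: G_def scaleR_add_right)
    then have "norm (G 0 t) \<le> norm (e t *\<^sub>R z) + norm ((e t * max 0 t) *\<^sub>R f 0)"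
      by (simp only: norm_triangle_ineq)
    also have "\<dots> = e t * norm z + e t * max 0 t * norm (f 0)"
      by (simp add: e_def abs_mult)
    also have "\<dots> \<le> 1 * norm z + 1 / l * norm (f 0)"
      using exp_weight_mult_le[OF l(1), of "max 0 t"] l(1)
      by (intro add_mono mult_right_mono) (auto simp: e_def)
    finally show ?thesis by simp
  qed
  have Gb: "G u \<in> bcontfun" for u
  proof -
    have "norm (G u t) \<le> (norm z + norm (f 0) / l) + dist u 0 / 2" for t
      using diff[of u t 0] G0[of t] norm_triangle_ineq[of "G u t - G 0 t" "G 0 t"] by simp
    then have "bounded (range (G u))" by (auto simp: bounded_iff)
    then show ?thesis using contG by (simp add: bcontfun_def)
  qed
  define \<Phi> where "\<Phi> u = Bcontfun (G u)" for u
  have ap: "apply_bcontfun (\<Phi> u) = G u" for u by (simp add: \<Phi>_def Bcontfun_inverse Gb)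
  \<comment> \<open>\<open>\<Phi>\<close> halves distances: the weight turns the Lipschitz constant into \<open>(l/2)/l\<close>.\<close>
  have "\<exists>!u. \<Phi> u = u"
  proof (rule banach_fix_type)
    show "\<forall>u v. dist (\<Phi> u) (\<Phi> v) \<le> 1/2 * dist u v"
      by (intro allI dist_bound) (use diff in \<open>simp add: ap dist_norm\<close>)
  qed auto
  then obtain u where u: "\<Phi> u = u" by blast
  define \<gamma> where "\<gamma> t = exp (l * t) *\<^sub>R apply_bcontfun u t" for t
  have \<gamma>: "\<gamma> t = z + I (apply_bcontfun u) t" if "0 \<le> t" for t
  proof -
    have "\<gamma> t = exp (l * t) *\<^sub>R G u t" using ap[of u] u by (simp add: \<gamma>_def)
    also have "\<dots> = z + I (apply_bcontfun u) t"
      using that by (simp add: G_def e_def exp_minus scaleR_scaleR[symmetric] max_absorb2)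
    finally show ?thesis .
  qed
  have "(\<gamma> has_vector_derivative f (\<gamma> t)) (at t within {0..})" if "t \<in> {0..}" for t
  proof -
    have t: "0 \<le> t" using that by simp
    have "((\<lambda>t. z + I (apply_bcontfun u) t) has_vector_derivative f (\<gamma> t)) (at t within {0..t+1})"
      unfolding \<gamma>_def using Ider[of t "t+1" u] t by (auto intro!: derivative_eq_intros)
    then have "(\<gamma> has_vector_derivative f (\<gamma> t)) (at t within {0..t+1})"
      by (rule has_vector_derivative_transform[rotated 2]) (use t \<gamma> in auto)
    moreover have "at t within {0..t+1} = at t within {0..}"
      by (rule at_within_nhd[where S="{..<t+1}"]) auto
    ultimately show ?thesis by simp
  qed
  moreover have "\<gamma> 0 = z" using \<gamma>[of 0] by (simp add: I_def)
  ultimately show ?thesis unfolding solves_def by blast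
qed

lemma has_vector_derivative_glue:
  assumes "(f has_vector_derivative d) (at c within {..c})"
    and "(g has_vector_derivative d) (at c within {c..})" and "f c = g c"
  shows "((\<lambda>t::real. if t \<le> c then f t else g t) has_vector_derivative d) (at c)"
proof -
  let ?h = "\<lambda>t::real. if t \<le> c then f t else g t"
  have "(?h has_vector_derivative d) (at c within {..c})"
    by (rule has_vector_derivative_transform[OF _ _ assms(1)]) auto
  moreover have "(?h has_vector_derivative d) (at c within {c..})"
    by (rule has_vector_derivative_transform[OF _ _ assms(2)]) (use assms(3) in auto)
  ultimately have "(?h has_vector_derivative d) (at c within {..c} \<union> {c..})"
    unfolding has_vector_derivative_def has_derivative_within
    by (auto simp: at_within_union has_derivative_within intro: filterlim_sup)
  moreover have "{..c} \<union> {c..} = UNIV" by auto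
  ultimately show ?thesis by simp
qed

lemma solves_glue:
  assumes "solves f \<gamma> {..0}" "solves f \<delta> {0..}" "\<gamma> 0 = \<delta> 0"
  shows "solves f (\<lambda>t. if t \<le> 0 then \<gamma> t else \<delta> t) UNIV"
proof -
  let ?g = "\<lambda>t. if t \<le> 0 then \<gamma> t else \<delta> t"
  have "(?g has_vector_derivative f (?g t)) (at t)" for t
  proof -
    consider "t < 0" | "t = 0" | "0 < t" by linarith
    then show ?thesis
    proof cases
      case 1
      have "(\<gamma> has_vector_derivative f (\<gamma> t)) (at t within {..0})"
        using assms(1) 1 unfolding solves_def by auto
      then have "(\<gamma> has_vector_derivative f (\<gamma> t)) (at t within {..<0})"
        by (rule has_vector_derivative_within_subset) auto
      then have "(?g has_vector_derivative f (\<gamma> t)) (at t within {..<0})"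
        by (rule has_vector_derivative_transform[rotated 2]) (use 1 in auto)
      then show ?thesis using 1 by (simp add: at_within_open[of t "{..<0}"])
    next
      case 2
      have "(\<gamma> has_vector_derivative f (\<gamma> 0)) (at 0 within {..0})"
        using assms(1) by (simp add: solves_def)
      moreover have "(\<delta> has_vector_derivative f (\<gamma> 0)) (at 0 within {0..})"
        using assms(2,3) by (simp add: solves_def)
      ultimately have "(?g has_vector_derivative f (\<gamma> 0)) (at 0)"
        using assms(3) by (rule has_vector_derivative_glue)
      then show ?thesis using 2 by simp
    next
      case 3
      have "(\<delta> has_vector_derivative f (\<delta> t)) (at t within {0..})"
        using assms(2) 3 unfolding solves_def by auto
      then have "(\<delta> has_vector_derivative f (\<delta> t)) (at t within {0<..})"
        by (rule has_vector_derivative_within_subset) auto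
      then have "(?g has_vector_derivative f (\<delta> t)) (at t within {0<..})"
        by (rule has_vector_derivative_transform[rotated 2]) (use 3 in auto)
      then show ?thesis using 3 by (simp add: at_within_open[of t "{0<..}"])
    qed
  qed
  then show ?thesis by (simp add: solves_def)
qed

text \<open>The past is the future of the reversed field.\<close>

lemma solution_exists:
  fixes f :: "'a::banach \<Rightarrow> 'a"
  assumes lip: "\<And>x y. norm (f x - f y) \<le> L * norm (x - y)"
  shows "\<exists>\<gamma>. \<gamma> 0 = z \<and> solves f \<gamma> UNIV"
proof -
  obtain \<gamma>1 where g1: "\<gamma>1 0 = z" "solves f \<gamma>1 {0..}"
    using forward_solution_exists[OF lip] by blast
  have "norm (- f x - - f y) \<le> L * norm (x - y)" for x y
    using lip[of y x] by (simp add: norm_minus_commute)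
  then obtain \<gamma>2 where g2: "\<gamma>2 0 = z" "solves (\<lambda>x. - f x) \<gamma>2 {0..}"
    using forward_solution_exists[of "\<lambda>x. - f x"] by blast
  have g3: "solves f (\<lambda>t. \<gamma>2 (- t)) {..0}"
    using solves_reverse[OF g2(2)] by (simp add: image_uminus_atLeast)
  have "solves f (\<lambda>t. if t \<le> 0 then \<gamma>2 (- t) else \<gamma>1 t) UNIV"
    by (rule solves_glue[OF g3 g1(2)]) (simp add: g1 g2)
  then show ?thesis using g2(1) by (intro exI[of _ "\<lambda>t. if t \<le> 0 then \<gamma>2 (- t) else \<gamma>1 t"]) simp
qed

section \<open>Functions of class \<open>C\<^sup>1\<close>\<close>

lemma has_real_derivative_glue:
  fixes f g :: "real \<Rightarrow> real"
  assumes "(f has_real_derivative d) (at c)" "(g has_real_derivative d) (at c)" "f c = g c"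
  shows "((\<lambda>t. if t \<le> c then f t else g t) has_real_derivative d) (at c)"
  using assms has_vector_derivative_glue[of f d c g]
  by (auto simp: has_real_derivative_iff_has_vector_derivative intro: has_vector_derivative_at_within)

lemma C1_on_const: "C1_on S (\<lambda>_. c)"
  unfolding C1_on_def by (intro exI[of _ "\<lambda>_. 0"]) (auto simp: zero_blinfun.rep_eq)

lemma C1_on_linear_compose:
  assumes "bounded_linear L" "C1_on S f"
  shows "C1_on S (\<lambda>z. L (f z))"
proof -
  obtain f' where f': "\<And>z. z \<in> S \<Longrightarrow> (f has_derivative blinfun_apply (f' z)) (at z within S)"
    "continuous_on S f'" using assms(2) unfolding C1_on_def by blast
  have "((\<lambda>z. L (f z)) has_derivative blinfun_apply (Blinfun L o\<^sub>L f' z)) (at z within S)" if "z \<in> S" for z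
    by (rule has_derivative_eq_rhs[OF bounded_linear.has_derivative[OF assms(1) f'(1)[OF that]]])
       (simp add: bounded_linear_Blinfun_apply[OF assms(1)] fun_eq_iff)
  moreover have "continuous_on S (\<lambda>z. Blinfun L o\<^sub>L f' z)"
    by (rule bounded_bilinear.continuous_on[OF bounded_bilinear_blinfun_compose continuous_on_const f'(2)])
  ultimately show ?thesis unfolding C1_on_def
    by (intro exI[of _ "\<lambda>z. Blinfun L o\<^sub>L f' z"]) blast
qed

lemma C1_on_linear: assumes "bounded_linear L" shows "C1_on S L"
proof -
  have "C1_on S (\<lambda>z. z)"
    unfolding C1_on_def by (intro exI[of _ "\<lambda>_. id_blinfun"]) auto
  from C1_on_linear_compose[OF assms this] show ?thesis .
qed

lemma C1_on_add:
  assumes "C1_on S f" "C1_on S g" shows "C1_on S (\<lambda>z. f z + g z)"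
proof -
  obtain f' g' where "\<And>z. z \<in> S \<Longrightarrow> (f has_derivative blinfun_apply (f' z)) (at z within S)"
    "continuous_on S f'" "\<And>z. z \<in> S \<Longrightarrow> (g has_derivative blinfun_apply (g' z)) (at z within S)"
    "continuous_on S g'" using assms unfolding C1_on_def by blast
  then show ?thesis unfolding C1_on_def
    by (intro exI[of _ "\<lambda>z. f' z + g' z"])
       (auto simp: plus_blinfun.rep_eq intro!: continuous_intros has_derivative_add)
qed

lemma C1_on_mult:
  fixes f g :: "'a::real_normed_vector \<Rightarrow> real"
  assumes "C1_on S f" "C1_on S g" shows "C1_on S (\<lambda>z. f z * g z)"
proof -
  obtain f' g' where d: "\<And>z. z \<in> S \<Longrightarrow> (f has_derivative blinfun_apply (f' z)) (at z within S)"
    "continuous_on S f'" "\<And>z. z \<in> S \<Longrightarrow> (g has_derivative blinfun_apply (g' z)) (at z within S)"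
    "continuous_on S g'" using assms unfolding C1_on_def by blast
  have c: "continuous_on S f" "continuous_on S g"
    by (rule has_derivative_continuous_on[OF d(1)], assumption)
       (rule has_derivative_continuous_on[OF d(3)], assumption)
  have "((\<lambda>z. f z * g z) has_derivative blinfun_apply (f z *\<^sub>R g' z + g z *\<^sub>R f' z)) (at z within S)"
    if "z \<in> S" for z
    by (rule has_derivative_eq_rhs[OF has_derivative_mult[OF d(1,3)[OF that]]])
       (auto simp: plus_blinfun.rep_eq scaleR_blinfun.rep_eq fun_eq_iff)
  moreover have "continuous_on S (\<lambda>z. f z *\<^sub>R g' z + g z *\<^sub>R f' z)"
    by (intro continuous_on_add continuous_on_scaleR c d(2,4))
  ultimately show ?thesis unfolding C1_on_def
    by (intro exI[of _ "\<lambda>z. f z *\<^sub>R g' z + g z *\<^sub>R f' z"]) blast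
qed

lemma C1_on_real_compose:
  fixes f :: "'a::real_normed_vector \<Rightarrow> real" and \<phi> :: "real \<Rightarrow> real"
  assumes "\<And>x. (\<phi> has_real_derivative \<phi>' x) (at x)" "continuous_on UNIV \<phi>'" "C1_on S f"
  shows "C1_on S (\<lambda>z. \<phi> (f z))"
proof -
  obtain f' where d: "\<And>z. z \<in> S \<Longrightarrow> (f has_derivative blinfun_apply (f' z)) (at z within S)"
    "continuous_on S f'" using assms unfolding C1_on_def by blast
  have c: "continuous_on S f" by (rule has_derivative_continuous_on[OF d(1)])
  have "((\<lambda>z. \<phi> (f z)) has_derivative blinfun_apply (\<phi>' (f z) *\<^sub>R f' z)) (at z within S)"
    if "z \<in> S" for z
    by (rule has_derivative_eq_rhs[OF has_derivative_compose[OF d(1)[OF that] assms(1)[unfolded has_field_derivative_def]]])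
       (auto simp: scaleR_blinfun.rep_eq fun_eq_iff)
  moreover have "continuous_on S (\<lambda>z. \<phi>' (f z) *\<^sub>R f' z)"
    by (intro continuous_on_scaleR d(2) continuous_on_compose2[OF assms(2) c]) auto
  ultimately show ?thesis unfolding C1_on_def
    by (intro exI[of _ "\<lambda>z. \<phi>' (f z) *\<^sub>R f' z"]) blast
qed

lemma C1_on_Pair:
  assumes "C1_on S f" "C1_on S g" shows "C1_on S (\<lambda>z. (f z, g z))"
proof -
  have 1: "bounded_linear (\<lambda>x::'b. (x, 0::'c))" "bounded_linear (\<lambda>y::'c. (0::'b, y))"
    by (intro bounded_linear_Pair bounded_linear_ident bounded_linear_zero)+
  show ?thesis
    using C1_on_add[OF C1_on_linear_compose[OF 1(1) assms(1)] C1_on_linear_compose[OF 1(2) assms(2)]] by simp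
qed

lemma C2_on_real_plane:
  fixes f :: "real \<times> real \<Rightarrow> real"
  assumes "\<And>z. (f has_derivative (\<lambda>h. p z * fst h + q z * snd h)) (at z)"
    and "C1_on UNIV p" "C1_on UNIV q"
  shows "C2_on UNIV f"
proof -
  define b1 b2 :: "(real \<times> real) \<Rightarrow>\<^sub>L real" where "b1 = Blinfun fst" and "b2 = Blinfun snd"
  have b: "blinfun_apply b1 = fst" "blinfun_apply b2 = snd"
    by (simp_all add: b1_def b2_def bounded_linear_Blinfun_apply bounded_linear_fst bounded_linear_snd)
  have "C1_on UNIV (\<lambda>z. p z *\<^sub>R b1 + q z *\<^sub>R b2)"
    by (intro C1_on_add C1_on_linear_compose[OF _ assms(2)] C1_on_linear_compose[OF _ assms(3)]
        bounded_linear_scaleR_left)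
  moreover have "(f has_derivative blinfun_apply (p z *\<^sub>R b1 + q z *\<^sub>R b2)) (at z)" for z
    by (rule has_derivative_eq_rhs[OF assms(1)])
       (simp add: fun_eq_iff plus_blinfun.rep_eq scaleR_blinfun.rep_eq b)
  ultimately show ?thesis unfolding C2_on_def
    by (intro exI[of _ "\<lambda>z. p z *\<^sub>R b1 + q z *\<^sub>R b2"]) blast
qed

section \<open>Periodic functions\<close>

lemma wrap_range: assumes "0 < D" shows "- D \<le> wrap D x" "wrap D x < D"
proof -
  have 1: "of_int \<lfloor>(x + D) / (2 * D)\<rfloor> \<le> (x + D) / (2 * D)" "(x + D) / (2 * D) < of_int \<lfloor>(x + D) / (2 * D)\<rfloor> + 1"
    by linarith+
  from 1 have "of_int \<lfloor>(x + D) / (2 * D)\<rfloor> * (2 * D) \<le> x + D"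
    "x + D < (of_int \<lfloor>(x + D) / (2 * D)\<rfloor> + 1) * (2 * D)"
    using assms by (simp_all only: pos_le_divide_eq pos_divide_less_eq mult_pos_pos zero_less_numeral)
  then show "- D \<le> wrap D x" "wrap D x < D" by (simp_all add: wrap_def algebra_simps)
qed

lemma wrap_unique:
  assumes "0 < D" "- D \<le> x - 2 * D * of_int n" "x - 2 * D * of_int n < D"
  shows "wrap D x = x - 2 * D * of_int n"
proof -
  have "\<lfloor>(x + D) / (2 * D)\<rfloor> = n"
    by (rule floor_unique) (use assms in \<open>simp_all add: field_simps\<close>)
  then show ?thesis by (simp add: wrap_def)
qed

lemma wrap_eq: "0 < D \<Longrightarrow> - D \<le> x \<Longrightarrow> x < D \<Longrightarrow> wrap D x = x"
  using wrap_unique[of D x 0] by simp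

lemma wrap_shift: "0 < D \<Longrightarrow> wrap D (x + 2 * D * of_int n) = wrap D x"
proof -
  assume D: "0 < D"
  let ?k = "\<lfloor>(x + D) / (2 * D)\<rfloor>"
  have "wrap D (x + 2 * D * of_int n) = x + 2 * D * of_int n - 2 * D * of_int (?k + n)"
    by (rule wrap_unique[OF D]) (use wrap_range[OF D, of x] in \<open>simp_all add: wrap_def algebra_simps\<close>)
  then show ?thesis by (simp add: wrap_def algebra_simps)
qed

lemma wrap_boundary:
  assumes D: "0 < D" and x: "wrap D x = - D"
  shows "x - 2 * D < y \<Longrightarrow> y < x \<Longrightarrow> wrap D y = y - x + D"
    and "x \<le> y \<Longrightarrow> y < x + 2 * D \<Longrightarrow> wrap D y = y - x - D"
proof -
  define n where "n = \<lfloor>(x + D) / (2 * D)\<rfloor>"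
  have x': "x = 2 * D * of_int n - D" using x by (simp add: wrap_def n_def)
  show "wrap D y = y - x + D" if "x - 2 * D < y" "y < x"
    using wrap_unique[OF D, of y "n - 1"] that x' by (simp add: algebra_simps)
  show "wrap D y = y - x - D" if "x \<le> y" "y < x + 2 * D"
    using wrap_unique[OF D, of y n] that x' by (simp add: algebra_simps)
qed

lemma wrap_interior:
  assumes D: "0 < D" and x: "wrap D x \<noteq> - D"
  shows "\<exists>c. wrap D x = x - c \<and> (\<forall>y. \<bar>y - c\<bar> < D \<longrightarrow> wrap D y = y - c) \<and> \<bar>x - c\<bar> < D"
proof -
  let ?c = "2 * D * of_int \<lfloor>(x + D) / (2 * D)\<rfloor>"
  have 1: "wrap D x = x - ?c" by (simp add: wrap_def)
  moreover have "\<bar>x - ?c\<bar> < D" using wrap_range[OF D, of x] x 1 by linarith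
  moreover have "wrap D y = y - ?c" if "\<bar>y - ?c\<bar> < D" for y
    by (rule wrap_unique[OF D]) (use that in linarith)+
  ultimately show ?thesis by blast
qed

text \<open>Away from the points congruent to \<open>D\<close> the function \<open>wrap D\<close> is locally a translation; at those points
the two one-sided translates of \<open>f\<close> are glued, which is where the matching conditions at \<open>\<plusminus>D\<close> enter.\<close>

lemma periodic_has_real_derivative:
  fixes f :: "real \<Rightarrow> real"
  assumes D: "0 < D" and f: "\<And>x. (f has_real_derivative f' x) (at x)" and "f (- D) = f D" "f' (- D) = f' D"
  shows "((\<lambda>x. f (wrap D x)) has_real_derivative f' (wrap D x)) (at x)"
proof (cases "wrap D x = - D")
  case True
  have "((\<lambda>y. if y \<le> x then f (y - x + D) else f (y - x - D)) has_real_derivative f' (- D)) (at x)"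
  proof (rule has_real_derivative_glue)
    show "((\<lambda>y. f (y - x + D)) has_real_derivative f' (- D)) (at x)"
      by (rule DERIV_chain2[where g = "\<lambda>y. y - x + D" and Db = 1, THEN DERIV_cong])
         (use f[of D] assms(4) in \<open>auto intro!: derivative_eq_intros\<close>)
    show "((\<lambda>y. f (y - x - D)) has_real_derivative f' (- D)) (at x)"
      by (rule DERIV_chain2[where g = "\<lambda>y. y - x - D" and Db = 1, THEN DERIV_cong])
         (use f[of "- D"] in \<open>auto intro!: derivative_eq_intros\<close>)
  qed (use assms in simp)
  then have "((\<lambda>x. f (wrap D x)) has_real_derivative f' (- D)) (at x)"
  proof (rule has_field_derivative_transform_within_open[where S = "{x - 2 * D<..<x + 2 * D}"])
    show "(if y \<le> x then f (y - x + D) else f (y - x - D)) = f (wrap D y)"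
      if "y \<in> {x - 2 * D<..<x + 2 * D}" for y
      using wrap_boundary[OF D True, of y] that assms(3) True by (cases "y = x") auto
  qed (use D in auto)
  then show ?thesis using True by simp
next
  case False
  then obtain c where c: "wrap D x = x - c" "\<And>y. \<bar>y - c\<bar> < D \<Longrightarrow> wrap D y = y - c" "\<bar>x - c\<bar> < D"
    using wrap_interior[OF D] by blast
  have "((\<lambda>y. f (y - c)) has_real_derivative f' (x - c)) (at x)"
    by (rule DERIV_chain2[where g = "\<lambda>y. y - c" and Db = 1, THEN DERIV_cong])
       (use f[of "x - c"] in \<open>auto intro!: derivative_eq_intros\<close>)
  then have "((\<lambda>x. f (wrap D x)) has_real_derivative f' (x - c)) (at x)"
    by (rule has_field_derivative_transform_within_open[where S = "ball c D"])
       (use c D in \<open>auto simp: dist_real_def abs_minus_commute\<close>)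
  then show ?thesis using c by simp
qed

lemma periodic_continuous:
  fixes f :: "real \<Rightarrow> real"
  assumes D: "0 < D" and f: "continuous_on UNIV f" and fD: "f (- D) = f D"
  shows "continuous_on UNIV (\<lambda>x. f (wrap D x))"
proof -
  have f': "continuous_on S f" for S using f continuous_on_subset by blast
  have "isCont (\<lambda>x. f (wrap D x)) x" for x
  proof (cases "wrap D x = - D")
    case True
    have "continuous_on {x - D..x + D} (\<lambda>y. if y \<le> x then f (y - x + D) else f (y - x - D))"
      by (rule continuous_on_cases_le[where h = "\<lambda>y. y"])
         (use fD D in \<open>auto intro!: continuous_intros continuous_on_compose2[OF f]\<close>)
    then have "continuous_on {x - D..x + D} (\<lambda>x. f (wrap D x))"
    proof (rule continuous_on_eq)
      fix y assume y: "y \<in> {x - D..x + D}"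
      consider "y < x" | "y = x" | "x < y" by linarith
      then show "(if y \<le> x then f (y - x + D) else f (y - x - D)) = f (wrap D y)"
        using wrap_boundary[OF D True, of y] y fD True D by cases auto
    qed
    then show ?thesis by (rule continuous_on_interior) (use D in auto)
  next
    case False
    then obtain c where c: "\<And>y. \<bar>y - c\<bar> < D \<Longrightarrow> wrap D y = y - c" "\<bar>x - c\<bar> < D"
      using wrap_interior[OF D] by blast
    have "continuous_on (ball c D) (\<lambda>y. f (y - c))"
      by (auto intro!: continuous_intros continuous_on_compose2[OF f])
    then have "continuous_on (ball c D) (\<lambda>x. f (wrap D x))"
      by (rule continuous_on_eq) (use c in \<open>auto simp: dist_real_def abs_minus_commute\<close>)
    then show ?thesis by (rule continuous_on_interior) (use c in \<open>auto simp: dist_real_def abs_minus_commute\<close>)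
  qed
  then show ?thesis by (simp add: continuous_at_imp_continuous_on)
qed

section \<open>Monotonicity and barriers\<close>

lemma strict_mono_inverse_derivative:
  fixes \<phi> :: "real \<Rightarrow> real"
  assumes d: "\<And>t. t \<in> {l<..<r} \<Longrightarrow> (\<phi> has_real_derivative \<phi>' t) (at t)"
    and pos: "\<And>t. t \<in> {l<..<r} \<Longrightarrow> 0 < \<phi>' t"
  shows "strict_mono_on {l<..<r} \<phi>"
    and "t \<in> {l<..<r} \<Longrightarrow> inv_into {l<..<r} \<phi> (\<phi> t) = t"
    and "t \<in> {l<..<r} \<Longrightarrow> (inv_into {l<..<r} \<phi> has_real_derivative inverse (\<phi>' t)) (at (\<phi> t))"
proof -
  show m: "strict_mono_on {l<..<r} \<phi>"
  proof (rule strict_mono_onI)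
    fix x y assume xy: "x \<in> {l<..<r}" "y \<in> {l<..<r}" "x < y"
    show "\<phi> x < \<phi> y"
    proof (rule DERIV_pos_imp_increasing[OF xy(3)])
      fix t assume "x \<le> t" "t \<le> y"
      then have "t \<in> {l<..<r}" using xy by auto
      from d[OF this] pos[OF this] show "\<exists>z. (\<phi> has_real_derivative z) (at t) \<and> 0 < z" by blast
    qed
  qed
  then have inj: "inj_on \<phi> {l<..<r}" by (rule strict_mono_on_imp_inj_on)
  then show "inv_into {l<..<r} \<phi> (\<phi> t) = t" if "t \<in> {l<..<r}" using that by simp
  show "(inv_into {l<..<r} \<phi> has_real_derivative inverse (\<phi>' t)) (at (\<phi> t))" if t: "t \<in> {l<..<r}"
    unfolding has_field_derivative_def
  proof (rule has_derivative_inverse_strong[of "{l<..<r}" t \<phi>])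
    show "continuous_on {l<..<r} \<phi>"
      by (rule DERIV_continuous_on) (use d in \<open>blast intro: has_field_derivative_at_within\<close>)
    show "(\<phi> has_derivative (*) (\<phi>' t)) (at t)" using d[OF t] by (simp add: has_field_derivative_def)
    show "(*) (\<phi>' t) \<circ> (*) (inverse (\<phi>' t)) = id" using pos[OF t] by (auto simp: fun_eq_iff)
  qed (use t inj in auto)
qed

lemma first_hit:
  fixes f :: "real \<Rightarrow> real"
  assumes "continuous_on {a..b} f" "a \<le> b" "f a < d" "d \<le> f b"
  obtains t where "a < t" "t \<le> b" "f t = d" "\<And>s. a \<le> s \<Longrightarrow> s < t \<Longrightarrow> f s < d"
proof -
  define S where "S = {s \<in> {a..b}. d \<le> f s}"
  have "closed S" unfolding S_def
    using continuous_closed_preimage[OF assms(1), of "{d..}"] by (simp add: vimage_def Int_def conj_commute)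
  moreover have "S \<subseteq> {a..b}" by (auto simp: S_def)
  ultimately have "compact S" using compact_Icc bounded_subset compact_eq_bounded_closed by meson
  moreover have "b \<in> S" using assms by (auto simp: S_def)
  ultimately obtain t where t: "t \<in> S" "\<And>s. s \<in> S \<Longrightarrow> t \<le> s"
    using compact_attains_inf[of S] by blast
  have lt: "f s < d" if "a \<le> s" "s < t" for s
  proof (rule ccontr)
    assume "\<not> f s < d"
    then have "s \<in> S" using that t(1) by (auto simp: S_def)
    then show False using t(2) that by force
  qed
  have at: "a < t" using t(1) assms(3) by (cases "a = t") (auto simp: S_def)
  have "f t = d"
  proof (rule ccontr)
    assume "f t \<noteq> d"
    then have "d < f t" using t(1) by (auto simp: S_def)
    moreover have "continuous_on {a..t} f" using assms(1) t(1) by (auto simp: S_def intro: continuous_on_subset)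
    ultimately obtain s where "a \<le> s" "s \<le> t" "f s = d" using IVT'[of f a d t] assms(3) at by force
    then show False using lt[of s] \<open>d < f t\<close> by (cases "s = t") auto
  qed
  then show thesis using that at t(1) lt by (auto simp: S_def)
qed

lemma last_exit:
  fixes f :: "real \<Rightarrow> real"
  assumes "continuous_on {a..b} f" "a \<le> b" "f a \<le> c" "c < f b"
  obtains t where "a \<le> t" "t < b" "f t = c" "\<And>s. t < s \<Longrightarrow> s \<le> b \<Longrightarrow> c < f s"
proof -
  have "continuous_on {-b..-a} (\<lambda>t. - f (- t))"
    by (intro continuous_intros continuous_on_compose2[OF assms(1)]) auto
  then obtain t where t: "-b < t" "t \<le> -a" "- f (- t) = - c" "\<And>s. -b \<le> s \<Longrightarrow> s < t \<Longrightarrow> - f (- s) < - c"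
    by (rule first_hit[of "-b" "-a" "\<lambda>t. - f (- t)" "-c"]) (use assms in auto)
  show thesis
    by (rule that[of "- t"]) (use t t(4)[of "- s" for s] in force)+
qed

text \<open>A level that repels from above cannot be crossed. The sign of the derivative is required only in a band above
the level, because for the truncated fields used below it is known only there.\<close>

lemma barrier:
  fixes f :: "real \<Rightarrow> real"
  assumes d: "\<And>t. t \<in> {a..b} \<Longrightarrow> (f has_real_derivative f' t) (at t within {a..b})"
    and "f a \<le> c" "c < e" and neg: "\<And>t. t \<in> {a..b} \<Longrightarrow> c < f t \<Longrightarrow> f t < e \<Longrightarrow> f' t \<le> 0"
    and t: "t \<in> {a..b}"
  shows "f t \<le> c"
proof (rule ccontr)
  assume "\<not> f t \<le> c"
  \<comment> \<open>A level strictly inside the band that is reached before or at time \<open>t\<close>.\<close>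
  define d' where "d' = min (f t) ((c + e) / 2)"
  have d': "c < d'" "d' < e" "d' \<le> f t" using \<open>\<not> f t \<le> c\<close> assms(3) by (auto simp: d'_def min_def)
  have cont: "continuous_on {a..b} f" by (rule DERIV_continuous_on) (use d in blast)
  then have "continuous_on {a..t} f" by (rule continuous_on_subset) (use t in auto)
  then obtain t2 where t2: "a < t2" "t2 \<le> t" "f t2 = d'" "\<And>s. a \<le> s \<Longrightarrow> s < t2 \<Longrightarrow> f s < d'"
    by (rule first_hit[of a t f d']) (use t d' assms(2) in auto)
  have "continuous_on {a..t2} f" using cont by (rule continuous_on_subset) (use t t2 in auto)
  then obtain t1 where t1: "a \<le> t1" "t1 < t2" "f t1 = c" "\<And>s. t1 < s \<Longrightarrow> s \<le> t2 \<Longrightarrow> c < f s"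
    by (rule last_exit[of a t2 f c]) (use t2 d' assms(2) in auto)
  have "f t2 \<le> f t1"
  proof (rule DERIV_nonpos_imp_decreasing_open[where f = f])
    show "continuous_on {t1..t2} f" using cont by (rule continuous_on_subset) (use t t1 t2 in auto)
    fix s assume that: "t1 < s" "s < t2"
    show "\<exists>y. (f has_real_derivative y) (at s) \<and> y \<le> 0"
    proof -
      have "at s within {a..b} = at s" using that t t1 t2 by (intro at_within_interior) auto
      then have "(f has_real_derivative f' s) (at s)" using d[of s] that t t1 t2 by auto
      moreover have "f' s \<le> 0"
      proof (rule neg)
        show "f s < e" using t2(4)[of s] that t1 d' by linarith
      qed (use that t t1 t2 t1(4)[of s] in auto)
      ultimately show ?thesis by blast
    qed
  qed (use t1 in simp)
  then show False using t1 t2 d' by simp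
qed

lemma nonincreasing_on:
  fixes f :: "real \<Rightarrow> real"
  assumes d: "\<And>t. t \<in> S \<Longrightarrow> (f has_real_derivative f' t) (at t within S)" "is_interval S"
    and neg: "\<And>t. t \<in> S \<Longrightarrow> f' t \<le> 0" and "s \<in> S" "t \<in> S" "s \<le> t"
  shows "f t \<le> f s"
proof -
  have sub: "{s..t} \<subseteq> S" using assms(2,4,5) by (meson atLeastAtMost_iff mem_is_interval_1_I subsetI)
  show ?thesis
  proof (rule barrier[where f = f and f' = f' and a = s and b = t and e = "f s + 1"])
    fix r assume "r \<in> {s..t}"
    then have r: "r \<in> S" using sub by blast
    show "(f has_real_derivative f' r) (at r within {s..t})"
      by (rule has_field_derivative_subset[OF d(1)[OF r] sub])
    show "f' r \<le> 0" by (rule neg[OF r])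
  qed (use assms in auto)
qed

section \<open>Periodic and bounded Lipschitz functions\<close>

lemma continuous_has_antiderivative:
  fixes f :: "real \<Rightarrow> real"
  assumes "continuous_on UNIV f"
  shows "\<exists>g. \<forall>x. (g has_real_derivative f x) (at x)"
proof -
  let ?g = "\<lambda>u. LBINT y=ereal 0..ereal u. f y"
  have "(?g has_real_derivative f x) (at x)" for x
  proof -
    let ?r = "\<bar>x\<bar> + 1"
    have "(?g has_vector_derivative f x) (at x within {-?r..?r})"
      by (rule interval_integral_FTC2) (use assms continuous_on_subset in \<open>auto\<close>)
    moreover have "at x within {-?r..?r} = at x" by (rule at_within_interior) auto
    ultimately show ?thesis by (simp add: has_real_derivative_iff_has_vector_derivative)
  qed
  then show ?thesis by blast
qed

lemma periodic_wrap:
  fixes f :: "real \<Rightarrow> 'b"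
  assumes "\<And>x. f (x + 2 * D) = f x" shows "f (x + 2 * D * of_int n) = f x" "f (wrap D x) = f x"
proof -
  have nat: "f (x + 2 * D * of_nat k) = f x" for x and k :: nat
  proof (induction k)
    case (Suc k)
    have "f (x + 2 * D * of_nat (Suc k)) = f ((x + 2 * D * of_nat k) + 2 * D)" by (simp add: algebra_simps)
    then show ?case using assms Suc by simp
  qed simp
  show *: "f (x + 2 * D * of_int n) = f x" for x n
  proof (cases "0 \<le> n")
    case True then show ?thesis using nat[of x "nat n"] by simp
  next
    case False then show ?thesis using nat[of "x + 2 * D * of_int n" "nat (- n)"] by simp
  qed
  show "f (wrap D x) = f x" using *[of x "- \<lfloor>(x + D) / (2 * D)\<rfloor>"] by (simp add: wrap_def)
qed

lemma periodic_bounded: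
  fixes f :: "real \<Rightarrow> real"
  assumes "0 < D" "\<And>x. f (x + 2 * D) = f x" "continuous_on UNIV f"
  shows "\<exists>M. \<forall>x. \<bar>f x\<bar> \<le> M"
proof -
  have "compact (f ` {-D..D})"
    by (rule compact_continuous_image) (use assms(3) continuous_on_subset in auto)
  then obtain M where M: "\<And>y. y \<in> f ` {-D..D} \<Longrightarrow> norm y \<le> M"
    using compact_imp_bounded bounded_iff by metis
  have "\<bar>f x\<bar> \<le> M" for x
  proof -
    have "wrap D x \<in> {-D..D}" using wrap_range[OF assms(1), of x] by simp
    from M[OF imageI[OF this]] show ?thesis using periodic_wrap(2)[of f D x] assms(2) by simp
  qed
  then show ?thesis by blast
qed

text \<open>Boundedness is part of the notion because it makes the class closed under products.\<close>

definition bounded_lipschitz :: "(real \<times> real \<Rightarrow> real) \<Rightarrow> bool" where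
  "bounded_lipschitz f \<longleftrightarrow> (\<exists>M. \<forall>z w. \<bar>f z\<bar> \<le> M \<and> \<bar>f z - f w\<bar> \<le> M * norm (z - w))"

lemma bounded_lipschitzE:
  assumes "bounded_lipschitz f"
  obtains M where "0 \<le> M" "\<And>z. \<bar>f z\<bar> \<le> M" "\<And>z w. \<bar>f z - f w\<bar> \<le> M * norm (z - w)"
  using assms unfolding bounded_lipschitz_def by (meson abs_ge_zero order_trans)

lemma bounded_lipschitz_const: "bounded_lipschitz (\<lambda>_. c)"
  unfolding bounded_lipschitz_def by (intro exI[of _ "\<bar>c\<bar>"]) auto

lemma bounded_lipschitz_add:
  assumes "bounded_lipschitz f" "bounded_lipschitz g" shows "bounded_lipschitz (\<lambda>z. f z + g z)"
proof -
  obtain M where M: "0 \<le> M" "\<And>z. \<bar>f z\<bar> \<le> M" "\<And>z w. \<bar>f z - f w\<bar> \<le> M * norm (z - w)"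
    using bounded_lipschitzE[OF assms(1)] by blast
  obtain N where N: "0 \<le> N" "\<And>z. \<bar>g z\<bar> \<le> N" "\<And>z w. \<bar>g z - g w\<bar> \<le> N * norm (z - w)"
    using bounded_lipschitzE[OF assms(2)] by blast
  have "\<bar>f z + g z\<bar> \<le> M + N" for z using M(2)[of z] N(2)[of z] by linarith
  moreover have "\<bar>f z + g z - (f w + g w)\<bar> \<le> (M + N) * norm (z - w)" for z w
    using M(3)[of z w] N(3)[of z w] unfolding distrib_right by linarith
  ultimately show ?thesis unfolding bounded_lipschitz_def by blast
qed

lemma bounded_lipschitz_mult:
  assumes "bounded_lipschitz f" "bounded_lipschitz g" shows "bounded_lipschitz (\<lambda>z. f z * g z)"
proof -
  obtain M where M: "0 \<le> M" "\<And>z. \<bar>f z\<bar> \<le> M" "\<And>z w. \<bar>f z - f w\<bar> \<le> M * norm (z - w)"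
    using bounded_lipschitzE[OF assms(1)] by blast
  obtain N where N: "0 \<le> N" "\<And>z. \<bar>g z\<bar> \<le> N" "\<And>z w. \<bar>g z - g w\<bar> \<le> N * norm (z - w)"
    using bounded_lipschitzE[OF assms(2)] by blast
  have 0: "0 \<le> M * N" using M N by simp
  have "\<bar>f z * g z\<bar> \<le> 2 * (M * N)" for z
  proof -
    have "\<bar>f z * g z\<bar> \<le> M * N"
      unfolding abs_mult by (rule mult_mono) (use M N in auto)
    then show ?thesis using 0 by linarith
  qed
  moreover have "\<bar>f z * g z - f w * g w\<bar> \<le> 2 * (M * N) * norm (z - w)" for z w
  proof -
    have "f z * g z - f w * g w = f z * (g z - g w) + g w * (f z - f w)" by (simp add: algebra_simps)
    then have "\<bar>f z * g z - f w * g w\<bar> \<le> \<bar>f z\<bar> * \<bar>g z - g w\<bar> + \<bar>g w\<bar> * \<bar>f z - f w\<bar>"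
      by (metis abs_mult abs_triangle_ineq)
    also have "\<dots> \<le> M * (N * norm (z - w)) + N * (M * norm (z - w))"
      by (intro add_mono mult_mono) (use M N in auto)
    finally show ?thesis by (simp add: algebra_simps)
  qed
  ultimately show ?thesis unfolding bounded_lipschitz_def by blast
qed

lemma real_lipschitz_of_derivative_bound:
  fixes f :: "real \<Rightarrow> real"
  assumes "\<And>x. x \<in> S \<Longrightarrow> (f has_real_derivative f' x) (at x within S)" "\<And>x. x \<in> S \<Longrightarrow> \<bar>f' x\<bar> \<le> M" "convex S"
    "x \<in> S" "y \<in> S"
  shows "\<bar>f x - f y\<bar> \<le> M * \<bar>x - y\<bar>"
  using field_differentiable_bound[of S f f' M x y] assms by simp

lemma bounded_lipschitz_fst:
  fixes f :: "real \<Rightarrow> real"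
  assumes D: "0 < D" and per: "\<And>x. f (x + 2 * D) = f x" "\<And>x. f' (x + 2 * D) = f' x"
    and der: "\<And>x. (f has_real_derivative f' x) (at x)" and cont: "continuous_on UNIV f'"
  shows "bounded_lipschitz (\<lambda>z. f (fst z))"
proof -
  have "continuous_on UNIV f" by (rule DERIV_continuous_on) (use der in auto)
  then obtain M where M: "\<And>x. \<bar>f x\<bar> \<le> M" using periodic_bounded[of D f] D per by blast
  obtain N where N: "\<And>x. \<bar>f' x\<bar> \<le> N" using periodic_bounded[of D f'] D per cont by blast
  have N0: "0 \<le> N" using N[of 0] by linarith
  have "\<bar>f (fst z) - f (fst w)\<bar> \<le> max M N * norm (z - w)" for z w :: "real \<times> real"
  proof -
    have "\<bar>f (fst z) - f (fst w)\<bar> \<le> N * \<bar>fst z - fst w\<bar>"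
      by (rule real_lipschitz_of_derivative_bound[of UNIV f f']) (use der N in auto)
    also have "\<dots> \<le> max M N * norm (z - w)"
      using dist_fst_le[of z w] N0 by (intro mult_mono) (auto simp: dist_norm)
    finally show ?thesis .
  qed
  moreover have "\<bar>f (fst z)\<bar> \<le> max M N" for z :: "real \<times> real" using M[of "fst z"] by linarith
  ultimately show ?thesis unfolding bounded_lipschitz_def by blast
qed

definition clamp_to :: "real \<Rightarrow> real \<Rightarrow> real" where "clamp_to Y y = max (- Y) (min Y y)"

lemma bounded_lipschitz_clamp: "bounded_lipschitz (\<lambda>z. clamp_to Y (snd z))"
proof -
  have "\<bar>clamp_to Y y\<bar> \<le> \<bar>Y\<bar>" "\<bar>clamp_to Y y - clamp_to Y y'\<bar> \<le> 1 * \<bar>y - y'\<bar>" for y y'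
    by (auto simp: clamp_to_def)
  moreover have "1 * \<bar>snd z - snd w\<bar> \<le> (\<bar>Y\<bar> + 1) * norm (z - w)" for z w :: "real \<times> real"
    using dist_snd_le[of z w] by (intro mult_mono) (auto simp: dist_norm)
  ultimately have "\<bar>clamp_to Y (snd z)\<bar> \<le> \<bar>Y\<bar> + 1 \<and>
      \<bar>clamp_to Y (snd z) - clamp_to Y (snd w)\<bar> \<le> (\<bar>Y\<bar> + 1) * norm (z - w)" for z w :: "real \<times> real"
    by (meson order_trans add_increasing2 le_add_same_cancel1 zero_le_one)
  then show ?thesis unfolding bounded_lipschitz_def by blast
qed

lemma bounded_lipschitz_field:
  assumes "bounded_lipschitz f" "bounded_lipschitz g"
  shows "\<exists>L\<ge>0. \<forall>z w. norm ((f z, g z) - (f w, g w)) \<le> L * norm (z - w)"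
proof -
  obtain M where M: "0 \<le> M" "\<And>z. \<bar>f z\<bar> \<le> M" "\<And>z w. \<bar>f z - f w\<bar> \<le> M * norm (z - w)"
    using bounded_lipschitzE[OF assms(1)] by blast
  obtain N where N: "0 \<le> N" "\<And>z. \<bar>g z\<bar> \<le> N" "\<And>z w. \<bar>g z - g w\<bar> \<le> N * norm (z - w)"
    using bounded_lipschitzE[OF assms(2)] by blast
  have "norm ((f z, g z) - (f w, g w)) \<le> (M + N) * norm (z - w)" for z w
  proof -
    have "norm ((f z, g z) - (f w, g w)) \<le> norm (f z - f w) + norm (g z - g w)"
      unfolding diff_Pair by (rule norm_Pair_le)
    then show ?thesis using M(3)[of z w] N(3)[of z w] unfolding distrib_right real_norm_def by linarith
  qed
  moreover have "0 \<le> M + N" using M(1) N(1) by simp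
  ultimately show ?thesis by blast
qed

section \<open>Conformal fields in normal form\<close>

text \<open>The coefficients \<open>m\<close>, \<open>a\<close>, \<open>b\<close> of the normal form, with their first and second derivatives, as
\<open>2D\<close>-periodic functions on the universal cover.\<close>

locale damped_annulus =
  fixes \<alpha> \<beta> B C D :: real and m m1 m2 a a1 a2 b b1 b2 :: "real \<Rightarrow> real"
  assumes params: "0 < \<beta>" "\<beta> < \<alpha>" "\<alpha> < 2 * \<beta>" "0 < B" "B < C" "C < D"
    and m_deriv: "\<And>x. (m has_real_derivative m1 x) (at x)" "\<And>x. (m1 has_real_derivative m2 x) (at x)" "continuous_on UNIV m2"
    and a_deriv: "\<And>x. (a has_real_derivative a1 x) (at x)" "\<And>x. (a1 has_real_derivative a2 x) (at x)" "continuous_on UNIV a2"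
    and b_deriv: "\<And>x. (b has_real_derivative b1 x) (at x)" "\<And>x. (b1 has_real_derivative b2 x) (at x)" "continuous_on UNIV b2"
    and m_periodic: "\<And>x. m (x + 2 * D) = m x" "\<And>x. m1 (x + 2 * D) = m1 x" "\<And>x. m2 (x + 2 * D) = m2 x"
    and a_periodic: "\<And>x. a (x + 2 * D) = a x" "\<And>x. a1 (x + 2 * D) = a1 x" "\<And>x. a2 (x + 2 * D) = a2 x"
    and b_periodic: "\<And>x. b (x + 2 * D) = b x" "\<And>x. b1 (x + 2 * D) = b1 x" "\<And>x. b2 (x + 2 * D) = b2 x"
    and parity: "\<And>x. m (- x) = m x" "\<And>x. m1 (- x) = - m1 x" "\<And>x. a (- x) = - a x" "\<And>x. a1 (- x) = a1 x"
      "\<And>x. b (- x) = b x" "\<And>x. b1 (- x) = - b1 x"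
    and m_range: "\<And>x. 1 \<le> m x" "\<And>x. m x \<le> 2"
    and m_inner: "\<And>x. \<bar>x\<bar> \<le> B \<Longrightarrow> m x = 2" "\<And>x. \<bar>x\<bar> \<le> B \<Longrightarrow> m1 x = 0"
    and m_outer: "\<And>x. C < \<bar>x\<bar> \<Longrightarrow> \<bar>x\<bar> \<le> D \<Longrightarrow> m x = 1" "\<And>x. C < \<bar>x\<bar> \<Longrightarrow> \<bar>x\<bar> \<le> D \<Longrightarrow> m1 x = 0"
    and m1_bound: "\<And>x. - C \<le> x \<Longrightarrow> x \<le> - B \<Longrightarrow> 0 \<le> m1 x \<and> m1 x * (\<beta> * (- x)) < 2 * (\<alpha> - \<beta>)"
    and a_inner: "\<And>x. \<bar>x\<bar> \<le> C \<Longrightarrow> a x = - \<beta> * x" "\<And>x. \<bar>x\<bar> \<le> C \<Longrightarrow> a1 x = - \<beta>"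
    and a1_bound: "\<And>x. \<bar>x\<bar> \<le> D \<Longrightarrow> - \<beta> \<le> a1 x"
    and a_sign: "\<And>x. - D < x \<Longrightarrow> x < 0 \<Longrightarrow> 0 < a x" "a D = 0"
    and b_range: "\<And>x. - 1 \<le> b x" "\<And>x. b x \<le> 0"
    and b_outer: "\<And>x. B \<le> \<bar>x\<bar> \<Longrightarrow> \<bar>x\<bar> \<le> D \<Longrightarrow> b x = 0" "\<And>x. B \<le> \<bar>x\<bar> \<Longrightarrow> \<bar>x\<bar> \<le> D \<Longrightarrow> b1 x = 0"
    and b1_sign: "\<And>x. - D \<le> x \<Longrightarrow> x \<le> 0 \<Longrightarrow> b1 x \<le> 0"
begin

definition K :: "real \<times> real \<Rightarrow> real" where
  "K z = m (fst z) / 2 * (snd z)\<^sup>2 + a (fst z) * snd z + b (fst z)"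

definition speed :: "real \<times> real \<Rightarrow> real" where "speed z = m (fst z) * snd z + a (fst z)"

definition Kx :: "real \<times> real \<Rightarrow> real" where
  "Kx z = m1 (fst z) / 2 * (snd z)\<^sup>2 + a1 (fst z) * snd z + b1 (fst z)"

definition F :: "real \<times> real \<Rightarrow> real \<times> real" where
  "F z = (speed z, - Kx z - \<alpha> * snd z)"

lemma D_pos: "0 < D" using params by linarith

lemma K_has_derivative: "(K has_derivative (\<lambda>h. Kx z * fst h + speed z * snd h)) (at z)"
proof -
  have *: "((\<lambda>z. g (fst z)) has_derivative (\<lambda>h. g' (fst z) * fst h)) (at z)"
    if "\<And>x. (g has_real_derivative g' x) (at x)" for g g' :: "real \<Rightarrow> real" and z :: "real \<times> real"
    by (rule has_derivative_eq_rhs[OF has_derivative_compose[OF bounded_linear.has_derivative[OF bounded_linear_fst has_derivative_ident] that[unfolded has_field_derivative_def]]]) auto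
  have sq: "((\<lambda>z. (snd z)\<^sup>2) has_derivative (\<lambda>h. 2 * snd z * snd h)) (at z)" for z :: "real \<times> real"
    by (auto intro!: derivative_eq_intros)
  have half: "((\<lambda>x. m x / 2) has_real_derivative m1 x / 2) (at x)" for x
    by (rule DERIV_cdivide[OF m_deriv(1)])
  show ?thesis unfolding K_def
    by (rule has_derivative_eq_rhs[OF has_derivative_add[OF has_derivative_add[OF
          has_derivative_mult[OF *[OF half] sq] has_derivative_mult[OF *[OF a_deriv(1)] has_derivative_snd[OF has_derivative_ident]]]
          *[OF b_deriv(1)]]])
       (auto simp: fun_eq_iff Kx_def speed_def field_simps power2_eq_square)
qed

lemma solves_components:
  assumes "solves F \<gamma> S" "t \<in> S"
  shows "((\<lambda>t. fst (\<gamma> t)) has_real_derivative speed (\<gamma> t)) (at t within S)"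
    and "((\<lambda>t. snd (\<gamma> t)) has_real_derivative - Kx (\<gamma> t) - \<alpha> * snd (\<gamma> t)) (at t within S)"
proof -
  have d: "(\<gamma> has_derivative (\<lambda>h. h *\<^sub>R F (\<gamma> t))) (at t within S)"
    using assms unfolding solves_def has_vector_derivative_def by blast
  show "((\<lambda>t. fst (\<gamma> t)) has_real_derivative speed (\<gamma> t)) (at t within S)"
    using has_derivative_fst[OF d] unfolding has_field_derivative_def
    by (rule has_derivative_eq_rhs) (auto simp: F_def)
  show "((\<lambda>t. snd (\<gamma> t)) has_real_derivative - Kx (\<gamma> t) - \<alpha> * snd (\<gamma> t)) (at t within S)"
    using has_derivative_snd[OF d] unfolding has_field_derivative_def
    by (rule has_derivative_eq_rhs) (auto simp: F_def)
qed

lemma derivative_along_solution: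
  assumes "solves F \<gamma> S" "t \<in> S" "(f has_derivative (\<lambda>h. p * fst h + q * snd h)) (at (\<gamma> t))"
  shows "((\<lambda>t. f (\<gamma> t)) has_real_derivative p * fst (F (\<gamma> t)) + q * snd (F (\<gamma> t))) (at t within S)"
proof -
  have d: "(\<gamma> has_derivative (\<lambda>h. h *\<^sub>R F (\<gamma> t))) (at t within S)"
    using assms unfolding solves_def has_vector_derivative_def by blast
  show ?thesis unfolding has_field_derivative_def
    by (rule has_derivative_eq_rhs[OF has_derivative_compose[OF d assms(3)]]) (auto simp: algebra_simps)
qed

lemma K_along:
  assumes "solves F \<gamma> S" "t \<in> S"
  shows "((\<lambda>t. K (\<gamma> t)) has_real_derivative - \<alpha> * (snd (\<gamma> t) * speed (\<gamma> t))) (at t within S)"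
  by (rule DERIV_cong[OF derivative_along_solution[OF assms K_has_derivative]]) (simp add: F_def algebra_simps)

text \<open>This is convexity of \<open>K\<close> in \<open>y\<close> between \<open>0\<close> and \<open>y\<close>, together with \<open>K(x,0) = b(x) \<le> 0\<close>.\<close>

lemma K_le_action: "K z \<le> snd z * speed z"
proof -
  have "0 \<le> m (fst z) / 2 * (snd z)\<^sup>2" using m_range(1)[of "fst z"] by simp
  then show ?thesis using b_range(2)[of "fst z"]
    unfolding K_def speed_def by (simp add: algebra_simps power2_eq_square)
qed

lemma K_decay:
  assumes "solves F \<gamma> S" "is_interval S" "s \<in> S" "t \<in> S" "s \<le> t"
  shows "K (\<gamma> t) \<le> exp (- \<alpha> * (t - s)) * K (\<gamma> s)"
proof -
  have "exp (\<alpha> * t) * K (\<gamma> t) \<le> exp (\<alpha> * s) * K (\<gamma> s)"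
  proof (rule nonincreasing_on[where f = "\<lambda>t. exp (\<alpha> * t) * K (\<gamma> t)" and S = S
        and f' = "\<lambda>t. exp (\<alpha> * t) * (\<alpha> * (K (\<gamma> t) - snd (\<gamma> t) * speed (\<gamma> t)))"])
    fix r assume r: "r \<in> S"
    show "((\<lambda>t. exp (\<alpha> * t) * K (\<gamma> t)) has_real_derivative
       exp (\<alpha> * r) * (\<alpha> * (K (\<gamma> r) - snd (\<gamma> r) * speed (\<gamma> r)))) (at r within S)"
      by (auto intro!: derivative_eq_intros K_along[OF assms(1) r] simp: algebra_simps)
    show "exp (\<alpha> * r) * (\<alpha> * (K (\<gamma> r) - snd (\<gamma> r) * speed (\<gamma> r))) \<le> 0"
      using K_le_action[of "\<gamma> r"] params by (intro mult_nonneg_nonpos) auto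
  qed (use assms in auto)
  then have "exp (- \<alpha> * t) * (exp (\<alpha> * t) * K (\<gamma> t)) \<le> exp (- \<alpha> * t) * (exp (\<alpha> * s) * K (\<gamma> s))"
    by (intro mult_left_mono) auto
  then show ?thesis unfolding mult.assoc[symmetric] exp_add[symmetric] by (simp add: algebra_simps)
qed

lemma a_bounded: obtains M where "0 \<le> M" "\<And>x. \<bar>a x\<bar> \<le> M"
proof -
  have "continuous_on UNIV a" by (rule DERIV_continuous_on) (use a_deriv in auto)
  then obtain M where "\<And>x. \<bar>a x\<bar> \<le> M" using periodic_bounded[OF D_pos, of a] a_periodic by blast
  then show thesis using that[of M] by (meson abs_ge_zero order_trans)
qed

text \<open>Superlinear growth in the fibre, uniformly in the base point: all dynamics with bounded \<open>K\<close> takes place in a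
strip on which the field is Lipschitz.\<close>

lemma sublevel_strip: "\<exists>Y>0. \<forall>z. K z \<le> c \<longrightarrow> \<bar>snd z\<bar> \<le> Y"
proof -
  obtain M where M: "0 \<le> M" "\<And>x. \<bar>a x\<bar> \<le> M" using a_bounded by blast
  \<comment> \<open>Large enough for the quadratic term to dominate \<open>M |y| + |c| + 1\<close>.\<close>
  let ?Y = "2 * M + 2 * \<bar>c\<bar> + 4"
  have "\<bar>snd z\<bar> \<le> ?Y" if "K z \<le> c" for z
  proof (rule ccontr)
    assume "\<not> \<bar>snd z\<bar> \<le> ?Y"
    then have y: "?Y < \<bar>snd z\<bar>" by simp
    have 1: "\<bar>snd z\<bar> * \<bar>snd z\<bar> / 2 \<le> m (fst z) / 2 * (snd z)\<^sup>2"
      using m_range(1)[of "fst z"] mult_right_mono[of 1 "m (fst z)" "(snd z)\<^sup>2"] by (simp add: power2_eq_square)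
    have "\<bar>a (fst z) * snd z\<bar> \<le> M * \<bar>snd z\<bar>"
      unfolding abs_mult by (rule mult_right_mono[OF M(2)]) simp
    then have 2: "- (M * \<bar>snd z\<bar>) \<le> a (fst z) * snd z" by linarith
    have aux: "e + 1 \<le> q1 + q2 + q3" if "(e + 2) * 1 \<le> u - v" "u \<le> q1" "- v \<le> q2" "- 1 \<le> q3"
      for e u v q1 q2 q3 :: real
      using add_mono[OF add_mono[OF that(2,3)] that(4)] that(1) by simp
    have "(\<bar>c\<bar> + 2) * 1 \<le> (\<bar>snd z\<bar> / 2 - M) * \<bar>snd z\<bar>" using y M by (intro mult_mono) auto
    also have "\<dots> = \<bar>snd z\<bar> * \<bar>snd z\<bar> / 2 - M * \<bar>snd z\<bar>" by (simp add: algebra_simps)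
    finally have "\<bar>c\<bar> + 1 \<le> K z" using 1 2 b_range(1)[of "fst z"] unfolding K_def by (rule aux)
    then show False using that by linarith
  qed
  then show ?thesis using M by (intro exI[of _ ?Y]) auto
qed

text \<open>The field is quadratic in \<open>y\<close>; freezing it outside a strip makes it globally Lipschitz.\<close>

definition clamped :: "real \<Rightarrow> real \<times> real \<Rightarrow> real \<times> real" where
  "clamped Y z = F (fst z, clamp_to Y (snd z))"

lemma clamped_eq: "\<bar>snd z\<bar> \<le> Y \<Longrightarrow> clamped Y z = F z"
  by (auto simp: clamped_def clamp_to_def max_def min_def intro: prod_eqI)

lemma bounded_lipschitz_coefficients:
  "bounded_lipschitz (\<lambda>z. m (fst z))" "bounded_lipschitz (\<lambda>z. m1 (fst z))"
  "bounded_lipschitz (\<lambda>z. a (fst z))" "bounded_lipschitz (\<lambda>z. a1 (fst z))"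
  "bounded_lipschitz (\<lambda>z. b1 (fst z))"
proof -
  have "continuous_on UNIV m1" "continuous_on UNIV a1" "continuous_on UNIV b1"
    by (rule DERIV_continuous_on, use m_deriv(2) a_deriv(2) b_deriv(2) in auto)+
  then show "bounded_lipschitz (\<lambda>z. m (fst z))" "bounded_lipschitz (\<lambda>z. m1 (fst z))"
    "bounded_lipschitz (\<lambda>z. a (fst z))" "bounded_lipschitz (\<lambda>z. a1 (fst z))"
    "bounded_lipschitz (\<lambda>z. b1 (fst z))"
    by (blast intro: bounded_lipschitz_fst[OF D_pos m_periodic(1,2) m_deriv(1)]
      bounded_lipschitz_fst[OF D_pos m_periodic(2,3) m_deriv(2) m_deriv(3)]
      bounded_lipschitz_fst[OF D_pos a_periodic(1,2) a_deriv(1)]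
      bounded_lipschitz_fst[OF D_pos a_periodic(2,3) a_deriv(2) a_deriv(3)]
      bounded_lipschitz_fst[OF D_pos b_periodic(2,3) b_deriv(2) b_deriv(3)])+
qed

lemma clamped_lipschitz: "\<exists>L\<ge>0. \<forall>z w. norm (clamped Y z - clamped Y w) \<le> L * norm (z - w)"
proof -
  let ?c = "\<lambda>z. clamp_to Y (snd z)"
  let ?f = "\<lambda>z. m (fst z) * ?c z + a (fst z)"
  let ?g = "\<lambda>z. (- 1 / 2) * (m1 (fst z) * (?c z * ?c z)) + ((- 1) * (a1 (fst z) * ?c z) + ((- 1) * b1 (fst z) + (- \<alpha>) * ?c z))"
  have "bounded_lipschitz ?f" "bounded_lipschitz ?g"
    by (intro bounded_lipschitz_add bounded_lipschitz_mult bounded_lipschitz_const bounded_lipschitz_clamp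
        bounded_lipschitz_coefficients)+
  from bounded_lipschitz_field[OF this]
  show ?thesis by (simp add: clamped_def F_def speed_def Kx_def power2_eq_square algebra_simps)
qed

lemma clamped_solution: "\<exists>\<gamma>. \<gamma> 0 = z \<and> solves (clamped Y) \<gamma> UNIV"
  using solution_exists clamped_lipschitz[of Y] by blast

lemma solves_clamped_iff:
  assumes "\<And>t. t \<in> S \<Longrightarrow> \<bar>snd (\<gamma> t)\<bar> \<le> Y"
  shows "solves (clamped Y) \<gamma> S \<longleftrightarrow> solves F \<gamma> S"
  using assms clamped_eq unfolding solves_def by auto

lemma solves_F_unique:
  assumes "solves F \<gamma> S" "solves F \<delta> S" "is_interval S" "t0 \<in> S" "t \<in> S" "\<gamma> t0 = \<delta> t0"
    and "\<And>t. t \<in> S \<Longrightarrow> \<bar>snd (\<gamma> t)\<bar> \<le> Y" "\<And>t. t \<in> S \<Longrightarrow> \<bar>snd (\<delta> t)\<bar> \<le> Y"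
  shows "\<gamma> t = \<delta> t"
proof -
  obtain L where L: "\<And>z w. norm (clamped Y z - clamped Y w) \<le> L * norm (z - w)"
    using clamped_lipschitz by blast
  show ?thesis
    by (rule solves_unique[of "clamped Y" \<gamma> S \<delta> t0 t L]) (use assms L solves_clamped_iff in auto)
qed

lemma forward_sublevel:
  assumes "solves F \<gamma> {0..}" "0 \<le> t" shows "K (\<gamma> t) \<le> max 0 (K (\<gamma> 0))"
proof -
  have 1: "K (\<gamma> t) \<le> exp (- \<alpha> * (t - 0)) * K (\<gamma> 0)"
    by (rule K_decay[OF assms(1)]) (use assms in \<open>auto simp: is_interval_ci\<close>)
  have "exp (- \<alpha> * t) \<le> 1" using assms params by simp
  then have "exp (- \<alpha> * t) * K (\<gamma> 0) \<le> max 0 (K (\<gamma> 0))"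
    using mult_left_le_one_le[of "K (\<gamma> 0)" "exp (- \<alpha> * t)"] mult_nonneg_nonpos[of "exp (- \<alpha> * t)" "K (\<gamma> 0)"]
    by (cases "0 \<le> K (\<gamma> 0)") auto
  then show ?thesis using 1 by simp
qed

text \<open>In the band \<open>c < K < c + 1\<close> the truncation is not felt, so there \<open>K\<close> decreases along the solution and
the level \<open>c\<close> acts as a barrier.\<close>

lemma clamped_stays:
  assumes c: "0 \<le> c" and Y: "\<And>z. K z \<le> c + 1 \<Longrightarrow> \<bar>snd z\<bar> \<le> Y"
    and "solves (clamped Y) \<gamma> {s..}" "K (\<gamma> s) \<le> c" "s \<le> t"
  shows "K (\<gamma> t) \<le> c"
proof -
  have sol: "solves (clamped Y) \<gamma> {s..t}" by (rule solves_subset[OF assms(3)]) auto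
  define d where "d r = Kx (\<gamma> r) * fst (clamped Y (\<gamma> r)) + speed (\<gamma> r) * snd (clamped Y (\<gamma> r))" for r
  show ?thesis
  proof (rule barrier[where f = "\<lambda>t. K (\<gamma> t)" and f' = d and a = s and b = t and e = "c + 1"])
    fix r assume r: "r \<in> {s..t}"
    have g: "(\<gamma> has_derivative (\<lambda>h. h *\<^sub>R clamped Y (\<gamma> r))) (at r within {s..t})"
      using sol r unfolding solves_def has_vector_derivative_def by blast
    show "((\<lambda>t. K (\<gamma> t)) has_real_derivative d r) (at r within {s..t})"
      unfolding has_field_derivative_def d_def
      by (rule has_derivative_eq_rhs[OF has_derivative_compose[OF g K_has_derivative]]) (auto simp: algebra_simps)
    assume "c < K (\<gamma> r)" "K (\<gamma> r) < c + 1"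
    then have "clamped Y (\<gamma> r) = F (\<gamma> r)" and k: "0 \<le> K (\<gamma> r)" using Y[of "\<gamma> r"] clamped_eq c by auto
    then have "d r = - \<alpha> * (snd (\<gamma> r) * speed (\<gamma> r))" by (simp add: d_def F_def algebra_simps)
    also have "\<dots> \<le> 0" using K_le_action[of "\<gamma> r"] k params by (intro mult_nonpos_nonneg) auto
    finally show "d r \<le> 0" .
  qed (use assms in auto)
qed

lemma forward_solution: "\<exists>\<gamma>. \<gamma> 0 = z \<and> solves F \<gamma> {0..}"
proof -
  let ?c = "max 0 (K z)"
  obtain Y where Y: "\<And>z. K z \<le> ?c + 1 \<Longrightarrow> \<bar>snd z\<bar> \<le> Y" using sublevel_strip by blast
  obtain \<gamma> where g: "\<gamma> 0 = z" "solves (clamped Y) \<gamma> UNIV" using clamped_solution by blast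
  have s: "solves (clamped Y) \<gamma> {0..}" by (rule solves_subset[OF g(2)]) auto
  have "K (\<gamma> t) \<le> ?c" if "0 \<le> t" for t
    by (rule clamped_stays[OF _ Y s _ that]) (use g in auto)
  then have "\<bar>snd (\<gamma> t)\<bar> \<le> Y" if "t \<in> {0..}" for t
    using that by (intro Y) (force intro: add_increasing2)
  then have "solves F \<gamma> {0..}" using solves_clamped_iff s by blast
  then show ?thesis using g by blast
qed

lemma forward_unique:
  assumes "solves F \<gamma> {0..}" "solves F \<delta> {0..}" "\<gamma> 0 = \<delta> 0" "0 \<le> t"
  shows "\<gamma> t = \<delta> t"
proof -
  obtain Y where Y: "\<And>z. K z \<le> max 0 (K (\<gamma> 0)) \<Longrightarrow> \<bar>snd z\<bar> \<le> Y" using sublevel_strip by blast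
  show ?thesis
    by (rule solves_F_unique[OF assms(1,2), where ?t0.0 = 0 and Y = Y])
       (use assms forward_sublevel[OF assms(1)] forward_sublevel[OF assms(2)] in \<open>auto simp: is_interval_ci intro!: Y\<close>)
qed

end

section \<open>The flow on the annulus\<close>

lemma cover_simp: "cover D z = (cis (pi * fst z / D), snd z)"
  by (cases z) (simp add: cover_def)

lemma continuous_on_cover: "continuous_on S (cover D)"
proof -
  have "continuous_on S (\<lambda>z. (cis (pi * fst z / D), snd z))"
    by (cases "D = 0") (auto intro!: continuous_intros)
  then show ?thesis by (simp add: cover_simp[abs_def])
qed

lemma cover_in_annulus: "cover D z \<in> annulus"
  by (simp add: cover_simp annulus_def)

text \<open>The fibres of the covering are the orbits of the deck translation.\<close>

lemma cover_eq_iff: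
  assumes "0 < D"
  shows "cover D z = cover D w \<longleftrightarrow> (\<exists>n. w = z + (2 * D * of_int n, 0))"
proof -
  have "cis x = cis y \<longleftrightarrow> (\<exists>n. y = x + 2 * pi * of_int n)" for x y
  proof -
    have "cis x = cis y \<longleftrightarrow> sin y = sin x \<and> cos y = cos x" by (auto simp: complex_eq_iff)
    also have "\<dots> \<longleftrightarrow> (\<exists>n. y = x + 2 * pi * of_int n)" by (rule sin_cos_eq_iff)
    finally show ?thesis .
  qed
  moreover have "pi * b / D = pi * a / D + 2 * pi * of_int n \<longleftrightarrow> b = a + 2 * D * of_int n" for a b n
  proof -
    have "pi * b / D = pi * a / D + 2 * pi * of_int n \<longleftrightarrow> pi * b = pi * (a + 2 * D * of_int n)"
      using assms by (simp add: field_simps)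
    then show ?thesis by simp
  qed
  ultimately show ?thesis by (cases z, cases w) (auto simp: cover_simp)
qed

lemma cover_surj:
  assumes "0 < D" "p \<in> annulus"
  shows "\<exists>z. cover D z = p \<and> - D \<le> fst z \<and> fst z < D"
proof -
  have n: "norm (fst p) = 1" using assms(2) by (auto simp: annulus_def)
  then have "fst p \<noteq> 0" by auto
  then have c: "cis (Arg (fst p)) = fst p" using n by (simp add: cis_Arg sgn_div_norm)
  let ?z = "(wrap D (D / pi * Arg (fst p)), snd p)"
  have "cover D ?z = cover D (D / pi * Arg (fst p), snd p)"
    by (subst cover_eq_iff[OF assms(1)]) (auto simp: wrap_def)
  also have "\<dots> = p" using c assms(1) by (cases p) (simp add: cover_simp)
  finally show ?thesis using wrap_range[OF assms(1)] by (intro exI[of _ ?z]) auto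
qed

text \<open>Over a bounded part of the base the covering map is proper.\<close>

lemma closed_cover_image:
  assumes S: "closed S" "S \<subseteq> {a..b} \<times> UNIV"
  shows "closed (cover D ` S)"
  unfolding closed_sequential_limits
proof (intro allI impI)
  fix x l assume "(\<forall>n. x n \<in> cover D ` S) \<and> x \<longlonglongrightarrow> l"
  then obtain z where z: "\<And>n. z n \<in> S" "\<And>n. x n = cover D (z n)" and lim: "x \<longlonglongrightarrow> l"
    by (auto simp: image_iff) metis
  have "(\<lambda>n. snd (z n)) \<longlonglongrightarrow> snd l" using tendsto_snd[OF lim] z(2) by (simp add: cover_simp)
  then have "bounded (range (\<lambda>n. snd (z n)))" by (rule convergent_imp_bounded)
  then obtain R where R: "\<And>n. \<bar>snd (z n)\<bar> \<le> R" by (auto simp: bounded_iff)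
  have "compact ({a..b} \<times> {-R..R})" by (intro compact_Times compact_Icc)
  then have "compact (S \<inter> {a..b} \<times> {-R..R})" using S(1) by (simp add: closed_Int_compact)
  moreover have "z n \<in> S \<inter> {a..b} \<times> {-R..R}" for n
    using z(1)[of n] S(2) R[of n] by (cases "z n") (auto simp: abs_le_iff)
  ultimately obtain w r where w: "w \<in> S" "strict_mono r" "(z \<circ> r) \<longlonglongrightarrow> w"
    unfolding compact_def by (metis IntE)
  have "(\<lambda>n. cover D ((z \<circ> r) n)) \<longlonglongrightarrow> cover D w"
    by (rule continuous_on_tendsto_compose[OF continuous_on_cover[of UNIV] w(3)]) auto
  moreover have "(\<lambda>n. cover D ((z \<circ> r) n)) \<longlonglongrightarrow> l"
    using LIMSEQ_subseq_LIMSEQ[OF lim w(2)] by (simp add: z(2) o_def)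
  ultimately show "l \<in> cover D ` S" using LIMSEQ_unique w(1) by blast
qed

context damped_annulus begin

lemma F_shift: "F (z + (2 * D * of_int n, 0)) = F z" "K (z + (2 * D * of_int n, 0)) = K z"
  by (simp_all add: F_def K_def speed_def Kx_def periodic_wrap(1)[of m D, OF m_periodic(1)]
     periodic_wrap(1)[of m1 D, OF m_periodic(2)] periodic_wrap(1)[of a D, OF a_periodic(1)]
     periodic_wrap(1)[of a1 D, OF a_periodic(2)] periodic_wrap(1)[of b D, OF b_periodic(1)]
     periodic_wrap(1)[of b1 D, OF b_periodic(2)])

lemma F_odd: "F (- z) = - F z" "K (- z) = K z"
  by (simp_all add: F_def K_def speed_def Kx_def parity)

lemma solves_shifted: "solves F \<gamma> S \<Longrightarrow> solves F (\<lambda>t. \<gamma> t + (2 * D * of_int n, 0)) S"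
  unfolding solves_def by (auto simp: F_shift intro!: derivative_eq_intros)

lemma solves_negated: "solves F \<gamma> S \<Longrightarrow> solves F (\<lambda>t. - \<gamma> t) S"
  unfolding solves_def by (auto simp: F_odd intro!: derivative_eq_intros)

definition lift :: "complex \<times> real \<Rightarrow> real \<times> real" where
  "lift p = (SOME z. cover D z = p)"

definition sol :: "real \<times> real \<Rightarrow> real \<Rightarrow> real \<times> real" where
  "sol z = (SOME \<gamma>. \<gamma> 0 = z \<and> solves F \<gamma> {0..})"

definition flow :: "real \<Rightarrow> complex \<times> real \<Rightarrow> complex \<times> real" where
  "flow t p = cover D (sol (lift p) t)"

lemma sol: "sol z 0 = z" "solves F (sol z) {0..}"
  using someI_ex[OF forward_solution[of z]] unfolding sol_def by blast+

text \<open>Since solutions are unique and the field is periodic, the choice of the lifts in the definition of the flow is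
immaterial.\<close>

lemma flow_cover:
  assumes "solves F \<gamma> {0..}" "0 \<le> t"
  shows "flow t (cover D (\<gamma> 0)) = cover D (\<gamma> t)"
proof -
  have "cover D (lift (cover D (\<gamma> 0))) = cover D (\<gamma> 0)"
    unfolding lift_def by (rule someI[of _ "\<gamma> 0"]) simp
  then obtain n where n: "lift (cover D (\<gamma> 0)) = \<gamma> 0 + (2 * D * of_int n, 0)"
    using cover_eq_iff[OF D_pos] by metis
  have "sol (lift (cover D (\<gamma> 0))) t = \<gamma> t + (2 * D * of_int n, 0)"
    by (rule forward_unique[OF sol(2) solves_shifted[OF assms(1)] _ assms(2)]) (simp add: sol n)
  then show ?thesis unfolding flow_def using cover_eq_iff[OF D_pos, of "\<gamma> t"] by metis
qed

lemma flow_is_forward_flow: "forward_flow D F flow"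
  unfolding forward_flow_def
  using flow_cover[OF sol(2)] sol unfolding solves_def by (metis atLeast_iff)

lemma continuous_on_K: "continuous_on S K"
  by (rule has_derivative_continuous_on[OF has_derivative_at_withinI[OF K_has_derivative]])

text \<open>Both statements come down to closedness of the images of \<open>{K \<le> 1}\<close> and \<open>{K \<ge> 1}\<close>; by periodicity one
fundamental domain suffices for each.\<close>

lemma sublevel_images:
  shows "openin (top_of_set annulus) (cover D ` {z. K z < 1})"
    and "top_of_set annulus closure_of (cover D ` {z. K z < 1}) \<subseteq> cover D ` {z. K z \<le> 1}"
proof -
  have red: "cover D ` {z. Q (K z)} = cover D ` ({z. Q (K z)} \<inter> {-D..D} \<times> UNIV)" for Q :: "real \<Rightarrow> bool"
  proof -
    have "cover D z \<in> cover D ` ({z. Q (K z)} \<inter> {-D..D} \<times> UNIV)" if "Q (K z)" for z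
    proof -
      obtain w where w: "cover D w = cover D z" "- D \<le> fst w" "fst w < D"
        using cover_surj[OF D_pos cover_in_annulus[of D z]] by blast
      then obtain n where "z = w + (2 * D * of_int n, 0)" using cover_eq_iff[OF D_pos] by blast
      then have "K z = K w" by (simp only: F_shift)
      then have "w \<in> {z. Q (K z)} \<inter> {-D..D} \<times> UNIV" using w that by (simp add: mem_Times_iff)
      from imageI[OF this, of "cover D"] show ?thesis by (simp only: w(1))
    qed
    then show ?thesis by (intro equalityI image_subsetI image_mono) auto
  qed
  have strip: "closed ({-D..D} \<times> (UNIV :: real set))" by (intro closed_Times) auto
  have "closed {z. K z \<le> 1}" "closed {z. 1 \<le> K z}"
    by (intro closed_Collect_le continuous_on_K continuous_on_const)+
  then have cl: "closed (cover D ` {z. K z \<le> 1})" "closed (cover D ` {z. 1 \<le> K z})"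
    unfolding red[of "\<lambda>k. k \<le> 1"] red[of "\<lambda>k. 1 \<le> k"]
    by (intro closed_cover_image[where a = "-D" and b = D] closed_Int strip; auto)+
  have eq: "cover D ` {z. K z < 1} = annulus \<inter> - cover D ` {z. 1 \<le> K z}"
  proof (intro equalityI subsetI)
    fix p assume "p \<in> cover D ` {z. K z < 1}"
    then obtain z where z: "p = cover D z" "K z < 1" by blast
    have "p \<notin> cover D ` {z. 1 \<le> K z}"
    proof
      assume "p \<in> cover D ` {z. 1 \<le> K z}"
      then obtain w where "cover D z = cover D w" "1 \<le> K w" using z by auto
      then show False using z cover_eq_iff[OF D_pos, of z w] F_shift(2)[of z] by auto
    qed
    then show "p \<in> annulus \<inter> - cover D ` {z. 1 \<le> K z}" using z cover_in_annulus by auto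
  next
    fix p assume p: "p \<in> annulus \<inter> - cover D ` {z. 1 \<le> K z}"
    then obtain z where "cover D z = p" using cover_surj[OF D_pos, of p] by blast
    moreover from this have "\<not> 1 \<le> K z" using p by auto
    ultimately show "p \<in> cover D ` {z. K z < 1}" by auto
  qed
  then show "openin (top_of_set annulus) (cover D ` {z. K z < 1})"
    using open_Compl[OF cl(2)] eq unfolding openin_open by blast
  have "cover D ` {z. K z < 1} \<subseteq> cover D ` {z. K z \<le> 1}" by (intro image_mono) auto
  then have "closure (cover D ` {z. K z < 1}) \<subseteq> cover D ` {z. K z \<le> 1}"
    by (rule closure_minimal[OF _ cl(1)])
  then show "top_of_set annulus closure_of (cover D ` {z. K z < 1}) \<subseteq> cover D ` {z. K z \<le> 1}"
    using closure_of_subtopology_subset[of euclidean annulus "cover D ` {z. K z < 1}"]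
    unfolding euclidean_closure_of by blast
qed

lemma flow_into_sublevel:
  assumes "p \<in> cover D ` {z. K z \<le> 1}" "0 < t" shows "flow t p \<in> cover D ` {z. K z < 1}"
proof -
  obtain z where z: "p = cover D z" "K z \<le> 1" using assms by blast
  have "K (sol z t) \<le> exp (- \<alpha> * (t - 0)) * K (sol z 0)"
    by (rule K_decay[OF sol(2)]) (use assms in \<open>auto simp: is_interval_ci\<close>)
  also have "\<dots> \<le> exp (- \<alpha> * t) * 1" using z by (simp add: sol)
  also have "\<dots> < 1" using assms params by simp
  finally have "K (sol z t) < 1" .
  moreover have "flow t p = cover D (sol z t)"
    using flow_cover[OF sol(2)[of z], of t] assms z by (simp add: sol)
  ultimately show ?thesis by blast
qed

text \<open>A point that lies in all forward images of \<open>{K < 1}\<close> has preimages at every time. By uniqueness these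
are pieces of one solution, and the decay of \<open>K\<close> from arbitrarily far in the past leaves only \<open>K \<le> 0\<close>.\<close>

lemma backward_solution:
  assumes p: "\<And>t. 0 < t \<Longrightarrow> p \<in> flow t ` cover D ` {z. K z < 1}" and z: "cover D z = p"
  shows "\<exists>\<gamma>. \<gamma> 0 = z \<and> solves F \<gamma> {..0} \<and> (\<forall>t\<le>0. K (\<gamma> t) \<le> 0)"
proof -
  obtain Y where Y: "\<And>z. K z \<le> 1 \<Longrightarrow> \<bar>snd z\<bar> \<le> Y" using sublevel_strip[of 1] by blast
  obtain L where L: "\<And>z w. norm (clamped Y z - clamped Y w) \<le> L * norm (z - w)"
    using clamped_lipschitz by blast
  obtain \<gamma> where g: "\<gamma> 0 = z" "solves (clamped Y) \<gamma> UNIV" using clamped_solution by blast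
  have K1: "K (\<gamma> t) \<le> 1" if "t < 0" for t
  proof -
    have "p \<in> flow (- t) ` cover D ` {z. K z < 1}" using that by (intro p) simp
    then obtain w where w: "K w < 1" "p = flow (- t) (cover D w)" by (elim imageE) simp
    then have "cover D z = cover D (sol w (- t))"
      using flow_cover[OF sol(2)[of w], of "- t"] that z by (simp add: sol)
    then obtain n where n: "sol w (- t) = z + (2 * D * of_int n, 0)" using cover_eq_iff[OF D_pos] by blast
    define \<delta> where "\<delta> s = sol w s + (2 * D * of_int (- n), 0)" for s
    have d: "solves F \<delta> {0..}" unfolding \<delta>_def by (rule solves_shifted[OF sol(2)])
    have dz: "\<delta> (- t) = z" by (simp add: \<delta>_def n prod_eq_iff)
    have d0: "K (\<delta> 0) < 1" using w by (simp only: \<delta>_def F_shift sol)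
    then have dK: "K (\<delta> s) \<le> 1" if "0 \<le> s" for s using forward_sublevel[OF d that] by simp
    have "solves (clamped Y) \<delta> {0..-t}"
      by (rule solves_clamped_iff[THEN iffD2]) (use dK Y solves_subset[OF d, of "{0..-t}"] in auto)
    moreover have "solves (clamped Y) (\<lambda>s. \<gamma> (s + t)) {0..-t}" by (rule solves_shift[OF g(2)]) auto
    ultimately have "\<delta> 0 = \<gamma> (0 + t)"
      by (rule solves_unique[of _ \<delta> _ "\<lambda>s. \<gamma> (s + t)" "- t" 0 L]) (use L that dz g in auto)
    then show ?thesis using d0 by simp
  qed
  moreover have "K (\<gamma> 0) \<le> 1"
  proof -
    have "p \<in> flow 1 ` cover D ` {z. K z < 1}" by (intro p) simp
    then obtain q where q: "p = flow 1 q" "q \<in> cover D ` {z. K z < 1}" by (elim imageE) simp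
    from q(2) have "q \<in> cover D ` {z. K z \<le> 1}" by (elim imageE) simp
    then have "p \<in> cover D ` {z. K z < 1}" unfolding q(1) by (rule flow_into_sublevel) simp
    then obtain w where w: "K w < 1" "cover D z = cover D w" unfolding z[symmetric] by (elim imageE) simp
    then obtain n where "w = z + (2 * D * of_int n, 0)" using cover_eq_iff[OF D_pos] by blast
    then have "K w = K z" by (simp only: F_shift)
    then show ?thesis using g w by simp
  qed
  ultimately have K1': "K (\<gamma> t) \<le> 1" if "t \<le> 0" for t using that by (cases "t = 0") auto
  have s: "solves F \<gamma> {..0}"
    by (rule solves_clamped_iff[THEN iffD1, of "{..0}" \<gamma> Y]) (use K1' Y solves_subset[OF g(2), of "{..0}"] in auto)
  have "K (\<gamma> t) \<le> 0" if t: "t \<le> 0" for t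
  proof (rule ccontr)
    assume "\<not> K (\<gamma> t) \<le> 0"
    then have k: "0 < K (\<gamma> t)" by simp
    \<comment> \<open>The time after which the decay from a value at most \<open>1\<close> would reach \<open>K (\<gamma> t) / e\<close>.\<close>
    define r where "r = (1 - ln (K (\<gamma> t))) / \<alpha>"
    have "ln (K (\<gamma> t)) \<le> 0" using K1'[OF t] k by simp
    then have r: "0 < r" using params unfolding r_def by (intro divide_pos_pos) auto
    have "K (\<gamma> t) \<le> exp (- \<alpha> * (t - (t - r))) * K (\<gamma> (t - r))"
      by (rule K_decay[OF s]) (use t r in \<open>auto simp: is_interval_ic\<close>)
    also have "\<dots> \<le> exp (- \<alpha> * (t - (t - r))) * 1"
      using K1'[of "t - r"] r t by (intro mult_left_mono) auto
    also have "\<dots> = exp (ln (K (\<gamma> t)) - 1)" using params by (simp add: r_def field_simps)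
    also have "\<dots> < exp (ln (K (\<gamma> t)))" by simp
    finally show False using k by simp
  qed
  then show ?thesis using g s by blast
qed

section \<open>The energy and its critical points\<close>

text \<open>The correction that turns \<open>K\<close> into the energy of a damped Newton equation, normalised to vanish at the saddle.\<close>

definition P :: "real \<Rightarrow> real" where
  "P = (SOME g. (\<forall>x. (g has_real_derivative a x / m x) (at x)) \<and> g D = 0)"

lemma P_deriv: "(P has_real_derivative a x / m x) (at x)" and P_D: "P D = 0"
proof -
  have m0: "m x \<noteq> 0" for x using m_range(1)[of x] by auto
  have "continuous_on UNIV a" "continuous_on UNIV m"
    by (rule DERIV_continuous_on, use a_deriv(1) m_deriv(1) in auto)+
  then have "continuous_on UNIV (\<lambda>x. a x / m x)" by (intro continuous_on_divide) (use m0 in auto)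
  then obtain g where g: "\<And>x. (g has_real_derivative a x / m x) (at x)"
    using continuous_has_antiderivative by blast
  have "((\<lambda>x. g x - g D) has_real_derivative a x / m x) (at x)" for x
    by (auto intro!: derivative_eq_intros g)
  then have "\<exists>g. (\<forall>x. (g has_real_derivative a x / m x) (at x)) \<and> g D = 0"
    by (intro exI[of _ "\<lambda>x. g x - g D"]) auto
  from someI_ex[OF this] show "(P has_real_derivative a x / m x) (at x)" "P D = 0"
    unfolding P_def by blast+
qed

lemma real_constant_of_zero_derivative:
  fixes f :: "real \<Rightarrow> real"
  assumes "\<And>x. (f has_real_derivative 0) (at x)" shows "f x = f y"
  using DERIV_isconst_all[of f x y] assms by blast

lemma P_even: "P (- x) = P x"
proof -
  have *: "((\<lambda>x. P (- x) - P x) has_real_derivative 0) (at x)" for x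
    by (rule DERIV_cong[OF DERIV_diff[OF DERIV_chain2[OF P_deriv DERIV_minus[OF DERIV_ident]] P_deriv]])
       (simp add: parity)
  show ?thesis using real_constant_of_zero_derivative[of "\<lambda>x. P (- x) - P x" x 0, OF *] by simp
qed

lemma P_periodic: "P (x + 2 * D) = P x"
proof -
  have 1: "((\<lambda>x. x + 2 * D) has_real_derivative 1) (at x)" for x
    by (auto intro!: derivative_eq_intros)
  have *: "((\<lambda>x. P (x + 2 * D) - P x) has_real_derivative 0) (at x)" for x
    by (rule DERIV_cong[OF DERIV_diff[OF DERIV_chain2[OF P_deriv 1] P_deriv]])
       (simp add: a_periodic m_periodic)
  show ?thesis using real_constant_of_zero_derivative[of "\<lambda>x. P (x + 2 * D) - P x" x "- D", OF *]
    P_even[of D] by simp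
qed

lemma P_increasing: assumes "- D \<le> x" "x < y" "y \<le> 0" shows "P x < P y"
proof (rule DERIV_pos_imp_increasing_open[OF assms(2)])
  fix z assume z: "x < z" "z < y"
  then have "0 < a z / m z" using a_sign(1)[of z] m_range(1)[of z] assms by (intro divide_pos_pos) auto
  then show "\<exists>d. (P has_real_derivative d) (at z) \<and> 0 < d" using P_deriv by blast
next
  show "continuous_on {x..y} P" by (rule DERIV_continuous_on) (use P_deriv has_field_derivative_at_within in blast)
qed

lemma P_mono: assumes "\<bar>y\<bar> < \<bar>x\<bar>" "\<bar>x\<bar> \<le> D" shows "P x < P y"
proof -
  have "P (- \<bar>x\<bar>) < P (- \<bar>y\<bar>)" by (rule P_increasing) (use assms in auto)
  moreover have "P (- \<bar>z\<bar>) = P z" for z using P_even[of z] by (cases "0 \<le> z") auto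
  ultimately show ?thesis by simp
qed

text \<open>The potential of the Newton equation and its derivative.\<close>

definition W :: "real \<Rightarrow> real" where "W x = b x - (a x)\<^sup>2 / (2 * m x) - \<alpha> * P x"

definition W1 :: "real \<Rightarrow> real" where
  "W1 x = b1 x - a x * a1 x / m x + (a x)\<^sup>2 * m1 x / (2 * (m x)\<^sup>2) - \<alpha> * (a x / m x)"

definition E :: "real \<times> real \<Rightarrow> real" where "E z = K z - \<alpha> * P (fst z)"

lemma E_eq: "E z = (speed z)\<^sup>2 / (2 * m (fst z)) + W (fst z)"
proof -
  have "m (fst z) \<noteq> 0" using m_range(1)[of "fst z"] by auto
  then show ?thesis by (simp add: E_def K_def W_def speed_def field_simps power2_eq_square)
qed

lemma W_deriv: "(W has_real_derivative W1 x) (at x)"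
proof -
  have m0: "m x \<noteq> 0" using m_range(1)[of x] by auto
  show ?thesis unfolding W_def
    by (rule derivative_eq_intros b_deriv(1) a_deriv(1) m_deriv(1) P_deriv refl | simp add: m0)+
       (use m0 in \<open>simp add: W1_def field_simps power2_eq_square\<close>)
qed

text \<open>Where \<open>m = 2\<close> both the force of \<open>V\<close> and the linear term are directed to the origin. Where \<open>m\<close>
varies, the sign is that of \<open>m' \<beta> |x| - 2 (\<alpha> - \<beta>) m\<close>, which is controlled by the bound on \<open>m'\<close>. Near
the saddle \<open>W' = -a (a' + \<alpha>)\<close>.\<close>

lemma W1_neg: assumes "- D < x" "x < 0" shows "W1 x < 0"
proof -
  have m0: "1 \<le> m x" using m_range(1)[of x] by auto
  have b1: "b1 x \<le> 0" using b1_sign assms by auto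
  consider "- B \<le> x" | "- C \<le> x" "x \<le> - B" | "x < - C" by linarith
  then show ?thesis
  proof cases
    case 1
    have x: "\<bar>x\<bar> \<le> B" "\<bar>x\<bar> \<le> C" using 1 assms params by auto
    have "W1 x = b1 x + (\<alpha> - \<beta>) * \<beta> * x / 2"
      unfolding W1_def by (simp add: m_inner[OF x(1)] a_inner[OF x(2)] field_simps power2_eq_square)
    moreover have "(\<alpha> - \<beta>) * \<beta> * x / 2 < 0"
      using assms params by (simp add: mult_pos_neg)
    ultimately show ?thesis using b1 by linarith
  next
    case 2
    have x: "\<bar>x\<bar> \<le> C" "B \<le> \<bar>x\<bar>" "\<bar>x\<bar> \<le> D" using 2 assms params by auto
    have "W1 x = (\<beta> * (- x) / (2 * (m x)\<^sup>2)) * (m1 x * (\<beta> * (- x)) - 2 * (\<alpha> - \<beta>) * m x)"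
      unfolding W1_def using m0
      by (simp add: b_outer[OF x(2,3)] a_inner[OF x(1)] field_simps power2_eq_square)
    moreover have "m1 x * (\<beta> * (- x)) - 2 * (\<alpha> - \<beta>) * m x < 0"
    proof -
      have "2 * (\<alpha> - \<beta>) * 1 \<le> 2 * (\<alpha> - \<beta>) * m x" using m0 params by (intro mult_left_mono) auto
      then show ?thesis using m1_bound[OF 2] by linarith
    qed
    moreover have "0 < \<beta> * (- x) / (2 * (m x)\<^sup>2)" using assms params m0
      by (intro divide_pos_pos mult_pos_pos) auto
    ultimately show ?thesis by (simp only: mult_pos_neg)
  next
    case 3
    have x: "C < \<bar>x\<bar>" "\<bar>x\<bar> \<le> D" "B \<le> \<bar>x\<bar>" using 3 assms params by auto
    have "W1 x = - a x * (a1 x + \<alpha>)"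
      unfolding W1_def by (simp add: b_outer[OF x(3,2)] m_outer[OF x(1,2)] algebra_simps)
    moreover have "0 < a x" "0 < a1 x + \<alpha>" using a_sign(1) a1_bound[OF x(2)] assms params by auto
    ultimately show ?thesis by simp
  qed
qed

lemma W_min: assumes "\<bar>x\<bar> \<le> D" "x \<noteq> 0" shows "W 0 < W x"
proof -
  have "W 0 < W (- \<bar>x\<bar>)"
  proof (rule DERIV_neg_imp_decreasing_open[where f = W])
    fix z assume z: "- \<bar>x\<bar> < z" "z < 0"
    then have "W1 z < 0" using assms by (intro W1_neg) auto
    then show "\<exists>d. (W has_real_derivative d) (at z) \<and> d < 0" using W_deriv by blast
  next
    show "continuous_on {- \<bar>x\<bar>..0} W"
      by (rule DERIV_continuous_on) (use W_deriv has_field_derivative_at_within in blast)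
  qed (use assms in auto)
  moreover have "W (- x) = W x" by (simp add: W_def parity P_even)
  ultimately show ?thesis by (cases "0 \<le> x") auto
qed

lemma E_min: assumes "\<bar>fst z\<bar> \<le> D" "E z \<le> E 0" shows "z = 0"
proof -
  have m0: "0 < m (fst z)" using m_range(1)[of "fst z"] by auto
  have a0: "a 0 = 0" using parity(3)[of 0] by simp
  have E0: "E 0 = W 0" by (simp add: E_eq speed_def a0)
  have sq: "0 \<le> (speed z)\<^sup>2 / (2 * m (fst z))" using m0 by simp
  have x: "fst z = 0"
  proof (rule ccontr)
    assume "fst z \<noteq> 0"
    from W_min[OF assms(1) this] show False using assms(2) sq unfolding E0 E_eq[of z] by linarith
  qed
  then have "(speed z)\<^sup>2 / (2 * m (fst z)) \<le> 0" using assms(2) unfolding E0 E_eq[of z] by simp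
  then have "speed z = 0" using m0 sq by simp
  then have "snd z = 0" using x m0 a0 by (simp add: speed_def)
  then show ?thesis using x by (simp add: prod_eq_iff)
qed

text \<open>If \<open>x' = 0\<close> then \<open>y = -a/m\<close>, and \<open>y'\<close> becomes \<open>-W'(x)\<close>.\<close>

lemma zero_of_field: assumes "F z = 0" "\<bar>fst z\<bar> \<le> D" shows "z \<in> {0, (D, 0), (- D, 0)}"
proof -
  have sgn: "w \<notin> {w. F w = 0 \<and> - D < fst w \<and> fst w < 0}" for w
  proof
    assume "w \<in> {w. F w = 0 \<and> - D < fst w \<and> fst w < 0}"
    then have w: "speed w = 0" "Kx w + \<alpha> * snd w = 0" "- D < fst w" "fst w < 0"
      by (auto simp: F_def prod_eq_iff)
    have m0: "m (fst w) \<noteq> 0" using m_range(1)[of "fst w"] by auto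
    then have y: "snd w = - a (fst w) / m (fst w)" using w(1) by (simp add: speed_def field_simps)
    have "W1 (fst w) = Kx w + \<alpha> * snd w"
      unfolding W1_def Kx_def y using m0 by (simp add: field_simps power2_eq_square)
    then show False using W1_neg w by force
  qed
  have 1: "\<not> (- D < fst z \<and> fst z < 0)" using sgn[of z] assms by auto
  have 2: "\<not> (0 < fst z \<and> fst z < D)" using sgn[of "- z"] assms by (auto simp: F_odd)
  have "fst z = 0 \<or> fst z = D \<or> fst z = - D" using 1 2 assms(2) by linarith
  then have "a (fst z) = 0" using a_sign(2) parity(3)[of D] parity(3)[of 0] by auto
  moreover have "speed z = 0" using assms(1) by (simp add: F_def prod_eq_iff)
  ultimately have "snd z = 0" using m_range(1)[of "fst z"] by (auto simp: speed_def)
  then show ?thesis using \<open>fst z = 0 \<or> fst z = D \<or> fst z = - D\<close> by (auto simp: prod_eq_iff)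
qed

lemma E_along:
  assumes "solves F \<gamma> S" "t \<in> S"
  shows "((\<lambda>t. E (\<gamma> t)) has_real_derivative - \<alpha> * ((speed (\<gamma> t))\<^sup>2 / m (fst (\<gamma> t)))) (at t within S)"
proof -
  have m0: "m (fst (\<gamma> t)) \<noteq> 0" using m_range(1)[of "fst (\<gamma> t)"] by auto
  have "((\<lambda>t. K (\<gamma> t) - \<alpha> * P (fst (\<gamma> t))) has_real_derivative
    - \<alpha> * (snd (\<gamma> t) * speed (\<gamma> t)) - \<alpha> * (a (fst (\<gamma> t)) / m (fst (\<gamma> t)) * speed (\<gamma> t))) (at t within S)"
    by (intro DERIV_diff DERIV_cmult K_along[OF assms] DERIV_chain2[OF P_deriv] solves_components(1)[OF assms])
  then show ?thesis unfolding E_def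
    by (rule DERIV_cong) (use m0 in \<open>simp add: speed_def field_simps power2_eq_square\<close>)
qed

lemma E_decreasing:
  assumes "solves F \<gamma> S" "is_interval S" "s \<in> S" "t \<in> S" "s \<le> t"
  shows "E (\<gamma> t) \<le> E (\<gamma> s)"
proof (rule nonincreasing_on[OF E_along[OF assms(1)] assms(2)])
  fix r assume "r \<in> S"
  have "0 < m (fst (\<gamma> r))" using m_range(1)[of "fst (\<gamma> r)"] by auto
  then have "0 \<le> (speed (\<gamma> r))\<^sup>2 / m (fst (\<gamma> r))" by simp
  then show "- \<alpha> * ((speed (\<gamma> r))\<^sup>2 / m (fst (\<gamma> r))) \<le> 0"
    using params by (intro mult_nonpos_nonneg) auto
qed (use assms in auto)

lemma continuous_on_E: "continuous_on S E"
proof -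
  have "continuous_on UNIV P" by (rule DERIV_continuous_on) (rule has_field_derivative_at_within[OF P_deriv])
  then have "continuous_on S (\<lambda>z. P (fst z))"
    by (rule continuous_on_compose2) (auto intro!: continuous_intros)
  then show ?thesis unfolding E_def[abs_def]
    by (intro continuous_on_diff continuous_on_K continuous_on_mult continuous_on_const)
qed

text \<open>Constant energy means zero speed; then \<open>x\<close> is constant, and the speed determines \<open>y\<close>.\<close>

lemma E_constant_imp_equilibrium:
  assumes g: "solves F \<gamma> {0..}" and e: "\<And>s. 0 \<le> s \<Longrightarrow> E (\<gamma> s) = e"
  shows "F (\<gamma> 0) = 0"
proof -
  have int: "at s within {0..} = at s" if "0 < s" for s :: real
    by (rule at_within_interior) (use that in auto)
  have sp: "speed (\<gamma> s) = 0" if s: "0 < s" for s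
  proof -
    have "((\<lambda>t. E (\<gamma> t)) has_real_derivative - \<alpha> * ((speed (\<gamma> s))\<^sup>2 / m (fst (\<gamma> s)))) (at s)"
      using E_along[OF g, of s] s int[OF s] by simp
    moreover have "((\<lambda>t. E (\<gamma> t)) has_real_derivative 0) (at s)"
      by (rule has_field_derivative_transform_within_open[of "\<lambda>_. e" _ _ "{0<..}"]) (use s e in auto)
    ultimately have "- \<alpha> * ((speed (\<gamma> s))\<^sup>2 / m (fst (\<gamma> s))) = 0" by (rule DERIV_unique)
    then show ?thesis using params m_range(1)[of "fst (\<gamma> s)"] by auto
  qed
  have x: "fst (\<gamma> s) = fst (\<gamma> 1)" if s: "0 < s" for s
  proof -
    have g': "solves F \<gamma> {0<..}" by (rule solves_subset[OF g]) auto
    have "\<exists>c. \<forall>s\<in>{0<..}. fst (\<gamma> s) = c"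
    proof (rule has_field_derivative_zero_constant)
      fix s :: real assume "s \<in> {0<..}"
      then show "((\<lambda>t. fst (\<gamma> t)) has_real_derivative 0) (at s within {0<..})"
        using solves_components(1)[OF g', of s] sp[of s] by auto
    qed simp
    then obtain c where "\<And>s. 0 < s \<Longrightarrow> fst (\<gamma> s) = c" by auto
    then show ?thesis using s by simp
  qed
  have y: "snd (\<gamma> s) = - a (fst (\<gamma> s)) / m (fst (\<gamma> s))" if "0 < s" for s
    using sp[OF that] m_range(1)[of "fst (\<gamma> s)"] by (simp add: speed_def field_simps)
  have const: "\<gamma> s = \<gamma> 1" if "0 < s" for s using x[OF that] y[OF that] y[of 1] by (simp add: prod_eq_iff)
  have "(\<gamma> has_vector_derivative F (\<gamma> 1)) (at 1)"
  proof -
    have "(\<gamma> has_vector_derivative F (\<gamma> 1)) (at 1 within {0..})" using g unfolding solves_def by simp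
    then show ?thesis by (simp add: int)
  qed
  moreover have "(\<gamma> has_vector_derivative 0) (at 1)"
  proof (rule has_vector_derivative_transform_within_open)
    show "\<gamma> 1 = \<gamma> s" if "s \<in> {0<..}" for s using const[of s] that by simp
  qed auto
  ultimately have F1: "F (\<gamma> 1) = 0" by (rule vector_derivative_unique_at)
  obtain Y where Y: "\<And>z. K z \<le> max 0 (max (K (\<gamma> 0)) (K (\<gamma> 1))) \<Longrightarrow> \<bar>snd z\<bar> \<le> Y" using sublevel_strip by blast
  have "\<gamma> 0 = \<gamma> 1"
  proof (rule solves_F_unique[OF g _ _ , of "\<lambda>_. \<gamma> 1" 1 0 Y])
    show "solves F (\<lambda>_. \<gamma> 1) {0..}" unfolding solves_def using F1 by simp
    show "\<bar>snd (\<gamma> t)\<bar> \<le> Y" if "t \<in> {0..}" for t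
      by (rule Y) (use forward_sublevel[OF g, of t] that in auto)
    show "\<bar>snd (\<gamma> 1)\<bar> \<le> Y" by (rule Y) auto
  qed (auto simp: is_interval_ci)
  then show ?thesis using F1 by simp
qed

text \<open>LaSalle's principle. It is stated for a sequence of solutions so that it serves both for the future of a
solution (started at times \<open>n\<close>, translated back to the fundamental domain) and for its past (started at times \<open>-n\<close>): in
both cases the energies at each fixed delay \<open>s\<close> converge to the same value, so the energy is constant along the
solution through a limit point.\<close>

lemma limit_equilibrium:
  assumes sol: "\<And>n. solves F (\<gamma> n) {0..}" and c: "\<And>n. K (\<gamma> n 0) \<le> c"
    and x: "\<And>n. \<bar>fst (\<gamma> n 0)\<bar> \<le> D" and e: "\<And>s. 0 \<le> s \<Longrightarrow> (\<lambda>n. E (\<gamma> n s)) \<longlonglongrightarrow> e"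
  shows "\<exists>p (r :: nat \<Rightarrow> nat). p \<in> {0, (D, 0), (- D, 0)} \<and> strict_mono r \<and> (\<lambda>n. \<gamma> (r n) 0) \<longlonglongrightarrow> p \<and> E p = e"
proof -
  obtain Y where Y: "\<And>z. K z \<le> max 0 c \<Longrightarrow> \<bar>snd z\<bar> \<le> Y" using sublevel_strip by blast
  have "compact ({-D..D} \<times> {-Y..Y})" by (intro compact_Times compact_Icc)
  moreover have "\<gamma> n 0 \<in> {-D..D} \<times> {-Y..Y}" for n
    using x[of n] Y[of "\<gamma> n 0"] c[of n] by (auto simp: mem_Times_iff abs_le_iff le_max_iff_disj)
  ultimately obtain p r where p: "p \<in> {-D..D} \<times> {-Y..Y}" "strict_mono r" "((\<lambda>n. \<gamma> n 0) \<circ> r) \<longlonglongrightarrow> p"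
    unfolding compact_def by meson
  have lim: "(\<lambda>n. \<gamma> (r n) 0) \<longlonglongrightarrow> p" using p(3) by (simp add: o_def)
  obtain \<delta> where d: "\<delta> 0 = p" "solves F \<delta> {0..}" using forward_solution by blast
  have "(\<lambda>n. K (\<gamma> (r n) 0)) \<longlonglongrightarrow> K p"
    by (rule continuous_on_tendsto_compose[OF continuous_on_K[of UNIV] lim]) auto
  then have Kp: "K p \<le> c" by (rule LIMSEQ_le_const2) (use c in auto)
  obtain L where L: "\<And>z w. norm (clamped Y z - clamped Y w) \<le> L * norm (z - w)"
    using clamped_lipschitz by blast
  have Yd: "\<bar>snd (\<delta> s)\<bar> \<le> Y" if "0 \<le> s" for s
    by (rule Y) (use forward_sublevel[OF d(2) that] Kp d in auto)
  have Yg: "\<bar>snd (\<gamma> n s)\<bar> \<le> Y" if "0 \<le> s" for s n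
    by (rule Y) (use forward_sublevel[OF sol that, of n] c[of n] in auto)
  have conv: "(\<lambda>n. \<gamma> (r n) s) \<longlonglongrightarrow> \<delta> s" if s: "0 \<le> s" for s
  proof -
    have bd: "norm (\<gamma> (r n) s - \<delta> s) \<le> exp (L * (s - 0)) * norm (\<gamma> (r n) 0 - \<delta> 0)" for n
    proof (rule gronwall[of "clamped Y" _ 0 s])
      show "solves (clamped Y) (\<gamma> (r n)) {0..s}"
        by (rule solves_clamped_iff[THEN iffD2]) (use Yg solves_subset[OF sol, of "{0..s}"] in auto)
      show "solves (clamped Y) \<delta> {0..s}"
        by (rule solves_clamped_iff[THEN iffD2]) (use Yd solves_subset[OF d(2), of "{0..s}"] in auto)
    qed (use L s in auto)
    have "(\<lambda>n. norm (\<gamma> (r n) 0 - p)) \<longlonglongrightarrow> 0" using lim by (simp add: LIM_zero_iff tendsto_norm_zero_iff)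
    then have "(\<lambda>n. exp (L * (s - 0)) * norm (\<gamma> (r n) 0 - \<delta> 0)) \<longlonglongrightarrow> 0"
      unfolding d(1) by (rule tendsto_mult_right_zero)
    then have "(\<lambda>n. \<gamma> (r n) s - \<delta> s) \<longlonglongrightarrow> 0"
      by (rule Lim_null_comparison[rotated]) (use bd in auto)
    then show ?thesis by (simp add: LIM_zero_iff)
  qed
  have Ee: "E (\<delta> s) = e" if s: "0 \<le> s" for s
  proof -
    have "(\<lambda>n. E (\<gamma> (r n) s)) \<longlonglongrightarrow> E (\<delta> s)"
      by (rule continuous_on_tendsto_compose[OF continuous_on_E[of UNIV] conv[OF s]]) auto
    moreover have "(\<lambda>n. E (\<gamma> (r n) s)) \<longlonglongrightarrow> e"
      using LIMSEQ_subseq_LIMSEQ[OF e[OF s] p(2)] by (simp add: o_def)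
    ultimately show ?thesis by (rule LIMSEQ_unique)
  qed
  have "F p = 0" using E_constant_imp_equilibrium[OF d(2) Ee] d(1) by simp
  then have "p \<in> {0, (D, 0), (- D, 0)}" by (rule zero_of_field) (use p(1) in \<open>auto simp: mem_Times_iff\<close>)
  then show ?thesis using p(2) lim Ee[of 0] d(1) by (intro exI[of _ p] exI[of _ r] conjI) simp_all
qed

end

section \<open>The maximal invariant set\<close>

text \<open>\<open>G\<close> is the branch of the unstable manifold of the saddle that leaves \<open>x = -D\<close> to the right; the other
branch is \<open>-G\<close>.\<close>

locale damped_annulus_curve = damped_annulus +
  fixes G :: "real \<Rightarrow> real \<times> real"
  assumes G_solves: "solves F G UNIV"
    and K_G: "\<And>t. K (G t) \<le> 0"
    and G_axis: "\<And>x. - D < x \<Longrightarrow> x < - C \<Longrightarrow> \<exists>s. G s = (x, 0)"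
begin

definition curve :: "(real \<times> real) set" where
  "curve = {0, (D, 0)} \<union> range G \<union> uminus ` range G"

lemma values_at_equilibria: "a (- D) = 0" "K (D, 0) = 0" "K (- D, 0) = 0" "F 0 = 0" "F (D, 0) = 0"
proof -
  show aD: "a (- D) = 0" using a_sign(2) parity(3)[of D] by simp
  have bD: "b D = 0" "b (- D) = 0" "b1 D = 0" by (intro b_outer; use params in auto)+
  have 0: "a 0 = 0" "b1 0 = 0" using parity(3)[of 0] parity(6)[of 0] by auto
  show "K (D, 0) = 0" "K (- D, 0) = 0" "F 0 = 0" "F (D, 0) = 0"
    using aD bD 0 a_sign(2) by (simp_all add: K_def F_def Kx_def speed_def prod_eq_iff)
qed

lemma K_curve: assumes "z \<in> curve" shows "K z \<le> 0"
proof -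
  have "K 0 \<le> 0" using b_range(2)[of 0] by (simp add: K_def)
  then show ?thesis using assms K_G values_at_equilibria unfolding curve_def by (auto simp: F_odd)
qed

lemma curve_solution:
  assumes "z \<in> curve"
  shows "\<exists>\<gamma>. \<gamma> 0 = z \<and> solves F \<gamma> UNIV \<and> range \<gamma> \<subseteq> curve"
proof -
  have const: "solves F (\<lambda>_. w) UNIV" if "F w = 0" for w using that by (simp add: solves_def)
  have G: "solves F (\<lambda>t. G (t + s)) UNIV" for s by (rule solves_shift[OF G_solves]) auto
  consider "z = 0" | "z = (D, 0)" | s where "z = G s" | s where "z = - G s"
    using assms unfolding curve_def by auto
  then show ?thesis
  proof cases
    case 1 then show ?thesis using const[OF values_at_equilibria(4)] by (intro exI[of _ "\<lambda>_. 0"]) (auto simp: curve_def)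
  next
    case 2 then show ?thesis using const[OF values_at_equilibria(5)] by (intro exI[of _ "\<lambda>_. (D, 0)"]) (auto simp: curve_def)
  next
    case (3 s) then show ?thesis using G[of s] by (intro exI[of _ "\<lambda>t. G (t + s)"]) (auto simp: curve_def)
  next
    case (4 s) then show ?thesis using solves_negated[OF G[of s]]
      by (intro exI[of _ "\<lambda>t. - G (t + s)"]) (auto simp: curve_def)
  qed
qed

lemma curve_forward_invariant:
  assumes d: "solves F \<delta> {T..0}" "T \<le> 0" and K: "\<And>t. T \<le> t \<Longrightarrow> t \<le> 0 \<Longrightarrow> K (\<delta> t) \<le> 0"
    and w: "\<delta> T \<in> range G \<union> uminus ` range G"
  shows "\<delta> 0 \<in> curve"
proof -
  obtain Y where Y: "\<And>z. K z \<le> 0 \<Longrightarrow> \<bar>snd z\<bar> \<le> Y" using sublevel_strip by blast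
  have *: "\<delta> 0 = \<eta> 0" if "solves F \<eta> {T..0}" "\<delta> T = \<eta> T" "\<And>t. K (\<eta> t) \<le> 0" for \<eta>
    by (rule solves_F_unique[OF d(1) that(1), where ?t0.0 = T and Y = Y])
       (use d(2) that K Y in \<open>auto simp: is_interval_cc\<close>)
  have G: "solves F (\<lambda>t. G (t + c)) {T..0}" for c by (rule solves_shift[OF G_solves]) auto
  consider s where "\<delta> T = G s" | s where "\<delta> T = - G s" using w by auto
  then show ?thesis
  proof cases
    case (1 s)
    have "\<delta> 0 = G (0 + (s - T))" by (rule *[OF G]) (use 1 K_G in auto)
    then show ?thesis unfolding curve_def by blast
  next
    case (2 s)
    have "\<delta> 0 = - G (0 + (s - T))" by (rule *[OF solves_negated[OF G]]) (use 2 K_G in \<open>auto simp: F_odd\<close>)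
    then show ?thesis unfolding curve_def by blast
  qed
qed

text \<open>Near the saddle \<open>y' = -(a' + \<alpha>) y\<close> with \<open>a' + \<alpha> \<ge> \<alpha> - \<beta> > 0\<close>, so a non-zero \<open>y\<close> would grow
exponentially in the past, contradicting the bound that comes with \<open>K \<le> 0\<close>.\<close>

lemma snd_vanishes_near_saddle:
  assumes d: "solves F \<delta> {..T}" and K: "\<And>t. t \<le> T \<Longrightarrow> K (\<delta> t) \<le> 0"
    and x: "\<And>t. t \<le> T \<Longrightarrow> C < \<bar>fst (\<delta> t)\<bar> \<and> \<bar>fst (\<delta> t)\<bar> < D"
  shows "snd (\<delta> T) = 0"
proof (rule ccontr)
  assume n: "snd (\<delta> T) \<noteq> 0"
  obtain Y where Y: "\<And>z. K z \<le> 0 \<Longrightarrow> \<bar>snd z\<bar> \<le> Y" using sublevel_strip by blast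
  define k where "k = 2 * (\<alpha> - \<beta>)"
  have k: "0 < k" using params by (simp add: k_def)
  define u where "u t = exp (k * t) * (snd (\<delta> t))\<^sup>2" for t
  have mono: "u T \<le> u s" if "s \<le> T" for s
  proof (rule nonincreasing_on[where f = u and S = "{..T}"
        and f' = "\<lambda>t. exp (k * t) * ((k - 2 * (a1 (fst (\<delta> t)) + \<alpha>)) * (snd (\<delta> t))\<^sup>2)"])
    fix t assume t: "t \<in> {..T}"
    have xt: "C < \<bar>fst (\<delta> t)\<bar>" "\<bar>fst (\<delta> t)\<bar> \<le> D" "B \<le> \<bar>fst (\<delta> t)\<bar>" using x[of t] t params by auto
    have y': "- Kx (\<delta> t) - \<alpha> * snd (\<delta> t) = - (a1 (fst (\<delta> t)) + \<alpha>) * snd (\<delta> t)"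
      by (simp add: Kx_def m_outer(2)[OF xt(1,2)] b_outer(2)[OF xt(3,2)] algebra_simps)
    have "((\<lambda>t. snd (\<delta> t)) has_real_derivative - (a1 (fst (\<delta> t)) + \<alpha>) * snd (\<delta> t)) (at t within {..T})"
      using solves_components(2)[OF d t] unfolding y' .
    then show "(u has_real_derivative exp (k * t) * ((k - 2 * (a1 (fst (\<delta> t)) + \<alpha>)) * (snd (\<delta> t))\<^sup>2)) (at t within {..T})"
      unfolding u_def by (auto intro!: derivative_eq_intros simp: algebra_simps power2_eq_square)
    show "exp (k * t) * ((k - 2 * (a1 (fst (\<delta> t)) + \<alpha>)) * (snd (\<delta> t))\<^sup>2) \<le> 0"
      using a1_bound[OF xt(2)] by (intro mult_nonneg_nonpos mult_nonpos_nonneg) (auto simp: k_def)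
  qed (use that in \<open>auto simp: is_interval_ic\<close>)
  have q: "0 < u T" using n by (simp add: u_def)
  \<comment> \<open>Early enough for \<open>exp (k s) Y\<^sup>2\<close> to be smaller than \<open>u T\<close>.\<close>
  define s where "s = min T (ln (u T / (Y\<^sup>2 + 1)) / k)"
  have Y1: "0 < Y\<^sup>2 + 1" by (simp add: add_nonneg_pos)
  have "k * s \<le> ln (u T / (Y\<^sup>2 + 1))"
    using k mult_left_mono[of s "ln (u T / (Y\<^sup>2 + 1)) / k" k] by (simp add: s_def)
  then have "exp (k * s) \<le> u T / (Y\<^sup>2 + 1)" using q Y1 by (metis divide_pos_pos exp_le_cancel_iff exp_ln)
  moreover have "(snd (\<delta> s))\<^sup>2 \<le> Y\<^sup>2"
    using Y[OF K[of s]] by (simp add: s_def abs_le_square_iff[symmetric])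
  ultimately have "u s \<le> u T / (Y\<^sup>2 + 1) * Y\<^sup>2" unfolding u_def
    by (intro mult_mono) (use q Y1 in \<open>auto simp: u_def\<close>)
  also have "\<dots> < u T" using q Y1 by (simp add: field_simps)
  finally have "u s < u T" .
  moreover have "u T \<le> u s" by (rule mono) (simp add: s_def)
  ultimately show False by simp
qed

text \<open>The energy \<open>e\<close> at time \<open>-\<infinity>\<close> is the energy of an equilibrium. If it is that of the sink, the minimum,
the solution is the sink. If it is that of the saddle, namely \<open>0\<close>, then \<open>\<alpha>P \<le> -E \<rightarrow> 0\<close> pushes the
solution towards \<open>|x| = D\<close>, where only the axis remains.\<close>

lemma capture_strip:
  assumes d: "solves F \<delta> {..0}" and K: "\<And>t. t \<le> 0 \<Longrightarrow> K (\<delta> t) \<le> 0"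
    and x: "\<And>t. t \<le> 0 \<Longrightarrow> \<bar>fst (\<delta> t)\<bar> < D"
  shows "\<delta> 0 \<in> curve"
proof -
  obtain Y where Y: "\<And>z. K z \<le> 0 \<Longrightarrow> \<bar>snd z\<bar> \<le> Y" using sublevel_strip by blast
  have Edec: "E (\<delta> t) \<le> E (\<delta> s)" if "s \<le> t" "t \<le> 0" for s t
    by (rule E_decreasing[OF d]) (use that in \<open>auto simp: is_interval_ic\<close>)
  define f where "f n = E (\<delta> (- real n))" for n
  have "compact ({-D..D} \<times> {-Y..Y})" by (intro compact_Times compact_Icc)
  then have "bounded (E ` ({-D..D} \<times> {-Y..Y}))"
    by (intro compact_imp_bounded compact_continuous_image continuous_on_E)
  then obtain M where M: "\<And>z. z \<in> {-D..D} \<times> {-Y..Y} \<Longrightarrow> norm (E z) \<le> M"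
    unfolding bounded_iff by auto
  have fM: "\<bar>f n\<bar> \<le> M" for n
  proof -
    have "\<delta> (- real n) \<in> {-D..D} \<times> {-Y..Y}"
      using x[of "- real n"] Y[OF K[of "- real n"]] by (auto simp: mem_Times_iff abs_le_iff)
    from M[OF this] show ?thesis by (simp add: f_def)
  qed
  have inc: "incseq f" unfolding f_def by (intro incseq_SucI Edec) auto
  obtain e where e: "f \<longlonglongrightarrow> e"
  proof (rule incseq_convergent[OF inc, of M])
    show "\<forall>i. f i \<le> M" using fM by (simp add: abs_le_iff)
  qed
  have Ee: "E (\<delta> t) \<le> e" if "t \<le> 0" for t
  proof -
    obtain n where n: "- t \<le> real n" using real_arch_simple by blast
    then have "E (\<delta> t) \<le> f n" unfolding f_def by (intro Edec) (use that in auto)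
    also have "\<dots> \<le> e" by (rule incseq_le[OF inc e])
    finally show ?thesis .
  qed
  have flow: "sol (\<delta> (- real n)) s = \<delta> (s - real n)" if "0 \<le> s" "s \<le> real n" for s n
  proof -
    have 1: "solves F (\<lambda>t. \<delta> (t + - real n)) {0..real n}" by (rule solves_shift[OF d]) auto
    have 2: "solves F (sol (\<delta> (- real n))) {0..real n}" by (rule solves_subset[OF sol(2)]) auto
    have 3: "K (sol (\<delta> (- real n)) t) \<le> 0" if "0 \<le> t" for t
    proof -
      have "K (sol (\<delta> (- real n)) t) \<le> max 0 (K (sol (\<delta> (- real n)) 0))"
        by (rule forward_sublevel[OF sol(2) that])
      also have "\<dots> = 0" using K[of "- real n"] by (simp add: sol)
      finally show ?thesis .
    qed
    have "sol (\<delta> (- real n)) s = \<delta> (s + - real n)"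
    proof (rule solves_F_unique[OF 2 1, where ?t0.0 = 0 and Y = Y])
      show "\<bar>snd (sol (\<delta> (- real n)) t)\<bar> \<le> Y" if "t \<in> {0..real n}" for t
        by (rule Y[OF 3]) (use that in simp)
      show "\<bar>snd (\<delta> (t + - real n))\<bar> \<le> Y" if "t \<in> {0..real n}" for t
        by (rule Y[OF K]) (use that in simp)
    qed (use that in \<open>simp_all add: sol is_interval_cc\<close>)
    then show ?thesis by simp
  qed
  have lim: "(\<lambda>n. E (sol (\<delta> (- real n)) s)) \<longlonglongrightarrow> e" if s: "0 \<le> s" for s
  proof -
    obtain k where k: "s \<le> real k" using real_arch_simple by blast
    have h1: "(\<lambda>n. f (n - k)) \<longlonglongrightarrow> e"
      by (rule LIMSEQ_offset[of _ k]) (simp add: e)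
    have h2: "f (n - k) \<le> E (sol (\<delta> (- real n)) s) \<and> E (sol (\<delta> (- real n)) s) \<le> f n" if n: "k \<le> n" for n
    proof -
      have "E (sol (\<delta> (- real n)) s) = E (\<delta> (s - real n))" by (subst flow) (use s k n in auto)
      moreover have "f (n - k) \<le> E (\<delta> (s - real n))" unfolding f_def by (rule Edec) (use s k n in auto)
      moreover have "E (\<delta> (s - real n)) \<le> f n" unfolding f_def by (rule Edec) (use s k n in auto)
      ultimately show ?thesis by simp
    qed
    show ?thesis
      by (rule tendsto_sandwich[OF _ _ h1 e]) (use h2 in \<open>auto simp: eventually_sequentially\<close>)
  qed
  obtain p r where p: "p \<in> {0, (D, 0), (- D, 0)}" "E p = e"
  proof -
    have "K (sol (\<delta> (- real n)) 0) \<le> 0" "\<bar>fst (sol (\<delta> (- real n)) 0)\<bar> \<le> D" for n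
      using K[of "- real n"] x[of "- real n"] by (simp_all add: sol)
    from limit_equilibrium[OF sol(2) this lim] show ?thesis using that by blast
  qed
  show ?thesis
  proof (cases "p = 0")
    case True
    have "\<delta> 0 = 0" by (rule E_min) (use x[of 0] Ee[of 0] p True in auto)
    then show ?thesis by (simp add: curve_def)
  next
    case False
    \<comment> \<open>\<open>K\<close> and \<open>P\<close> both vanish at the saddle.\<close>
    have e0: "e = 0" using p False values_at_equilibria P_D P_even[of D] by (auto simp: E_def)
    have PC: "0 < P C" using P_mono[of C D] params P_D by simp
    then have "- \<alpha> * P C < e" using e0 params by (simp add: mult_neg_pos)
    then obtain N where N: "- \<alpha> * P C < f N"
      using order_tendstoD(1)[OF e] by (auto simp: eventually_sequentially)
    have far: "C < \<bar>fst (\<delta> t)\<bar>" if t: "t \<le> - real N" for t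
    proof (rule ccontr)
      assume "\<not> C < \<bar>fst (\<delta> t)\<bar>"
      then consider "\<bar>fst (\<delta> t)\<bar> < \<bar>C\<bar>" | "fst (\<delta> t) = C" | "fst (\<delta> t) = - C"
        using params by linarith
      then have "P C \<le> P (fst (\<delta> t))"
      proof cases
        case 1
        then have "P C < P (fst (\<delta> t))" by (rule P_mono) (use params in auto)
        then show ?thesis by simp
      qed (use P_even in auto)
      then have "\<alpha> * P C \<le> \<alpha> * P (fst (\<delta> t))" using params by simp
      moreover have "f N \<le> E (\<delta> t)" unfolding f_def by (rule Edec) (use t in auto)
      moreover have "K (\<delta> t) \<le> 0" using K t by auto
      ultimately show False using N by (simp add: E_def)
    qed
    let ?T = "- real N"
    have y: "snd (\<delta> ?T) = 0"
      by (rule snd_vanishes_near_saddle[OF solves_subset[OF d]]) (use K x far in auto)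
    have "\<delta> ?T \<in> range G \<union> uminus ` range G"
    proof (cases "fst (\<delta> ?T) < 0")
      case True
      then obtain s where "G s = (fst (\<delta> ?T), 0)" using G_axis[of "fst (\<delta> ?T)"] far[of ?T] x[of ?T] by auto
      then have "\<delta> ?T = G s" using y by (simp add: prod_eq_iff)
      then show ?thesis by blast
    next
      case False
      then obtain s where "G s = (- fst (\<delta> ?T), 0)" using G_axis[of "- fst (\<delta> ?T)"] far[of ?T] x[of ?T] by auto
      then have "\<delta> ?T = - G s" using y by (simp add: prod_eq_iff)
      then show ?thesis by blast
    qed
    then show ?thesis
      by (intro curve_forward_invariant[of \<delta> ?T] solves_subset[OF d]) (use K in auto)
  qed
qed

text \<open>A solution with \<open>K \<le> 0\<close> can meet the fibre over \<open>D\<close> only at the saddle. So either it is the saddle, or a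
lift of it stays in the open fundamental strip.\<close>

lemma capture:
  assumes g: "solves F \<gamma> {..0}" and K: "\<And>t. t \<le> 0 \<Longrightarrow> K (\<gamma> t) \<le> 0"
  shows "cover D (\<gamma> 0) \<in> cover D ` curve"
proof (cases "\<exists>t\<le>0. wrap D (fst (\<gamma> t)) = - D")
  case True
  then obtain t where t: "t \<le> 0" "wrap D (fst (\<gamma> t)) = - D" by blast
  define n where "n = \<lfloor>(fst (\<gamma> t) + D) / (2 * D)\<rfloor>"
  have x: "fst (\<gamma> t) = D + 2 * D * of_int (n - 1)" using t(2) by (simp add: wrap_def n_def algebra_simps)
  then have gt: "\<gamma> t = (D, snd (\<gamma> t)) + (2 * D * of_int (n - 1), 0)" by (simp add: prod_eq_iff)
  have "K (D, snd (\<gamma> t)) \<le> 0" using K[OF t(1)] gt F_shift(2)[of "(D, snd (\<gamma> t))" "n - 1"] by simp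
  moreover have "m D = 1" "b D = 0" using m_outer(1)[of D] b_outer(1)[of D] params by auto
  ultimately have y: "snd (\<gamma> t) = 0" using a_sign(2) by (simp add: K_def)
  have F0: "F (\<gamma> t) = 0" using gt y F_shift(1)[of "(D, 0)" "n - 1"] values_at_equilibria(5) by simp
  obtain Y where Y: "\<And>z. K z \<le> 0 \<Longrightarrow> \<bar>snd z\<bar> \<le> Y" using sublevel_strip by blast
  have "\<gamma> 0 = \<gamma> t"
    by (rule solves_F_unique[where \<gamma> = \<gamma> and \<delta> = "\<lambda>_. \<gamma> t" and S = "{..0}" and ?t0.0 = t and Y = Y])
       (use g F0 t K Y in \<open>auto simp: solves_def is_interval_ic\<close>)
  moreover have "\<gamma> t = (D, 0) + (2 * D * of_int (n - 1), 0)" using gt y by simp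
  then have "cover D (D, 0) = cover D (\<gamma> t)" using cover_eq_iff[OF D_pos] by blast
  ultimately show ?thesis by (auto simp: curve_def)
next
  case False
  define n where "n = \<lfloor>(fst (\<gamma> 0) + D) / (2 * D)\<rfloor>"
  define \<delta> where "\<delta> t = \<gamma> t + (2 * D * of_int (- n), 0)" for t
  have d: "solves F \<delta> {..0}" unfolding \<delta>_def by (rule solves_shifted[OF g])
  have wr: "wrap D (fst (\<delta> t)) = wrap D (fst (\<gamma> t))" for t
    using wrap_shift[OF D_pos, of "fst (\<gamma> t)" "- n"] by (simp add: \<delta>_def)
  have d0: "fst (\<delta> 0) = wrap D (fst (\<gamma> 0))" by (simp add: \<delta>_def wrap_def n_def)
  have never: "fst (\<delta> t) \<noteq> D" "fst (\<delta> t) \<noteq> - D" if "t \<le> 0" for t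
    using wr[of t] False that wrap_eq[OF D_pos, of "- D"] wrap_shift[OF D_pos, of "- D" 1] D_pos by auto
  have cont: "continuous_on {t..0} (\<lambda>t. fst (\<delta> t))" for t
    using continuous_on_fst[OF solves_continuous_on[OF d]] by (rule continuous_on_subset) auto
  have in_strip: "\<bar>fst (\<delta> t)\<bar> < D" if t: "t \<le> 0" for t
  proof (rule ccontr)
    assume "\<not> \<bar>fst (\<delta> t)\<bar> < D"
    then consider "D \<le> fst (\<delta> t)" | "fst (\<delta> t) \<le> - D" by linarith
    then show False
    proof cases
      case 1
      have "\<exists>s\<ge>t. s \<le> 0 \<and> fst (\<delta> s) = D"
        by (rule IVT2'[OF _ 1 t cont]) (use d0 wrap_range[OF D_pos] less_imp_le in auto)
      then show False using never by blast
    next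
      case 2
      have "\<exists>s\<ge>t. s \<le> 0 \<and> fst (\<delta> s) = - D"
        by (rule IVT'[OF 2 _ t cont]) (use d0 wrap_range[OF D_pos] in auto)
      then show False using never by blast
    qed
  qed
  have "\<delta> 0 \<in> curve"
    by (rule capture_strip[OF d _ in_strip]) (use K in \<open>simp_all add: \<delta>_def F_shift del: of_int_minus\<close>)
  moreover have "cover D (\<gamma> 0) = cover D (\<delta> 0)"
    using cover_eq_iff[OF D_pos, of "\<gamma> 0" "\<delta> 0"] unfolding \<delta>_def by blast
  ultimately show ?thesis by auto
qed

lemma forward_limit:
  assumes g: "solves F \<gamma> {0..}"
  shows "\<exists>p t. p \<in> cover D ` curve \<and> (\<forall>n. 0 \<le> t n) \<and> (\<lambda>n::nat. cover D (\<gamma> (t n))) \<longlonglongrightarrow> p"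
proof -
  define c where "c = max 0 (K (\<gamma> 0))"
  obtain Y where Y: "\<And>z. K z \<le> c \<Longrightarrow> \<bar>snd z\<bar> \<le> Y" using sublevel_strip by blast
  define N where "N i = \<lfloor>(fst (\<gamma> (real i)) + D) / (2 * D)\<rfloor>" for i :: nat
  define \<gamma>' where "\<gamma>' i t = \<gamma> (t + real i) + (2 * D * of_int (- N i), 0)" for i t
  have sol': "solves F (\<gamma>' i) {0..}" for i
    unfolding \<gamma>'_def by (intro solves_shifted solves_shift[OF g]) auto
  have Eper: "E (z + (2 * D * of_int n, 0)) = E z" for z n
    using F_shift(2)[of z n] periodic_wrap(1)[of P D, OF P_periodic] by (simp add: E_def)
  have x': "\<bar>fst (\<gamma>' i 0)\<bar> \<le> D" for i
  proof -
    have "fst (\<gamma>' i 0) = wrap D (fst (\<gamma> (real i)))" by (simp add: \<gamma>'_def wrap_def N_def)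
    then show ?thesis using wrap_range[OF D_pos, of "fst (\<gamma> (real i))"] by auto
  qed
  have Kc: "K (\<gamma> t) \<le> c" if "0 \<le> t" for t using forward_sublevel[OF g that] by (simp add: c_def)
  have K': "K (\<gamma>' i 0) \<le> c" for i using Kc[of "real i"] unfolding \<gamma>'_def F_shift by simp
  have Edec: "E (\<gamma> t) \<le> E (\<gamma> s)" if "0 \<le> s" "s \<le> t" for s t
    by (rule E_decreasing[OF g]) (use that in \<open>auto simp: is_interval_ci\<close>)
  have E0: "E 0 \<le> E (\<gamma>' i 0)" for i
    using E_min[OF x'[of i]] by (cases "E (\<gamma>' i 0) \<le> E 0") auto
  define f where "f i = E (\<gamma> (real i))" for i :: nat
  have f': "E (\<gamma>' i t) = E (\<gamma> (t + real i))" for i t unfolding \<gamma>'_def Eper ..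
  have dec: "decseq f" unfolding f_def by (intro decseq_SucI Edec) auto
  have "E 0 \<le> f i" for i using E0[of i] unfolding f' f_def by simp
  then obtain e where e: "f \<longlonglongrightarrow> e" using decseq_convergent[OF dec] by blast
  have lim: "(\<lambda>i. E (\<gamma>' i s)) \<longlonglongrightarrow> e" if s: "0 \<le> s" for s
  proof -
    obtain k where k: "s \<le> real k" using real_arch_simple by blast
    have h1: "(\<lambda>n. f (n + k)) \<longlonglongrightarrow> e" using e by (rule LIMSEQ_ignore_initial_segment)
    have h2: "f (n + k) \<le> E (\<gamma>' n s)" "E (\<gamma>' n s) \<le> f n" for n
      unfolding f' f_def by (intro Edec; use s k in auto)+
    show ?thesis
      by (rule tendsto_sandwich[OF _ _ h1 e]) (use h2 in auto)
  qed
  obtain p r where p: "p \<in> {0, (D, 0), (- D, 0)}" "(\<lambda>n. \<gamma>' (r n) 0) \<longlonglongrightarrow> p"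
    using limit_equilibrium[OF sol' K' x' lim] by blast
  have "cover D (- D, 0) = cover D (D, 0)" using cover_eq_iff[OF D_pos, of "(- D, 0)" "(D, 0)"]
    by (auto intro!: exI[of _ 1])
  then have "cover D p \<in> cover D ` curve" using p(1) by (auto simp: curve_def)
  moreover have "(\<lambda>n. cover D (\<gamma>' (r n) 0)) \<longlonglongrightarrow> cover D p"
    by (rule continuous_on_tendsto_compose[OF continuous_on_cover[of UNIV] p(2)]) auto
  moreover have "cover D (\<gamma>' i 0) = cover D (\<gamma> (real i))" for i
  proof -
    have "\<gamma>' i 0 = \<gamma> (real i) + (2 * D * of_int (- N i), 0)" by (simp add: \<gamma>'_def)
    then have "cover D (\<gamma> (real i)) = cover D (\<gamma>' i 0)" using cover_eq_iff[OF D_pos] by blast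
    then show ?thesis by simp
  qed
  ultimately show ?thesis by (intro exI[of _ "cover D p"] exI[of _ "\<lambda>n. real (r n)"]) auto
qed

theorem curve_is_global_attractor:
  assumes "compact (cover D ` curve)"
  shows "is_global_attractor D F (cover D ` curve)"
proof -
  let ?Q = "cover D ` curve" and ?U = "cover D ` {z. K z < 1}"
  have "?Q \<subseteq> annulus" using cover_in_annulus by auto
  moreover have "?Q \<noteq> {}" by (auto simp: curve_def)
  moreover have QU: "?Q \<subseteq> ?U" using K_curve by force
  moreover have "flow t ` (top_of_set annulus closure_of ?U) \<subseteq> ?U" if "0 < t" for t
    using flow_into_sublevel[OF _ that] sublevel_images(2) by blast
  moreover have "?Q = (\<Inter>t\<in>{0<..}. flow t ` ?U)"
  proof (intro equalityI subsetI INT_I)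
    fix q and t :: real assume q: "q \<in> ?Q" and t: "t \<in> {0<..}"
    then obtain z where z: "z \<in> curve" "q = cover D z" by blast
    obtain \<gamma> where g: "\<gamma> 0 = z" "solves F \<gamma> UNIV" "range \<gamma> \<subseteq> curve" using curve_solution[OF z(1)] by blast
    have "flow t (cover D (\<gamma> (0 + - t))) = cover D (\<gamma> (t + - t))"
      by (rule flow_cover[OF solves_shift[OF g(2)]]) (use t in auto)
    then have "q = flow t (cover D (\<gamma> (- t)))" using z g by simp
    moreover have "cover D (\<gamma> (- t)) \<in> ?U" using QU g(3) by blast
    ultimately show "q \<in> flow t ` ?U" by (rule image_eqI)
  next
    fix q assume q: "q \<in> (\<Inter>t\<in>{0<..}. flow t ` ?U)"
    then have "q \<in> flow 1 ` ?U" by auto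
    then have "q \<in> annulus" by (elim imageE) (simp add: flow_def cover_in_annulus)
    then obtain z where z: "cover D z = q" using cover_surj[OF D_pos] by blast
    obtain \<gamma> where "\<gamma> 0 = z" "solves F \<gamma> {..0}" "\<forall>t\<le>0. K (\<gamma> t) \<le> 0"
      using backward_solution[OF _ z] q by auto
    then show "q \<in> ?Q" using capture[of \<gamma>] z by auto
  qed
  ultimately have "attractor annulus flow ?Q"
    unfolding attractor_def using assms sublevel_images(1) by blast
  moreover have "\<exists>t\<ge>0. flow t z \<in> V" if V: "openin (top_of_set annulus) V" "?Q \<subseteq> V" "z \<in> annulus" for V z
  proof -
    obtain w where w: "cover D w = z" using cover_surj[OF D_pos V(3)] by blast
    obtain p t where p: "p \<in> ?Q" "\<And>n. 0 \<le> t n" "(\<lambda>n::nat. cover D (sol w (t n))) \<longlonglongrightarrow> p"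
      using forward_limit[OF sol(2)[of w]] by blast
    obtain T where T: "open T" "V = annulus \<inter> T" using V(1) unfolding openin_open by blast
    have "eventually (\<lambda>n. cover D (sol w (t n)) \<in> T) sequentially"
      by (rule topological_tendstoD[OF p(3) T(1)]) (use p(1) V(2) T in auto)
    then obtain n where "cover D (sol w (t n)) \<in> T" by (auto simp: eventually_sequentially)
    moreover have "flow (t n) z = cover D (sol w (t n))"
      using flow_cover[OF sol(2)[of w] p(2)] w by (simp add: sol)
    ultimately show ?thesis using p(2) T cover_in_annulus by (intro exI[of _ "t n"]) auto
  qed
  ultimately show ?thesis
    unfolding is_global_attractor_def global_attractor_def using flow_is_forward_flow by blast
qed

end

section \<open>The planar orbit\<close>

text \<open>The system in the strip \<open>|x| \<le> B\<close>. The lower bound on \<open>A\<close> keeps the kick so small that the orbit turns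
back before \<open>x = A\<close> and that \<open>middle_shear_gentle\<close> holds.\<close>

locale planar_potential =
  fixes \<alpha> \<beta> A B :: real and V V1 V2 :: "real \<Rightarrow> real"
  assumes params: "0 < \<beta>" "\<beta> < \<alpha>" "\<alpha> < 2 * \<beta>" "0 < A" "A < B"
    and V_deriv: "\<And>x. (V has_real_derivative V1 x) (at x)" "\<And>x. (V1 has_real_derivative V2 x) (at x)"
    and V2_cont: "continuous_on UNIV V2"
    and V1_odd: "\<And>x. V1 (- x) = - V1 x"
    and V_outer: "\<And>x. B \<le> \<bar>x\<bar> \<Longrightarrow> V x = 0" "\<And>x. B \<le> \<bar>x\<bar> \<Longrightarrow> V1 x = 0"
    and V_inner: "\<And>x. \<bar>x\<bar> \<le> A \<Longrightarrow> V x = - 1" "\<And>x. \<bar>x\<bar> \<le> A \<Longrightarrow> V1 x = 0"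
    and V1_sign: "\<And>x. x \<le> - A \<Longrightarrow> V1 x \<le> 0"
    and A_large: "12 / (\<beta> * (2 * \<beta> - \<alpha>)) \<le> A\<^sup>2"
begin

definition Fp :: "real \<times> real \<Rightarrow> real \<times> real" where
  "Fp z = (- \<beta> * fst z + 2 * snd z, - V1 (fst z) + (\<beta> - \<alpha>) * snd z)"

lemma B_pos: "0 < B" using params by linarith

lemma V1_lipschitz: "\<exists>M\<ge>0. \<forall>x y. \<bar>V1 x - V1 y\<bar> \<le> M * \<bar>x - y\<bar>"
proof -
  have "compact (V2 ` {-B..B})"
    by (intro compact_continuous_image compact_Icc continuous_on_subset[OF V2_cont]) auto
  then obtain M where M: "\<And>y. y \<in> V2 ` {-B..B} \<Longrightarrow> norm y \<le> M"
    using compact_imp_bounded[of "V2 ` {-B..B}"] unfolding bounded_iff by auto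
  have b: "\<bar>V2 x\<bar> \<le> M" for x
  proof (cases "\<bar>x\<bar> \<le> B")
    case True then show ?thesis using M[of "V2 x"] by (auto simp: abs_le_iff)
  next
    case False
    have "open {x :: real. B < \<bar>x\<bar>}" by (intro open_Collect_less continuous_intros)
    then have "(V1 has_real_derivative 0) (at x)"
      by (rule has_field_derivative_transform_within_open[of "\<lambda>_. 0" _ _ "{x. B < \<bar>x\<bar>}", rotated])
         (use False V_outer(2) in auto)
    then have "V2 x = 0" using DERIV_unique V_deriv(2) by blast
    moreover have "0 \<le> M" using M[of "V2 0"] B_pos by (force intro: order_trans[OF norm_ge_zero])
    ultimately show ?thesis by simp
  qed
  have "\<bar>V1 x - V1 y\<bar> \<le> M * \<bar>x - y\<bar>" for x y
    using field_differentiable_bound[of UNIV V1 V2 M x y] V_deriv(2) b by simp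
  moreover have "0 \<le> M" using b[of 0] by linarith
  ultimately show ?thesis by blast
qed

lemma Fp_lipschitz: "\<exists>L. \<forall>z w. norm (Fp z - Fp w) \<le> L * norm (z - w)"
proof -
  obtain M where M: "0 \<le> M" "\<And>x y. \<bar>V1 x - V1 y\<bar> \<le> M * \<bar>x - y\<bar>" using V1_lipschitz by blast
  have "norm (Fp z - Fp w) \<le> ((\<beta> + 2) + (M + (\<alpha> - \<beta>))) * norm (z - w)" for z w
  proof -
    let ?x = "fst z - fst w" and ?y = "snd z - snd w" and ?n = "norm (z - w)"
    have n: "\<bar>?x\<bar> \<le> ?n" "\<bar>?y\<bar> \<le> ?n" using dist_fst_le[of z w] dist_snd_le[of z w] by (auto simp: dist_norm)
    have e: "Fp z - Fp w = (- \<beta> * ?x + 2 * ?y, - (V1 (fst z) - V1 (fst w)) + (\<beta> - \<alpha>) * ?y)"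
      by (simp add: Fp_def algebra_simps)
    have "\<bar>- \<beta> * p + 2 * q\<bar> \<le> \<beta> * \<bar>p\<bar> + 2 * \<bar>q\<bar>" for p q
      using abs_triangle_ineq[of "- \<beta> * p" "2 * q"] params by (simp add: abs_mult)
    from this[of ?x ?y] have "\<bar>- \<beta> * ?x + 2 * ?y\<bar> \<le> \<beta> * \<bar>?x\<bar> + 2 * \<bar>?y\<bar>" .
    also have "\<dots> \<le> \<beta> * ?n + 2 * ?n" using n params by (intro add_mono mult_left_mono) auto
    finally have 1: "\<bar>- \<beta> * ?x + 2 * ?y\<bar> \<le> (\<beta> + 2) * ?n" by (simp add: algebra_simps)
    have "\<bar>- (V1 (fst z) - V1 (fst w)) + (\<beta> - \<alpha>) * ?y\<bar> \<le> \<bar>V1 (fst z) - V1 (fst w)\<bar> + (\<alpha> - \<beta>) * \<bar>?y\<bar>"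
      using abs_triangle_ineq[of "- (V1 (fst z) - V1 (fst w))" "(\<beta> - \<alpha>) * ?y"] params by (simp add: abs_mult)
    also have "\<dots> \<le> M * ?n + (\<alpha> - \<beta>) * ?n"
      using n params M(1) order_trans[OF M(2) mult_left_mono[OF n(1) M(1)]] by (intro add_mono mult_left_mono) auto
    finally have 2: "\<bar>- (V1 (fst z) - V1 (fst w)) + (\<beta> - \<alpha>) * ?y\<bar> \<le> (M + (\<alpha> - \<beta>)) * ?n"
      by (simp add: algebra_simps)
    show ?thesis unfolding e using norm_Pair_le[of "- \<beta> * ?x + 2 * ?y" "- (V1 (fst z) - V1 (fst w)) + (\<beta> - \<alpha>) * ?y"] 1 2
      unfolding distrib_right real_norm_def by linarith
  qed
  then show ?thesis by blast
qed

lemma Fp_unique: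
  assumes "solves Fp \<gamma> S" "solves Fp \<eta> S" "is_interval S" "t0 \<in> S" "t \<in> S" "\<gamma> t0 = \<eta> t0"
  shows "\<gamma> t = \<eta> t"
proof -
  obtain L where L: "\<And>z w. norm (Fp z - Fp w) \<le> L * norm (z - w)" using Fp_lipschitz by blast
  show ?thesis by (rule solves_unique[OF assms, of L]) (rule L)
qed

definition g :: "real \<Rightarrow> real \<times> real" where
  "g = (SOME \<gamma>. \<gamma> 0 = (- B, 0) \<and> solves Fp \<gamma> UNIV)"

lemma g0: "g 0 = (- B, 0)" and g_solves: "solves Fp g UNIV"
proof -
  have "\<exists>\<gamma>. \<gamma> 0 = (- B, 0) \<and> solves Fp \<gamma> UNIV"
    using solution_exists[of Fp] Fp_lipschitz by blast
  from someI_ex[OF this] show "g 0 = (- B, 0)" "solves Fp g UNIV" unfolding g_def by blast+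
qed

definition gx :: "real \<Rightarrow> real" where "gx t = fst (g t)"
definition gy :: "real \<Rightarrow> real" where "gy t = snd (g t)"

lemma g_eq: "g t = (gx t, gy t)" by (simp add: gx_def gy_def)

lemma gx_deriv: "(gx has_real_derivative - \<beta> * gx t + 2 * gy t) (at t within S)"
  and gy_deriv: "(gy has_real_derivative - V1 (gx t) + (\<beta> - \<alpha>) * gy t) (at t within S)"
proof -
  have d: "(g has_derivative (\<lambda>h. h *\<^sub>R Fp (g t))) (at t)"
    using g_solves unfolding solves_def has_vector_derivative_def by blast
  have "(gx has_real_derivative - \<beta> * gx t + 2 * gy t) (at t)"
    using has_derivative_fst[OF d] unfolding has_field_derivative_def gx_def[abs_def]
    by (rule has_derivative_eq_rhs) (auto simp: Fp_def gy_def)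
  then show "(gx has_real_derivative - \<beta> * gx t + 2 * gy t) (at t within S)"
    by (rule has_field_derivative_at_within)
  have "(gy has_real_derivative - V1 (gx t) + (\<beta> - \<alpha>) * gy t) (at t)"
    using has_derivative_snd[OF d] unfolding has_field_derivative_def gy_def[abs_def]
    by (rule has_derivative_eq_rhs) (auto simp: Fp_def gx_def)
  then show "(gy has_real_derivative - V1 (gx t) + (\<beta> - \<alpha>) * gy t) (at t within S)"
    by (rule has_field_derivative_at_within)
qed

lemma continuous_on_gx: "continuous_on S gx" and continuous_on_gy: "continuous_on S gy"
  by (rule DERIV_continuous_on, rule gx_deriv, rule DERIV_continuous_on, rule gy_deriv)

lemma solves_Pair:
  assumes "\<And>t. t \<in> S \<Longrightarrow> (x has_real_derivative - \<beta> * x t + 2 * y t) (at t within S)"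
    and "\<And>t. t \<in> S \<Longrightarrow> (y has_real_derivative - V1 (x t) + (\<beta> - \<alpha>) * y t) (at t within S)"
  shows "solves Fp (\<lambda>t. (x t, y t)) S"
  unfolding solves_def Fp_def
  using assms by (auto simp: has_real_derivative_iff_has_vector_derivative intro!: has_vector_derivative_Pair)

lemma g_backward: assumes "t \<le> 0" shows "g t = (- B * exp (- \<beta> * t), 0)"
proof (rule Fp_unique[of g "{..0}" "\<lambda>t. (- B * exp (- \<beta> * t), 0)" 0])
  show "solves Fp g {..0}" by (rule solves_subset[OF g_solves]) auto
  have "V1 (- B * exp (- \<beta> * t)) = 0" if "t \<le> 0" for t
  proof (rule V_outer(2))
    have "1 \<le> exp (- \<beta> * t)" using that params by (simp add: mult_nonneg_nonpos)
    then show "B \<le> \<bar>- B * exp (- \<beta> * t)\<bar>" using B_pos by (simp add: abs_mult)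
  qed
  then show "solves Fp (\<lambda>t. (- B * exp (- \<beta> * t), 0)) {..0}"
    by (intro solves_Pair) (auto intro!: derivative_eq_intros)
qed (use assms g0 in \<open>auto simp: is_interval_ic\<close>)

text \<open>While \<open>x \<le> -A\<close> the force is non-negative, so \<open>y \<ge> 0\<close> and \<open>x' \<ge> \<beta>A\<close>; consequently \<open>y + V(x)/(\<beta>A)\<close> is
non-increasing, which bounds the height gained by the total drop of \<open>V\<close>, however steep \<open>V\<close> is.\<close>

lemma kick_phase:
  assumes left: "\<And>t. t \<in> {0..\<tau>} \<Longrightarrow> gx t \<le> - A" and t: "t \<in> {0..\<tau>}"
  shows "s \<in> {0..t} \<Longrightarrow> exp ((\<alpha> - \<beta>) * s) * gy s \<le> exp ((\<alpha> - \<beta>) * t) * gy t"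
    and "0 \<le> gy t" and "- B + \<beta> * A * t \<le> gx t" and "gy t \<le> - V (gx t) / (\<beta> * A)"
proof -
  have mono: "exp ((\<alpha> - \<beta>) * s) * gy s \<le> exp ((\<alpha> - \<beta>) * t) * gy t" if "s \<le> t" "s \<in> {0..\<tau>}" "t \<in> {0..\<tau>}" for s t
  proof -
    have "- (exp ((\<alpha> - \<beta>) * t) * gy t) \<le> - (exp ((\<alpha> - \<beta>) * s) * gy s)"
    proof (rule nonincreasing_on[where f = "\<lambda>t. - (exp ((\<alpha> - \<beta>) * t) * gy t)" and S = "{0..\<tau>}"
          and f' = "\<lambda>t. exp ((\<alpha> - \<beta>) * t) * V1 (gx t)"])
      show "((\<lambda>t. - (exp ((\<alpha> - \<beta>) * t) * gy t)) has_real_derivative exp ((\<alpha> - \<beta>) * r) * V1 (gx r)) (at r within {0..\<tau>})" for r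
        by (auto intro!: derivative_eq_intros gy_deriv simp: algebra_simps)
      show "exp ((\<alpha> - \<beta>) * r) * V1 (gx r) \<le> 0" if "r \<in> {0..\<tau>}" for r
        using V1_sign[OF left[OF that]] by (intro mult_nonneg_nonpos) auto
    qed (use that in \<open>auto simp: is_interval_cc\<close>)
    then show ?thesis by simp
  qed
  show "exp ((\<alpha> - \<beta>) * s) * gy s \<le> exp ((\<alpha> - \<beta>) * t) * gy t" if "s \<in> {0..t}"
    by (rule mono) (use that t in auto)
  have y0: "0 \<le> gy t" if "t \<in> {0..\<tau>}" for t
    using mono[of 0 t] that g0 by (simp add: gy_def zero_le_mult_iff)
  then show "0 \<le> gy t" using t by blast
  have v: "\<beta> * A \<le> - \<beta> * gx t + 2 * gy t" if "t \<in> {0..\<tau>}" for t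
  proof -
    have "\<beta> * A \<le> \<beta> * (- gx t)" using left[OF that] params by (intro mult_left_mono) auto
    then show ?thesis using y0[OF that] by simp
  qed
  have "\<beta> * A * t - gx t \<le> \<beta> * A * 0 - gx 0"
    by (rule nonincreasing_on[where f = "\<lambda>t. \<beta> * A * t - gx t" and S = "{0..\<tau>}"
          and f' = "\<lambda>t. \<beta> * A - (- \<beta> * gx t + 2 * gy t)"])
       (use v t in \<open>auto intro!: derivative_eq_intros gx_deriv simp: is_interval_cc\<close>)
  then show "- B + \<beta> * A * t \<le> gx t" using g0 by (simp add: gx_def)
  have bA: "0 < \<beta> * A" using params by simp
  have "gy t + V (gx t) / (\<beta> * A) \<le> gy 0 + V (gx 0) / (\<beta> * A)"
  proof (rule nonincreasing_on[where f = "\<lambda>t. gy t + V (gx t) / (\<beta> * A)" and S = "{0..\<tau>}"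
        and f' = "\<lambda>t. (- V1 (gx t) + (\<beta> - \<alpha>) * gy t) + V1 (gx t) * (- \<beta> * gx t + 2 * gy t) / (\<beta> * A)"])
    fix r assume r: "r \<in> {0..\<tau>}"
    show "((\<lambda>t. gy t + V (gx t) / (\<beta> * A)) has_real_derivative
       (- V1 (gx r) + (\<beta> - \<alpha>) * gy r) + V1 (gx r) * (- \<beta> * gx r + 2 * gy r) / (\<beta> * A)) (at r within {0..\<tau>})"
      by (intro DERIV_add DERIV_cdivide gy_deriv DERIV_chain2[OF V_deriv(1) gx_deriv])
    have "1 \<le> (- \<beta> * gx r + 2 * gy r) / (\<beta> * A)" using v[OF r] bA by simp
    then have "V1 (gx r) * ((- \<beta> * gx r + 2 * gy r) / (\<beta> * A)) \<le> V1 (gx r) * 1"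
      by (rule mult_left_mono_neg) (use V1_sign left r in auto)
    moreover have "(\<beta> - \<alpha>) * gy r \<le> 0" using y0[OF r] params by (intro mult_nonpos_nonneg) auto
    ultimately show "(- V1 (gx r) + (\<beta> - \<alpha>) * gy r) + V1 (gx r) * (- \<beta> * gx r + 2 * gy r) / (\<beta> * A) \<le> 0"
      by simp
  qed (use t in \<open>auto simp: is_interval_cc\<close>)
  moreover have "V (gx 0) = 0" "gy 0 = 0" using g0 V_outer(1)[of "- B"] B_pos by (auto simp: gx_def gy_def)
  ultimately show "gy t \<le> - V (gx t) / (\<beta> * A)" by simp
qed

lemma kick_phase_ends: "\<exists>T>0. gx T = - A \<and> (\<forall>t\<in>{0..T}. gx t \<le> - A)"
proof -
  \<comment> \<open>At speed at least \<open>\<beta>A\<close> the distance \<open>B - A\<close> is covered before this time.\<close>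
  define \<tau> where "\<tau> = (B - A) / (\<beta> * A) + 1"
  have bA: "0 < \<beta> * A" using params by simp
  then have \<tau>: "0 < \<tau>" using params by (simp add: \<tau>_def add_nonneg_pos)
  have "\<exists>t\<in>{0..\<tau>}. - A \<le> gx t"
  proof (rule ccontr)
    assume "\<not> (\<exists>t\<in>{0..\<tau>}. - A \<le> gx t)"
    then have l: "\<And>t. t \<in> {0..\<tau>} \<Longrightarrow> gx t < - A" by force
    then have "- B + \<beta> * A * \<tau> \<le> gx \<tau>" by (intro kick_phase(3)[of \<tau>]) (use \<tau> less_imp_le in auto)
    moreover have "\<beta> * A * \<tau> = (B - A) + \<beta> * A" using params by (simp add: \<tau>_def field_simps)
    ultimately show False using l[of \<tau>] \<tau> bA by simp
  qed
  then obtain t where t: "t \<in> {0..\<tau>}" "- A \<le> gx t" by blast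
  have x0: "gx 0 < - A" using g0 params by (simp add: gx_def)
  obtain T where T: "0 < T" "gx T = - A" "\<And>s. 0 \<le> s \<Longrightarrow> s < T \<Longrightarrow> gx s < - A"
    by (rule first_hit[of 0 t gx "- A"]) (use t x0 continuous_on_gx in auto)
  then have "\<forall>t\<in>{0..T}. gx t \<le> - A" by (metis atLeastAtMost_iff less_eq_real_def)
  then show ?thesis using T by blast
qed

definition T :: real where "T = (SOME T. 0 < T \<and> gx T = - A \<and> (\<forall>t\<in>{0..T}. gx t \<le> - A))"

lemma T: "0 < T" "gx T = - A" "\<And>t. t \<in> {0..T} \<Longrightarrow> gx t \<le> - A"
  using someI_ex[OF kick_phase_ends] unfolding T_def by blast+

definition h :: real where "h = gy T"
text \<open>The slope of the slow eigendirection of the linear part.\<close>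

definition slope :: real where "slope = (2 * \<beta> - \<alpha>) / 2"

lemma slope_pos: "0 < slope" using params by (simp add: slope_def)

text \<open>If \<open>h\<close> were \<open>0\<close>, then \<open>y\<close> would vanish during the whole kick, and \<open>V\<close> would be constant along it.\<close>

lemma h_le: "h \<le> 1 / (\<beta> * A)" and h_pos: "0 < h"
proof -
  have T': "T \<in> {0..T}" using T by simp
  have "h \<le> - V (gx T) / (\<beta> * A)" unfolding h_def by (rule kick_phase(4)[OF T(3) T'])
  then show "h \<le> 1 / (\<beta> * A)" using T(2) V_inner(1)[of "- A"] params by simp
  have "0 \<le> h" unfolding h_def by (rule kick_phase(2)[OF T(3) T'])
  moreover have "h \<noteq> 0"
  proof
    assume h0: "h = 0"
    have y0: "gy t = 0" if t: "t \<in> {0..T}" for t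
    proof -
      have "0 \<le> gy t" by (rule kick_phase(2)[OF T(3) t])
      moreover have "exp ((\<alpha> - \<beta>) * t) * gy t \<le> exp ((\<alpha> - \<beta>) * T) * gy T"
        by (rule kick_phase(1)[OF T(3) T' t])
      ultimately show ?thesis using h0 by (simp add: h_def mult_le_0_iff)
    qed
    have "V (gx T) = V (gx 0)"
    proof (rule DERIV_isconst_end[where f = "\<lambda>t. V (gx t)"])
      show "0 < T" by (rule T)
      have "continuous_on UNIV V" by (rule DERIV_continuous_on) (rule has_field_derivative_at_within[OF V_deriv(1)])
      then show "continuous_on {0..T} (\<lambda>t. V (gx t))"
        by (rule continuous_on_compose2[OF _ continuous_on_gx]) auto
      show "((\<lambda>t. V (gx t)) has_real_derivative 0) (at t)" if t: "0 < t" "t < T" for t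
      proof -
        have "(gy has_real_derivative 0) (at t)"
          by (rule has_field_derivative_transform_within_open[of "\<lambda>_. 0" _ _ "{0<..<T}"]) (use t y0 in auto)
        then have "- V1 (gx t) + (\<beta> - \<alpha>) * gy t = 0" using DERIV_unique[OF gy_deriv] by blast
        then have "V1 (gx t) = 0" using y0[of t] t by simp
        then show ?thesis using DERIV_chain2[OF V_deriv(1) gx_deriv[of t UNIV]] by simp
      qed
    qed
    moreover have "V (gx 0) = 0" using g0 V_outer(1)[of "- B"] B_pos by (auto simp: gx_def)
    ultimately show False using T(2) V_inner(1)[of "- A"] params by simp
  qed
  ultimately show "0 < h" by simp
qed

lemma h_slope_le: "h / slope \<le> A"
proof -
  have "h / slope \<le> 1 / (\<beta> * A) / slope" by (rule divide_right_mono[OF h_le]) (use slope_pos in simp)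
  also have "\<dots> = (2 / (\<beta> * (2 * \<beta> - \<alpha>))) / A" using params by (simp add: slope_def field_simps)
  also have "\<dots> \<le> A\<^sup>2 / A"
  proof (rule divide_right_mono)
    have "2 / (\<beta> * (2 * \<beta> - \<alpha>)) \<le> 12 / (\<beta> * (2 * \<beta> - \<alpha>))"
      using params by (intro divide_right_mono) auto
    then show "2 / (\<beta> * (2 * \<beta> - \<alpha>)) \<le> A\<^sup>2" using A_large by linarith
  qed (use params in simp)
  also have "\<dots> = A" using params by (simp add: power2_eq_square)
  finally show ?thesis .
qed

text \<open>The first coordinate of the solution of the linear system that starts at \<open>(-A, h)\<close>.\<close>

definition inner_x :: "real \<Rightarrow> real" where
  "inner_x t = h / slope * exp (- (\<alpha> - \<beta>) * t) - (A + h / slope) * exp (- \<beta> * t)"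

lemma inner_x_bound: assumes "0 \<le> t" shows "\<bar>inner_x t\<bar> \<le> A"
proof -
  let ?u = "exp (- (\<alpha> - \<beta>) * t)" and ?v = "exp (- \<beta> * t)"
  have "0 \<le> (\<alpha> - \<beta>) * t" "(\<alpha> - \<beta>) * t \<le> \<beta> * t"
    using assms params by (intro mult_nonneg_nonneg mult_right_mono; simp)+
  then have uv: "?v \<le> ?u" "?u \<le> 1" "?v \<le> 1" "0 \<le> ?v" by (simp_all add: algebra_simps)
  have hd: "0 \<le> h / slope" using h_pos slope_pos by simp
  have "inner_x t = h / slope * (?u - ?v) - A * ?v" by (simp add: inner_x_def algebra_simps)
  moreover have "0 \<le> h / slope * (?u - ?v)" using uv hd by (intro mult_nonneg_nonneg) auto
  moreover have "A * ?v \<le> A" using uv params by (simp add: mult_left_le)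
  ultimately have 1: "- A \<le> inner_x t" by linarith
  have "h / slope * ?u \<le> h / slope" by (rule mult_left_le[OF uv(2) hd])
  moreover have "0 \<le> (A + h / slope) * ?v" using uv hd params by (intro mult_nonneg_nonneg) auto
  ultimately have "inner_x t \<le> A" using h_slope_le by (simp add: inner_x_def)
  with 1 show ?thesis by simp
qed

lemma g_forward: assumes "T \<le> t" shows "g t = (inner_x (t - T), h * exp (- (\<alpha> - \<beta>) * (t - T)))"
proof (rule Fp_unique[of g "{T..}" "\<lambda>t. (inner_x (t - T), h * exp (- (\<alpha> - \<beta>) * (t - T)))" T])
  show "solves Fp g {T..}" by (rule solves_subset[OF g_solves]) auto
  show "solves Fp (\<lambda>t. (inner_x (t - T), h * exp (- (\<alpha> - \<beta>) * (t - T)))) {T..}"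
  proof (rule solves_Pair)
    fix t assume t: "t \<in> {T..}"
    have e: "((\<lambda>t. exp (c * (t - T))) has_real_derivative c * exp (c * (t - T))) (at t within {T..})" for c
      by (auto intro!: derivative_eq_intros)
    have V0: "V1 (inner_x (t - T)) = 0" by (rule V_inner(2)[OF inner_x_bound]) (use t in simp)
    show "((\<lambda>t. h * exp (- (\<alpha> - \<beta>) * (t - T))) has_real_derivative
        - V1 (inner_x (t - T)) + (\<beta> - \<alpha>) * (h * exp (- (\<alpha> - \<beta>) * (t - T)))) (at t within {T..})"
      unfolding V0 by (auto intro!: derivative_eq_intros simp: algebra_simps)
    have "((\<lambda>t. inner_x (t - T)) has_real_derivative
        h / slope * (- (\<alpha> - \<beta>) * exp (- (\<alpha> - \<beta>) * (t - T))) - (A + h / slope) * (- \<beta> * exp (- \<beta> * (t - T)))) (at t within {T..})"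
      unfolding inner_x_def by (intro DERIV_diff DERIV_cmult e)
    moreover have "h / slope * (- (\<alpha> - \<beta>) * E1) - (A + h / slope) * (- \<beta> * E2) =
        - \<beta> * (h / slope * E1 - (A + h / slope) * E2) + 2 * (h * E1)" for E1 E2
    proof -
      define q where "q = h / slope"
      have "2 * h = (2 * \<beta> - \<alpha>) * q" using slope_pos by (simp add: q_def) (simp add: slope_def)
      then have "2 * (h * E1) = (2 * \<beta> - \<alpha>) * q * E1" by simp
      then show ?thesis unfolding q_def[symmetric] by (simp add: algebra_simps)
    qed
    ultimately show "((\<lambda>t. inner_x (t - T)) has_real_derivative
        - \<beta> * inner_x (t - T) + 2 * (h * exp (- (\<alpha> - \<beta>) * (t - T)))) (at t within {T..})"
      by (simp only: inner_x_def)
  qed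
  show "g T = (inner_x (T - T), h * exp (- (\<alpha> - \<beta>) * (T - T)))"
    using T(2) by (simp add: g_eq inner_x_def h_def[symmetric])
qed (use assms in \<open>auto simp: is_interval_ci\<close>)

lemma g_strip: "0 \<le> t \<Longrightarrow> \<bar>fst (g t)\<bar> \<le> B" "t < 0 \<Longrightarrow> fst (g t) < - B"
proof -
  show "\<bar>fst (g t)\<bar> \<le> B" if t: "0 \<le> t"
  proof (cases "t \<le> T")
    case True
    have "- B + \<beta> * A * t \<le> gx t" by (rule kick_phase(3)[of T]) (use T True t in auto)
    moreover have "0 \<le> \<beta> * A * t" using params t by simp
    ultimately have "- B \<le> gx t" by linarith
    then show ?thesis using T(3)[of t] True t params by (simp add: gx_def)
  next
    case False
    then show ?thesis using g_forward[of t] inner_x_bound[of "t - T"] params by simp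
  qed
  show "fst (g t) < - B" if "t < 0"
  proof -
    have "1 < exp (- \<beta> * t)" using that params by (simp add: mult_pos_neg)
    then show ?thesis using g_backward[of t] that B_pos by simp
  qed
qed

lemma speed_pos: assumes "t \<le> T" shows "0 < - \<beta> * gx t + 2 * gy t"
proof (cases "t \<le> 0")
  case True
  then show ?thesis using g_backward[OF True] B_pos params by (simp add: gx_def gy_def)
next
  case False
  then have "0 \<le> gy t" by (intro kick_phase(2)[of T]) (use T assms in auto)
  moreover have "gx t < 0" using T(3)[of t] False assms params by simp
  moreover from this have "\<beta> * gx t < 0" using params by (simp add: mult_pos_neg)
  ultimately show ?thesis by simp
qed

text \<open>Eliminating time between the slow coordinate \<open>h exp (-(\<alpha> - \<beta>)t)\<close> and the fast one gives a power with
exponent \<open>\<beta>/(\<alpha> - \<beta>)\<close>. The odd extension to negative \<open>y\<close> describes the orbit of \<open>(B,0)\<close>.\<close>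

definition psi :: "real \<Rightarrow> real" where
  "psi y = y / slope - (A + h / slope) * (sgn y * (\<bar>y\<bar> / h) powr (\<beta> / (\<alpha> - \<beta>)))"

lemma psi_on_orbit: "psi (h * exp (- (\<alpha> - \<beta>) * t)) = inner_x t"
proof -
  have "(\<bar>h * exp (- (\<alpha> - \<beta>) * t)\<bar> / h) powr (\<beta> / (\<alpha> - \<beta>)) = exp (- (\<alpha> - \<beta>) * t) powr (\<beta> / (\<alpha> - \<beta>))"
    using h_pos by (simp add: abs_mult)
  also have "\<dots> = exp (- \<beta> * t)" using params by (simp add: powr_def field_simps)
  finally show ?thesis using h_pos by (simp add: psi_def inner_x_def sgn_mult)
qed

lemma inner_arc: "g ` {T..} = (\<lambda>y. (psi y, y)) ` {0<..h}"
proof (intro equalityI subsetI)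
  fix z assume "z \<in> g ` {T..}"
  then obtain t where t: "T \<le> t" "z = g t" by auto
  let ?y = "h * exp (- (\<alpha> - \<beta>) * (t - T))"
  have "0 \<le> (\<alpha> - \<beta>) * (t - T)" using t params by (intro mult_nonneg_nonneg) auto
  then have "exp (- (\<alpha> - \<beta>) * (t - T)) \<le> 1" by (simp only: mult_minus_left) simp
  then have "?y \<in> {0<..h}" using h_pos by (simp add: mult_left_le)
  moreover have "z = (psi ?y, ?y)" using t g_forward[OF t(1)] by (simp only: psi_on_orbit)
  ultimately show "z \<in> (\<lambda>y. (psi y, y)) ` {0<..h}" by blast
next
  fix z assume "z \<in> (\<lambda>y. (psi y, y)) ` {0<..h}"
  then obtain y where y: "0 < y" "y \<le> h" "z = (psi y, y)" by auto
  \<comment> \<open>The time at which the height has dropped from \<open>h\<close> to \<open>y\<close>.\<close>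
  define t where "t = ln (h / y) / (\<alpha> - \<beta>)"
  have "0 \<le> ln (h / y)" using y by simp
  then have t0: "0 \<le> t" using params by (simp add: t_def)
  have "(\<alpha> - \<beta>) * t = ln (h / y)" using params by (simp add: t_def)
  then have "h * exp (- (\<alpha> - \<beta>) * t) = h * exp (- ln (h / y))" by (simp only: mult_minus_left)
  also have "\<dots> = y" using y h_pos by (simp add: exp_minus)
  finally have e: "h * exp (- (\<alpha> - \<beta>) * t) = y" .
  have "g (T + t) = (inner_x t, y)" using g_forward[of "T + t"] t0 e by simp
  then have "z = g (T + t)" using psi_on_orbit[of t] e y by simp
  then show "z \<in> g ` {T..}" using t0 by auto
qed

text \<open>As long as \<open>x < 0\<close> the speed \<open>x'\<close> is positive, so \<open>x\<close> can replace time as parameter beyond both ends of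
\<open>[-B,-A]\<close>. The slopes at the two ends are recorded because they must match the neighbouring pieces.\<close>

lemma outer_arc:
  "\<exists>Y Y1. (\<forall>x\<in>{-B..-A}. (Y has_real_derivative Y1 x) (at x)) \<and> continuous_on {-B..-A} Y1 \<and>
     Y (- B) = 0 \<and> Y1 (- B) = 0 \<and> Y (- A) = h \<and> Y1 (- A) = - (\<alpha> - \<beta>) * h / (\<beta> * A + 2 * h) \<and>
     g ` {0..T} = (\<lambda>x. (x, Y x)) ` {-B..-A}"
proof -
  define d where "d t = - \<beta> * gx t + 2 * gy t" for t
  have "isCont d T" unfolding d_def
    by (intro continuous_intros; rule DERIV_isCont, rule gx_deriv gy_deriv)
  then have "eventually (\<lambda>t. 0 < d t) (at T)"
    using speed_pos[of T] by (intro order_tendstoD(1)[of d "d T"]) (auto simp: isCont_def d_def)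
  then obtain e where e: "0 < e" "\<And>t. t \<noteq> T \<Longrightarrow> dist t T < e \<Longrightarrow> 0 < d t"
    by (auto simp: eventually_at)
  \<comment> \<open>An open time interval around \<open>[0, T]\<close>, so that the inverse function has two-sided derivatives at both ends.\<close>
  let ?I = "{-1<..<T + e}"
  have dpos: "0 < d t" if "t \<in> ?I" for t
    using e(2)[of t] speed_pos[of t] that by (cases "t \<le> T") (auto simp: d_def dist_real_def)
  have dd: "(gx has_real_derivative d t) (at t)" for t unfolding d_def by (rule gx_deriv)
  have inv2: "inv_into ?I gx (gx t) = t" if "t \<in> ?I" for t
    by (rule strict_mono_inverse_derivative(2)[of "-1" "T + e" gx d, OF _ _ that]) (rule dd, rule dpos)
  have inv3: "(inv_into ?I gx has_real_derivative inverse (d t)) (at (gx t))" if "t \<in> ?I" for t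
    by (rule strict_mono_inverse_derivative(3)[of "-1" "T + e" gx d, OF _ _ that]) (rule dd, rule dpos)
  define \<iota> where "\<iota> = inv_into ?I gx"
  define Y where "Y x = gy (\<iota> x)" for x
  define Y1 where "Y1 x = (- V1 x + (\<beta> - \<alpha>) * Y x) / (- \<beta> * x + 2 * Y x)" for x
  have sub: "{0..T} \<subseteq> ?I" using e T by auto
  have Yg: "Y (gx t) = gy t" if "t \<in> {0..T}" for t
    unfolding Y_def \<iota>_def by (subst inv2) (use that sub in auto)
  have onto: "\<exists>t\<in>{0..T}. gx t = x" if x: "x \<in> {-B..-A}" for x
  proof -
    have "\<exists>t\<ge>0. t \<le> T \<and> gx t = x"
      by (rule IVT') (use x T g0 continuous_on_gx in \<open>auto simp: gx_def\<close>)
    then show ?thesis by auto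
  qed
  have into: "gx t \<in> {-B..-A}" if "t \<in> {0..T}" for t
    using g_strip(1)[of t] T(3)[OF that] that by (auto simp: gx_def)
  have Yd: "(Y has_real_derivative Y1 x) (at x)" if x: "x \<in> {-B..-A}" for x
  proof -
    obtain t where t: "t \<in> {0..T}" "gx t = x" using onto[OF x] by blast
    have ti: "t \<in> ?I" using t sub by blast
    have i: "(\<iota> has_real_derivative inverse (d t)) (at x)" using inv3[OF ti] t(2) by (simp add: \<iota>_def)
    have it: "\<iota> x = t" using inv2[OF ti] t(2) by (simp add: \<iota>_def)
    have "((\<lambda>x. gy (\<iota> x)) has_real_derivative (- V1 (gx (\<iota> x)) + (\<beta> - \<alpha>) * gy (\<iota> x)) * inverse (d t)) (at x)"
      by (rule DERIV_chain2[OF gy_deriv i])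
    then show ?thesis unfolding Y_def[abs_def, symmetric]
      by (rule DERIV_cong) (simp add: Y1_def it t(2) Yg[OF t(1), unfolded t(2)] d_def divide_inverse)
  qed
  have den: "- \<beta> * x + 2 * Y x \<noteq> 0" if x: "x \<in> {-B..-A}" for x
  proof -
    obtain t where t: "t \<in> {0..T}" "gx t = x" using onto[OF x] by blast
    then show ?thesis using speed_pos[of t] Yg[OF t(1)] by simp
  qed
  have "continuous_on {-B..-A} Y" "continuous_on {-B..-A} V1"
    by (rule DERIV_continuous_on, use Yd V_deriv(2) in \<open>blast intro: has_field_derivative_at_within\<close>)+
  then have "continuous_on {-B..-A} Y1" unfolding Y1_def
    by (intro continuous_on_divide continuous_on_add continuous_on_mult continuous_on_minus
         continuous_on_const continuous_on_id) (use den in auto)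
  moreover have YB: "Y (- B) = 0" using Yg[of 0] T(1) g0 by (simp add: gx_def gy_def)
  moreover have "Y1 (- B) = 0" using V_outer(2)[of "- B"] B_pos by (simp add: Y1_def YB)
  moreover have YA: "Y (- A) = h" using Yg[of T] T by (simp add: h_def)
  moreover have "Y1 (- A) = - (\<alpha> - \<beta>) * h / (\<beta> * A + 2 * h)"
    using V_inner(2)[of "- A"] params by (simp add: Y1_def YA)
  moreover have "g ` {0..T} = (\<lambda>x. (x, Y x)) ` {-B..-A}"
  proof (intro equalityI subsetI)
    fix z assume "z \<in> g ` {0..T}"
    then obtain t where t: "t \<in> {0..T}" "z = g t" by blast
    then have "z = (gx t, Y (gx t))" using Yg[OF t(1)] by (simp add: g_eq)
    then show "z \<in> (\<lambda>x. (x, Y x)) ` {-B..-A}" using into[OF t(1)] by blast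
  next
    fix z assume "z \<in> (\<lambda>x. (x, Y x)) ` {-B..-A}"
    then obtain x where x: "x \<in> {-B..-A}" "z = (x, Y x)" by blast
    obtain t where t: "t \<in> {0..T}" "gx t = x" using onto[OF x(1)] by blast
    then have "z = g t" using x Yg[OF t(1)] by (simp add: g_eq)
    then show "z \<in> g ` {0..T}" using t(1) by blast
  qed
  ultimately show ?thesis using Yd by (intro exI[of _ Y] exI[of _ Y1]) auto
qed

end

section \<open>Isotopies made of shears\<close>

definition vshear :: "(real \<Rightarrow> real) \<Rightarrow> real \<Rightarrow> real \<times> real \<Rightarrow> real \<times> real" where
  "vshear f s z = (fst z, snd z + s * f (fst z))"

definition hshear :: "real \<Rightarrow> real \<Rightarrow> real \<times> real \<Rightarrow> real \<times> real" where
  "hshear k s z = (fst z + s * (k * snd z), snd z)"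

lemma C1_on_vshear:
  assumes f: "\<And>x. (f has_real_derivative f' x) (at x)" "continuous_on UNIV f'" and "C1_on S \<sigma>" "C1_on S u"
  shows "C1_on S (\<lambda>p. vshear f (\<sigma> p) (u p))"
proof -
  have 1: "C1_on S (\<lambda>p. fst (u p))" "C1_on S (\<lambda>p. snd (u p))"
    by (intro C1_on_linear_compose[OF bounded_linear_fst assms(4)] C1_on_linear_compose[OF bounded_linear_snd assms(4)])+
  show ?thesis unfolding vshear_def
    by (intro C1_on_Pair 1 C1_on_add C1_on_mult assms(3) C1_on_real_compose[OF f 1(1)])
qed

lemma C1_on_hshear:
  assumes "C1_on S \<sigma>" "C1_on S u"
  shows "C1_on S (\<lambda>p. hshear k (\<sigma> p) (u p))"
proof -
  have 1: "C1_on S (\<lambda>p. fst (u p))" "C1_on S (\<lambda>p. snd (u p))"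
    by (intro C1_on_linear_compose[OF bounded_linear_fst assms(2)] C1_on_linear_compose[OF bounded_linear_snd assms(2)])+
  show ?thesis unfolding hshear_def
    by (intro C1_on_Pair 1 C1_on_add C1_on_mult assms(1) C1_on_const)
qed

lemma shear_inverse:
  "vshear f (- s) (vshear f s z) = z" "vshear f s (vshear f (- s) z) = z"
  "hshear k (- s) (hshear k s z) = z" "hshear k s (hshear k (- s) z) = z"
  by (simp_all add: vshear_def hshear_def)

definition area_preserving :: "(real \<times> real \<Rightarrow> real \<times> real) \<Rightarrow> bool" where
  "area_preserving T \<longleftrightarrow> (\<forall>z. \<exists>T'. (T has_derivative T') (at z) \<and> (\<forall>u v. area_form (T' u) (T' v) = area_form u v))"

lemma area_preserving_compose:
  assumes "area_preserving S" "area_preserving T" shows "area_preserving (\<lambda>z. S (T z))"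
  unfolding area_preserving_def
proof
  fix z
  obtain T' where T: "(T has_derivative T') (at z)" "\<And>u v. area_form (T' u) (T' v) = area_form u v"
    using assms(2) unfolding area_preserving_def by blast
  obtain S' where S: "(S has_derivative S') (at (T z))" "\<And>u v. area_form (S' u) (S' v) = area_form u v"
    using assms(1) unfolding area_preserving_def by blast
  have "((\<lambda>z. S (T z)) has_derivative (\<lambda>h. S' (T' h))) (at z)"
    by (rule has_derivative_compose[OF T(1) S(1)])
  then show "\<exists>R. ((\<lambda>z. S (T z)) has_derivative R) (at z) \<and> (\<forall>u v. area_form (R u) (R v) = area_form u v)"
    using S(2) T(2) by (intro exI[of _ "\<lambda>h. S' (T' h)"]) simp
qed

lemma area_preserving_vshear:
  assumes f: "\<And>x. (f has_real_derivative f' x) (at x)"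
  shows "area_preserving (vshear f s)"
  unfolding area_preserving_def
proof
  fix z :: "real \<times> real"
  have "((\<lambda>z. f (fst z)) has_derivative (\<lambda>h. f' (fst z) * fst h)) (at z)"
    by (rule has_derivative_eq_rhs[OF has_derivative_compose[OF bounded_linear.has_derivative[OF bounded_linear_fst has_derivative_ident]
          f[unfolded has_field_derivative_def]]]) auto
  then have "(vshear f s has_derivative (\<lambda>h. (fst h, snd h + s * (f' (fst z) * fst h)))) (at z)"
    unfolding vshear_def[abs_def]
    by (intro has_derivative_Pair has_derivative_add has_derivative_mult_right
        bounded_linear.has_derivative[OF bounded_linear_fst has_derivative_ident]
        bounded_linear.has_derivative[OF bounded_linear_snd has_derivative_ident])
  then show "\<exists>R. (vshear f s has_derivative R) (at z) \<and> (\<forall>u v. area_form (R u) (R v) = area_form u v)"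
    by (intro exI[of _ "\<lambda>h. (fst h, snd h + s * (f' (fst z) * fst h))"]) (auto simp: area_form_def algebra_simps)
qed

lemma area_preserving_hshear: "area_preserving (hshear k s)"
  unfolding area_preserving_def
proof
  fix z :: "real \<times> real"
  have "(hshear k s has_derivative (\<lambda>h. (fst h + s * (k * snd h), snd h))) (at z)"
    unfolding hshear_def[abs_def]
    by (intro has_derivative_Pair has_derivative_add has_derivative_mult_right
        bounded_linear.has_derivative[OF bounded_linear_fst has_derivative_ident]
        bounded_linear.has_derivative[OF bounded_linear_snd has_derivative_ident])
  then show "\<exists>R. (hshear k s has_derivative R) (at z) \<and> (\<forall>u v. area_form (R u) (R v) = area_form u v)"
    by (intro exI[of _ "\<lambda>h. (fst h + s * (k * snd h), snd h)"]) (auto simp: area_form_def algebra_simps)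
qed

text \<open>The vertical coordinate of \<open>N\<close> is a defining function: its derivative cannot vanish, since the derivative of
\<open>N\<close> preserves area.\<close>

lemma C1_submanifold_zero_set:
  assumes D: "0 < D" and N: "C1_on UNIV N" "area_preserving N"
    and shift: "\<And>z n. N (z + (2 * D * of_int n, 0)) = N z + (2 * D * of_int n, 0)"
    and L: "L = cover D ` {z. snd (N z) = 0}"
  shows "C1_submanifold D L"
proof -
  have iff: "cover D w \<in> L \<longleftrightarrow> snd (N w) = 0" for w
  proof
    assume "cover D w \<in> L"
    then obtain z where z: "snd (N z) = 0" "cover D z = cover D w" using L by auto
    then obtain n where "w = z + (2 * D * of_int n, 0)" using cover_eq_iff[OF D] by blast
    then show "snd (N w) = 0" using shift[of z n] z by simp
  qed (use L in auto)
  have C: "C1_on UNIV (\<lambda>z. snd (N z))" by (rule C1_on_linear_compose[OF bounded_linear_snd N(1)])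
  have nz: "frechet_derivative (\<lambda>z. snd (N z)) (at w) \<noteq> (\<lambda>_. 0)" for w
  proof
    assume 0: "frechet_derivative (\<lambda>z. snd (N z)) (at w) = (\<lambda>_. 0)"
    obtain N' where N': "(N has_derivative N') (at w)" "\<And>u v. area_form (N' u) (N' v) = area_form u v"
      using N(2) unfolding area_preserving_def by blast
    have "frechet_derivative (\<lambda>z. snd (N z)) (at w) = (\<lambda>h. snd (N' h))"
      using frechet_derivative_at[OF has_derivative_snd[OF N'(1)]] by simp
    then have "snd (N' h) = 0" for h using 0 by (metis)
    then have "area_form (N' (1, 0)) (N' (0, 1)) = 0" by (simp add: area_form_def)
    then show False using N'(2)[of "(1, 0)" "(0, 1)"] by (simp add: area_form_def)
  qed
  show ?thesis unfolding C1_submanifold_def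
  proof (intro conjI allI impI)
    show "L \<subseteq> annulus" using L cover_in_annulus by auto
    fix z assume "cover D z \<in> L"
    show "\<exists>W (g :: real \<times> real \<Rightarrow> real). open W \<and> z \<in> W \<and> C1_on W g \<and> (\<forall>w\<in>W. frechet_derivative g (at w) \<noteq> (\<lambda>_. 0)) \<and>
        (\<forall>w\<in>W. (cover D w \<in> L) = (g w = 0))"
      by (intro exI[of _ UNIV] exI[of _ "\<lambda>z. snd (N z)"]) (use C nz iff in auto)
  qed
qed

text \<open>Shears preserve area, commute with the deck translation, and have shears as inverses; scaling all of them by
\<open>s\<close> gives an isotopy that starts at the identity.\<close>

locale shear_isotopy =
  fixes D k :: real and f f' g g' :: "real \<Rightarrow> real"
  assumes D: "0 < D"
    and f: "\<And>x. (f has_real_derivative f' x) (at x)" "continuous_on UNIV f'" "\<And>x. f (x + 2 * D) = f x"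
    and g: "\<And>x. (g has_real_derivative g' x) (at x)" "continuous_on UNIV g'" "\<And>x. g (x + 2 * D) = g x"
begin

definition \<Psi> :: "real \<Rightarrow> real \<times> real \<Rightarrow> real \<times> real" where
  "\<Psi> s z = vshear f s (hshear k s (vshear g s z))"

definition \<Phi> :: "real \<Rightarrow> real \<times> real \<Rightarrow> real \<times> real" where
  "\<Phi> s z = vshear g (- s) (hshear k (- s) (vshear f (- s) z))"

lemma inverse: "\<Phi> s (\<Psi> s z) = z" "\<Psi> s (\<Phi> s z) = z"
  by (simp_all add: \<Phi>_def \<Psi>_def shear_inverse)

lemma shift: "\<Psi> s (z + (2 * D * of_int n, 0)) = \<Psi> s z + (2 * D * of_int n, 0)"
  "\<Phi> s (z + (2 * D * of_int n, 0)) = \<Phi> s z + (2 * D * of_int n, 0)"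
proof -
  have v: "vshear \<phi> s (z + (2 * D * of_int n, 0)) = vshear \<phi> s z + (2 * D * of_int n, 0)"
    if "\<And>x. \<phi> (x + 2 * D) = \<phi> x" for \<phi> s z
    using periodic_wrap(1)[of \<phi> D "fst z" n, OF that] by (simp add: vshear_def prod_eq_iff)
  have h: "hshear k s (z + (2 * D * of_int n, 0)) = hshear k s z + (2 * D * of_int n, 0)" for s z
    by (simp add: hshear_def prod_eq_iff)
  show "\<Psi> s (z + (2 * D * of_int n, 0)) = \<Psi> s z + (2 * D * of_int n, 0)"
    "\<Phi> s (z + (2 * D * of_int n, 0)) = \<Phi> s z + (2 * D * of_int n, 0)"
    unfolding \<Psi>_def \<Phi>_def v[of f, OF f(3)] v[of g, OF g(3)] h by simp_all
qed

lemma area: "area_preserving (\<Psi> s)" "area_preserving (\<Phi> s)"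
  unfolding \<Psi>_def[abs_def] \<Phi>_def[abs_def]
  by (rule area_preserving_compose[OF area_preserving_vshear[OF f(1)]
        area_preserving_compose[OF area_preserving_hshear area_preserving_vshear[OF g(1)]]],
      rule area_preserving_compose[OF area_preserving_vshear[OF g(1)]
        area_preserving_compose[OF area_preserving_hshear area_preserving_vshear[OF f(1)]]])

lemma C1_inverse: "C1_on UNIV (\<Phi> s)"
proof -
  have "C1_on UNIV (\<lambda>z. z :: real \<times> real)" by (rule C1_on_linear) (rule bounded_linear_ident)
  then show ?thesis unfolding \<Phi>_def[abs_def]
    by (intro C1_on_vshear[OF f(1,2)] C1_on_vshear[OF g(1,2)] C1_on_hshear C1_on_const)
qed

lemma C1_isotopy: "C1_on S (\<lambda>(s, z). \<Psi> s z)"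
proof -
  have "C1_on S (\<lambda>p. \<Psi> (fst p) (snd p))" unfolding \<Psi>_def
    by (intro C1_on_vshear[OF f(1,2)] C1_on_vshear[OF g(1,2)] C1_on_hshear C1_on_linear
        bounded_linear_fst bounded_linear_snd)
  then show ?thesis by (simp add: case_prod_beta')
qed

lemma symplectic: "symplectic_isotopy D \<Psi>"
  unfolding symplectic_isotopy_def
proof (intro conjI ballI allI)
  show "\<Psi> 0 = id" by (auto simp: \<Psi>_def vshear_def hshear_def fun_eq_iff)
  show "C1_on ({0..1} \<times> UNIV) (\<lambda>(s, z). \<Psi> s z)" by (rule C1_isotopy)
  fix s :: real
  have inv: "inv (\<Psi> s) = \<Phi> s" by (rule inv_equality) (simp_all add: inverse)
  show "bij (\<Psi> s)" by (rule o_bij[of "\<Phi> s"]) (auto simp: inverse fun_eq_iff)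
  show "C1_on UNIV (inv (\<Psi> s))" unfolding inv by (rule C1_inverse)
  show "\<Psi> s (x + 2 * D, y) = \<Psi> s (x, y) + (2 * D, 0)" for x y using shift(1)[of s "(x, y)" 1] by simp
  fix z u v
  obtain T' where T': "(\<Psi> s has_derivative T') (at z)" "area_form (T' u) (T' v) = area_form u v"
    using area(1) unfolding area_preserving_def by blast
  then show "area_form (frechet_derivative (\<Psi> s) (at z) u) (frechet_derivative (\<Psi> s) (at z) v) = area_form u v"
    using frechet_derivative_at[OF T'(1)] by metis
qed

lemma zero_section_image:
  "cover D ` \<Psi> 1 ` (UNIV \<times> {0}) = cover D ` (\<lambda>x. \<Psi> 1 (x, 0)) ` {-D..D}"
proof (intro equalityI subsetI)
  fix p assume "p \<in> cover D ` \<Psi> 1 ` (UNIV \<times> {0})"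
  then obtain x where x: "p = cover D (\<Psi> 1 (x, 0))" by auto
  define n where "n = \<lfloor>(x + D) / (2 * D)\<rfloor>"
  have "(x, 0 :: real) = (wrap D x, 0) + (2 * D * of_int n, 0)" by (simp add: wrap_def n_def)
  then have "\<Psi> 1 (x, 0) = \<Psi> 1 (wrap D x, 0) + (2 * D * of_int n, 0)" using shift(1) by metis
  then have "cover D (\<Psi> 1 (wrap D x, 0)) = p" unfolding x using cover_eq_iff[OF D] by blast
  moreover have "wrap D x \<in> {-D..D}" using wrap_range[OF D, of x] by auto
  ultimately show "p \<in> cover D ` (\<lambda>x. \<Psi> 1 (x, 0)) ` {-D..D}" by blast
qed auto

theorem isotopic: "isotopic_to_zero_section D (cover D ` (\<lambda>x. \<Psi> 1 (x, 0)) ` {-D..D})"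
  unfolding isotopic_to_zero_section_def using symplectic zero_section_image by metis

theorem submanifold: "C1_submanifold D (cover D ` (\<lambda>x. \<Psi> 1 (x, 0)) ` {-D..D})"
proof (rule C1_submanifold_zero_set[OF D C1_inverse area(2) shift(2)])
  have "{z. snd (\<Phi> 1 z) = 0} = \<Psi> 1 ` (UNIV \<times> {0})"
  proof (intro equalityI subsetI)
    fix z assume "z \<in> {z. snd (\<Phi> 1 z) = 0}"
    then have "\<Phi> 1 z \<in> UNIV \<times> {0}" by (auto simp: mem_Times_iff)
    then show "z \<in> \<Psi> 1 ` (UNIV \<times> {0})" by (rule image_eqI[rotated]) (simp add: inverse)
  qed (auto simp: inverse)
  then show "cover D ` (\<lambda>x. \<Psi> 1 (x, 0)) ` {-D..D} = cover D ` {z. snd (\<Phi> 1 z) = 0}"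
    using zero_section_image by simp
qed

lemma \<Psi>_axis: "\<Psi> 1 (x, 0) = (x + k * g x, g x + f (x + k * g x))"
  by (simp add: \<Psi>_def vshear_def hshear_def)

theorem compact_image: "compact (cover D ` (\<lambda>x. \<Psi> 1 (x, 0)) ` {-D..D})"
proof -
  have fg: "continuous_on S f" "continuous_on S g" for S
    by (rule DERIV_continuous_on, rule has_field_derivative_at_within, rule f g)+
  have 1: "continuous_on {-D..D} (\<lambda>x. x + k * g x)"
    by (intro continuous_on_add continuous_on_mult continuous_on_const continuous_on_id fg)
  have "continuous_on {-D..D} (\<lambda>x. f (x + k * g x))"
    by (rule continuous_on_compose2[OF fg(1)[of UNIV] 1]) simp
  then have "continuous_on {-D..D} (\<lambda>x. \<Psi> 1 (x, 0))"
    unfolding \<Psi>_axis by (intro continuous_on_Pair continuous_on_add 1 fg)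
  then show ?thesis
    by (intro compact_continuous_image continuous_on_cover compact_Icc)
qed

end

section \<open>The curve as a sheared zero section\<close>

lemma has_real_derivative_piecewise:
  fixes f g :: "real \<Rightarrow> real"
  assumes f: "\<And>x. x \<in> I \<Longrightarrow> x \<le> c \<Longrightarrow> (f has_real_derivative f' x) (at x)"
    and g: "\<And>x. x \<in> I \<Longrightarrow> c \<le> x \<Longrightarrow> (g has_real_derivative g' x) (at x)"
    and c: "f c = g c" "f' c = g' c" and x: "x \<in> I"
  shows "((\<lambda>t. if t \<le> c then f t else g t) has_real_derivative (if x \<le> c then f' x else g' x)) (at x)"
proof -
  consider "x < c" | "x = c" | "c < x" by linarith
  then show ?thesis
  proof cases
    case 1
    have "((\<lambda>t. if t \<le> c then f t else g t) has_real_derivative f' x) (at x)"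
      by (rule has_field_derivative_transform_within_open[OF f[OF x], of "{..<c}"]) (use 1 in auto)
    then show ?thesis using 1 by simp
  next
    case 2
    have "(f has_real_derivative f' c) (at c)" "(g has_real_derivative f' c) (at c)"
      using f[OF x] g[OF x] 2 c by auto
    from has_real_derivative_glue[OF this c(1)] show ?thesis using 2 by simp
  next
    case 3
    have "((\<lambda>t. if t \<le> c then f t else g t) has_real_derivative g' x) (at x)"
      by (rule has_field_derivative_transform_within_open[OF g[OF x], of "{c<..}"]) (use 3 in auto)
    then show ?thesis using 3 by simp
  qed
qed

text \<open>At \<open>0\<close> the difference quotient is \<open>(|y|/c)\<close> to the power \<open>p - 1 > 0\<close>, up to a constant.\<close>

lemma signed_power_has_derivative:
  fixes p c :: real
  assumes "1 < p" "0 < c"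
  shows "((\<lambda>y. sgn y * (\<bar>y\<bar> / c) powr p) has_real_derivative p / c * (\<bar>y\<bar> / c) powr (p - 1)) (at y)"
proof -
  let ?S = "\<lambda>y. sgn y * (\<bar>y\<bar> / c) powr p"
  have pos: "(?S has_real_derivative p / c * (\<bar>y\<bar> / c) powr (p - 1)) (at y)" if y: "0 < y" for y
  proof -
    have "((\<lambda>y. (y / c) powr p) has_real_derivative p * (y / c) powr (p - 1) * (1 / c)) (at y)"
      using y assms by (auto intro!: derivative_eq_intros simp: powr_diff field_simps)
    then have "(?S has_real_derivative p * (y / c) powr (p - 1) * (1 / c)) (at y)"
      by (rule has_field_derivative_transform_within_open[of _ _ _ "{0<..}"]) (use y in auto)
    then show ?thesis using y by (simp add: mult_ac)
  qed
  consider "0 < y" | "y < 0" | "y = 0" by linarith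
  then show ?thesis
  proof cases
    case 1 then show ?thesis by (rule pos)
  next
    case 2
    have "((\<lambda>y. - ?S (- y)) has_real_derivative - (p / c * (\<bar>- y\<bar> / c) powr (p - 1) * - 1)) (at y)"
      by (intro DERIV_minus DERIV_chain2[OF pos] DERIV_ident) (use 2 in simp)
    then show ?thesis by (simp add: sgn_minus)
  next
    case 3
    have "((\<lambda>y. (\<bar>y\<bar> / c) powr (p - 1) / c) \<longlongrightarrow> (\<bar>0\<bar> / c) powr (p - 1) / c) (at 0)"
      by (intro tendsto_divide tendsto_powr' tendsto_const tendsto_rabs tendsto_ident_at) (use assms in auto)
    then have l1: "((\<lambda>y. (\<bar>y\<bar> / c) powr (p - 1) / c) \<longlongrightarrow> 0) (at 0)" using assms by simp
    have l2: "(\<bar>y\<bar> / c) powr (p - 1) / c = (?S y - ?S 0) / (y - 0)" if "y \<noteq> 0" for y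
    proof -
      have "(\<bar>y\<bar> / c) powr (p - 1) = (\<bar>y\<bar> / c) powr p / (\<bar>y\<bar> / c)"
        using that assms by (simp add: powr_diff)
      then show ?thesis using that assms by (auto simp: sgn_if field_simps)
    qed
    have "((\<lambda>y. (?S y - ?S 0) / (y - 0)) \<longlongrightarrow> 0) (at 0)"
      by (rule Lim_transform_eventually[OF l1], unfold eventually_at_filter,
          intro always_eventually allI impI, rule l2)
    then have "(?S has_real_derivative 0) (at 0)" unfolding has_field_derivative_iff .
    then show ?thesis using 3 assms by simp
  qed
qed

lemma continuous_on_abs_powr: "0 < q \<Longrightarrow> 0 < c \<Longrightarrow> continuous_on S (\<lambda>y :: real. (\<bar>y\<bar> / c) powr q)"
  by (intro continuous_on_powr' continuous_on_divide continuous_on_rabs continuous_on_id continuous_on_const) auto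

context planar_potential begin

definition psi1 :: "real \<Rightarrow> real" where
  "psi1 y = 1 / slope - (A + h / slope) * (\<beta> / (\<alpha> - \<beta>) / h * (\<bar>y\<bar> / h) powr (\<beta> / (\<alpha> - \<beta>) - 1))"

lemma exponent: "1 < \<beta> / (\<alpha> - \<beta>)" using params by (simp add: field_simps)

lemma psi_deriv: "(psi has_real_derivative psi1 y) (at y)"
  unfolding psi_def[abs_def] psi1_def
  by (intro DERIV_diff DERIV_cmult DERIV_cdivide DERIV_ident
      signed_power_has_derivative[OF exponent h_pos])

lemma continuous_on_psi1: "continuous_on S psi1"
  unfolding psi1_def[abs_def]
  by (intro continuous_on_diff continuous_on_mult continuous_on_const continuous_on_abs_powr) (use exponent h_pos in auto)

lemma psi_odd: "psi (- y) = - psi y"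
  by (simp add: psi_def sgn_minus algebra_simps)

lemma psi_h: "psi h = - A"
  using h_pos by (simp add: psi_def)

lemma psi1_even: "psi1 (- y) = psi1 y" by (simp add: psi1_def)

text \<open>Minus the slope \<open>dy/dx\<close> of the orbit at \<open>(-A, h)\<close>; \<open>psi1_h\<close> computes it from the other side.\<close>

definition rho :: real where "rho = (\<alpha> - \<beta>) * h / (\<beta> * A + 2 * h)"

lemma rho_pos: "0 < rho" and rho_le: "rho \<le> h / A"
proof -
  have d: "0 < \<beta> * A + 2 * h" using params h_pos by (simp add: add_pos_pos)
  then show "0 < rho" unfolding rho_def using params h_pos by (intro divide_pos_pos mult_pos_pos) auto
  have "(\<alpha> - \<beta>) * h * A \<le> \<beta> * h * A" using params h_pos by (intro mult_right_mono) auto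
  also have "\<dots> \<le> h * (\<beta> * A + 2 * h)" using h_pos by (simp add: algebra_simps)
  finally show "rho \<le> h / A" unfolding rho_def using d params by (simp add: field_simps)
qed

lemma two_slope: "2 * \<beta> - \<alpha> = 2 * slope" by (simp add: slope_def)

lemma psi1_h: "psi1 h = - 1 / rho"
proof -
  have e: "0 < \<alpha> - \<beta>" using params by simp
  have p: "psi1 h = 1 / slope - (A + h / slope) * (\<beta> / (\<alpha> - \<beta>) / h)" using h_pos by (simp add: psi1_def)
  have t1: "1 / slope * ((\<alpha> - \<beta>) * h) = (\<alpha> - \<beta>) * (h / slope)" by simp
  have t2: "Z * (\<beta> / (\<alpha> - \<beta>) / h) * ((\<alpha> - \<beta>) * h) = Z * \<beta>" for Z using e h_pos by simp
  have "psi1 h * ((\<alpha> - \<beta>) * h) = (\<alpha> - \<beta>) * (h / slope) - (A + h / slope) * \<beta>"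
    unfolding p left_diff_distrib[of "1 / slope"] t1 t2 ..
  also have "\<dots> = - (\<beta> * A + (2 * \<beta> - \<alpha>) * (h / slope))"
  proof -
    have "(\<alpha> - \<beta>) * r - (A + r) * \<beta> = - (\<beta> * A + (2 * \<beta> - \<alpha>) * r)" for r by (simp add: algebra_simps)
    then show ?thesis .
  qed
  also have "(2 * \<beta> - \<alpha>) * (h / slope) = 2 * h" unfolding two_slope using slope_pos by simp
  finally have "psi1 h * ((\<alpha> - \<beta>) * h) = - (\<beta> * A + 2 * h)" .
  then show ?thesis using e h_pos by (simp add: rho_def field_simps)
qed

lemma psi_bound: assumes "\<bar>y\<bar> \<le> h" shows "\<bar>psi y\<bar> \<le> A"
proof -
  have pos: "\<bar>psi y\<bar> \<le> A" if "0 < y" "y \<le> h" for y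
  proof -
    have "(psi y, y) \<in> g ` {T..}" unfolding inner_arc using that by auto
    then obtain t where t: "T \<le> t" "(psi y, y) = g t" by auto
    have "psi y = inner_x (t - T)" using t(2) unfolding g_forward[OF t(1)] by (rule Pair_inject)
    then show ?thesis using inner_x_bound[of "t - T"] t by simp
  qed
  consider "0 < y" | "y = 0" | "0 < - y" by linarith
  then show ?thesis
    using pos[of y] pos[of "- y"] assms psi_odd[of y] params by cases (auto simp: psi_def)
qed

text \<open>The odd cubic \<open>q\<close> with \<open>q(-A) = h\<close> and \<open>q'(-A) = -\<rho>\<close>: it continues the arc over \<open>[-B,-A]\<close> to the middle
part and has slopes of order \<open>h/A\<close>.\<close>

definition q3 :: real where "q3 = (h / A - rho) / (2 * A\<^sup>2)"
definition q1 :: real where "q1 = - (3 * (h / A) - rho) / 2"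
definition q :: "real \<Rightarrow> real" where "q x = q1 * x + q3 * x ^ 3"
definition q' :: "real \<Rightarrow> real" where "q' x = q1 + 3 * q3 * x\<^sup>2"

lemma q_deriv: "(q has_real_derivative q' x) (at x)"
  unfolding q_def[abs_def] q'_def by (auto intro!: derivative_eq_intros)

lemma q_odd: "q (- x) = - q x" and q'_even: "q' (- x) = q' x"
  by (simp_all add: q_def q'_def)

lemma q_A: "q A = - h" and q'_A: "q' A = - rho"
proof -
  have A: "A \<noteq> 0" using params by simp
  have "q3 * A\<^sup>2 = (h / A - rho) / 2" using A by (simp add: q3_def)
  then have 1: "q3 * A ^ 3 = (h / A - rho) / 2 * A" by (simp add: power3_eq_cube power2_eq_square)
  show "q A = - h" unfolding q_def 1 using A by (simp add: q1_def field_simps)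
  show "q' A = - rho" unfolding q'_def using \<open>q3 * A\<^sup>2 = (h / A - rho) / 2\<close>
    by (simp add: q1_def field_simps)
qed

lemma continuous_on_q': "continuous_on S q'"
  unfolding q'_def[abs_def] by (intro continuous_intros)

text \<open>The horizontal shear must outweigh the slow direction, whose inverse slope is \<open>1/slope\<close>, with room for the
perturbation \<open>k q'\<close>; twice that value is enough.\<close>

definition k :: real where "k = 2 / slope"

lemma middle_shear_gentle: assumes "\<bar>x\<bar> \<le> A" shows "\<bar>k * q' x\<bar> \<le> 1 / 2"
proof -
  have q3: "0 \<le> q3" using rho_le params by (simp add: q3_def)
  have "x\<^sup>2 \<le> A\<^sup>2" using assms params by (simp add: abs_le_square_iff[symmetric])
  then have "q' x \<le> q' A" using q3 by (simp add: q'_def mult_left_mono)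
  then have 1: "q' x \<le> 0" using q'_A rho_pos by simp
  have "q1 \<le> q' x" using q3 by (simp add: q'_def)
  moreover have "- (3 / 2 * r) \<le> - (3 * r - rho) / 2" for r using rho_pos by simp
  then have "- (3 / 2 * (h / A)) \<le> q1" unfolding q1_def .
  ultimately have 2: "- (3 / 2 * (h / A)) \<le> q' x" by (rule order_trans[rotated])
  have "h / A \<le> 1 / (\<beta> * A) / A" by (rule divide_right_mono[OF h_le]) (use params in simp)
  also have "\<dots> = (1 / \<beta>) / A\<^sup>2" using params by (simp add: power2_eq_square)
  also have "\<dots> \<le> slope / 6"
  proof -
    have "12 / (\<beta> * (2 * slope)) * (slope / 6) \<le> A\<^sup>2 * (slope / 6)"
      by (rule mult_right_mono[OF A_large[unfolded two_slope]]) (use slope_pos in simp)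
    moreover have "12 / (\<beta> * (2 * slope)) * (slope / 6) = 1 / \<beta>" using params slope_pos by simp
    ultimately have 3: "1 / \<beta> \<le> slope / 6 * A\<^sup>2" by (simp only: mult.commute)
    have A2: "0 < A\<^sup>2" using params by simp
    show ?thesis unfolding pos_divide_le_eq[OF A2] by (rule 3)
  qed
  finally have 4: "h / A \<le> slope / 6" .
  have "3 / 2 * r \<le> slope / 4" if "r \<le> slope / 6" for r using that by simp
  from this[OF 4] have "3 / 2 * (h / A) \<le> slope / 4" .
  then have "\<bar>q' x\<bar> \<le> slope / 4" using 1 2 by simp
  then have "k * \<bar>q' x\<bar> \<le> k * (slope / 4)" using slope_pos by (intro mult_left_mono) (auto simp: k_def)
  also have "\<dots> = 1 / 2" using slope_pos by (simp add: k_def)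
  finally show ?thesis using slope_pos by (simp add: abs_mult k_def)
qed

text \<open>The middle part of the curve after undoing the vertical shear \<open>q\<close> and the horizontal shear \<open>k\<close>, parametrised
by \<open>u = -y\<close>: \<open>X u\<close> is its horizontal coordinate, and \<open>q (psi u) - u\<close> its height.\<close>

definition X :: "real \<Rightarrow> real" where "X u = k * (u - q (psi u)) - psi u"
definition X1 :: "real \<Rightarrow> real" where "X1 u = k * (1 - q' (psi u) * psi1 u) - psi1 u"

lemma X_deriv: "(X has_real_derivative X1 u) (at u)"
  unfolding X_def[abs_def] X1_def
  by (intro DERIV_diff DERIV_cmult DERIV_ident DERIV_chain2[OF q_deriv] psi_deriv)

lemma continuous_on_psi: "continuous_on S psi"
  by (rule DERIV_continuous_on) (rule has_field_derivative_at_within[OF psi_deriv])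

lemma continuous_on_X1: "continuous_on S X1"
  unfolding X1_def[abs_def]
  by (intro continuous_on_diff continuous_on_mult continuous_on_const continuous_on_psi1
      continuous_on_compose2[OF continuous_on_q'[of UNIV] continuous_on_psi]) auto

text \<open>If \<open>psi1 u \<ge> 0\<close>, then \<open>(1 + k q') psi1 u \<le> (3/2)/slope < k\<close>; if it is negative, the second term of \<open>X1 u\<close>
helps.\<close>

lemma X1_pos: assumes "\<bar>u\<bar> \<le> h" shows "0 < X1 u"
proof -
  have b: "\<bar>k * q' (psi u)\<bar> \<le> 1 / 2" by (rule middle_shear_gentle[OF psi_bound[OF assms]])
  have X1: "X1 u = k - (1 + k * q' (psi u)) * psi1 u" by (simp add: X1_def algebra_simps)
  have k: "0 < k" using slope_pos by (simp add: k_def)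
  have p: "psi1 u \<le> 1 / slope"
  proof -
    have "0 \<le> (A + h / slope) * (\<beta> / (\<alpha> - \<beta>) / h * (\<bar>u\<bar> / h) powr (\<beta> / (\<alpha> - \<beta>) - 1))"
      using params h_pos slope_pos by (intro mult_nonneg_nonneg add_nonneg_nonneg divide_nonneg_nonneg) auto
    then show ?thesis by (simp add: psi1_def)
  qed
  show ?thesis
  proof (cases "0 \<le> psi1 u")
    case True
    have "(1 + k * q' (psi u)) * psi1 u \<le> 3 / 2 * (1 / slope)"
      using b p True by (intro mult_mono) auto
    also have "3 / 2 * (1 / slope) < 2 * (1 / slope)" using slope_pos by (intro mult_strict_right_mono) auto
    also have "2 * (1 / slope) = k" by (simp add: k_def)
    finally show ?thesis unfolding X1 by simp
  next
    case False
    have "(1 + k * q' (psi u)) * psi1 u \<le> 0" using b False by (intro mult_nonneg_nonpos) auto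
    then show ?thesis unfolding X1 using k by simp
  qed
qed

lemma X_h: "X h = A" "X (- h) = - A"
  by (simp_all add: X_def psi_odd psi_h q_odd q_A)

text \<open>The height as a function of the horizontal coordinate. It joins the zero function in a \<open>C\<^sup>1\<close> way at \<open>\<plusminus>A\<close> since
\<open>q\<close> is tangent to the curve there: \<open>q' (\<plusminus>A) psi1 (\<plusminus>h) = 1\<close>.\<close>

lemma middle_profile:
  "\<exists>G G1. (\<forall>x. (G has_real_derivative G1 x) (at x)) \<and> continuous_on UNIV G1 \<and>
     (\<forall>x. A \<le> \<bar>x\<bar> \<longrightarrow> G x = 0 \<and> G1 x = 0) \<and> (\<forall>u. \<bar>u\<bar> \<le> h \<longrightarrow> G (X u) = q (psi u) - u)"
proof -
  have hh: "0 < X1 h" "0 < X1 (- h)" using X1_pos h_pos by auto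
  have lim: "(X1 \<longlongrightarrow> X1 u) (nhds u)" for u
    using continuous_on_X1[of UNIV]
    by (simp add: continuous_on_eq_continuous_at isCont_def tendsto_at_iff_tendsto_nhds)
  have "eventually (\<lambda>u. 0 < X1 u) (nhds h)" "eventually (\<lambda>u. 0 < X1 u) (nhds (- h))"
    using order_tendstoD(1)[OF lim hh(1)] order_tendstoD(1)[OF lim hh(2)] by auto
  then obtain e1 e2 where e: "0 < e1" "\<And>u. dist u h < e1 \<Longrightarrow> 0 < X1 u" "0 < e2" "\<And>u. dist u (- h) < e2 \<Longrightarrow> 0 < X1 u"
    unfolding eventually_nhds_metric by auto
  define e where "e = min e1 e2"
  \<comment> \<open>Again an open interval is needed for two-sided derivatives at the ends.\<close>
  let ?I = "{-h - e<..<h + e}"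
  have pos: "0 < X1 u" if "u \<in> ?I" for u
    using X1_pos[of u] e(2)[of u] e(4)[of u] that by (cases "\<bar>u\<bar> \<le> h"; cases "0 \<le> u") (auto simp: e_def dist_real_def)
  have epos: "0 < e" using e(1,3) by (simp add: e_def)
  then have sub: "{-h..h} \<subseteq> ?I" by auto
  define \<iota> where "\<iota> = inv_into ?I X"
  have inv: "\<iota> (X u) = u" if "u \<in> ?I" for u
    unfolding \<iota>_def by (rule strict_mono_inverse_derivative(2)[of _ _ X X1, OF _ _ that]) (rule X_deriv, rule pos)
  have invd: "(\<iota> has_real_derivative inverse (X1 u)) (at (X u))" if "u \<in> ?I" for u
    unfolding \<iota>_def by (rule strict_mono_inverse_derivative(3)[of _ _ X X1, OF _ _ that]) (rule X_deriv, rule pos)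
  have onto: "\<exists>u\<in>{-h..h}. X u = x" if x: "x \<in> {-A..A}" for x
  proof -
    have "continuous_on {-h..h} X" by (rule DERIV_continuous_on) (rule has_field_derivative_at_within[OF X_deriv])
    then have "\<exists>u\<ge>-h. u \<le> h \<and> X u = x" by (intro IVT') (use x X_h h_pos in auto)
    then show ?thesis by auto
  qed
  define M where "M x = q (psi (\<iota> x)) - \<iota> x" for x
  define M1 where "M1 x = (q' (psi (\<iota> x)) * psi1 (\<iota> x) - 1) * inverse (X1 (\<iota> x))" for x
  have ix: "\<iota> x \<in> {-h..h} \<and> X (\<iota> x) = x" if "x \<in> {-A..A}" for x
    using onto[OF that] inv sub by force
  have id: "(\<iota> has_real_derivative inverse (X1 (\<iota> x))) (at x)" if "x \<in> {-A..A}" for x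
    using invd[of "\<iota> x"] ix[OF that] sub by auto
  have Md: "(M has_real_derivative M1 x) (at x)" if x: "x \<in> {-A..A}" for x
  proof -
    have "((\<lambda>x. q (psi (\<iota> x)) - \<iota> x) has_real_derivative
        q' (psi (\<iota> x)) * (psi1 (\<iota> x) * inverse (X1 (\<iota> x))) - inverse (X1 (\<iota> x))) (at x)"
      by (intro DERIV_diff DERIV_chain2[OF q_deriv] DERIV_chain2[OF psi_deriv] id[OF x])
    then show ?thesis unfolding M_def[abs_def, symmetric] by (rule DERIV_cong) (simp add: M1_def algebra_simps)
  qed
  have \<iota>c: "continuous_on {-A..A} \<iota>" by (rule DERIV_continuous_on) (rule has_field_derivative_at_within[OF id])
  have M1c: "continuous_on {-A..A} M1"
    unfolding M1_def
    by (intro continuous_on_mult continuous_on_diff continuous_on_const continuous_on_inverse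
        continuous_on_compose2[OF continuous_on_q'[of UNIV] continuous_on_compose2[OF continuous_on_psi[of UNIV] \<iota>c]]
        continuous_on_compose2[OF continuous_on_psi1[of UNIV] \<iota>c]
        continuous_on_compose2[OF continuous_on_X1[of UNIV] \<iota>c])
       (use ix X1_pos in \<open>force simp: abs_le_iff\<close>)+
  have \<iota>A: "\<iota> A = h" "\<iota> (- A) = - h" using inv[of h] inv[of "- h"] X_h epos h_pos by auto
  have MA: "M A = 0" "M (- A) = 0" by (simp_all add: M_def \<iota>A psi_odd psi_h q_odd q_A)
  have M1A: "M1 A = 0" "M1 (- A) = 0"
    using rho_pos by (simp_all add: M1_def \<iota>A psi_odd psi_h q'_even q'_A psi1_even psi1_h)
  define G where "G = (\<lambda>x. if x \<le> A then if x \<le> - A then 0 else M x else 0)"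
  define G1 where "G1 = (\<lambda>x. if x \<le> A then if x \<le> - A then 0 else M1 x else 0)"
  have left: "((\<lambda>x. if x \<le> - A then 0 else M x) has_real_derivative (if x \<le> - A then 0 else M1 x)) (at x)"
    if "x \<in> {..A}" for x
    by (rule has_real_derivative_piecewise[where I = "{..A}" and f' = "\<lambda>_. 0" and g' = M1]) (use that Md MA M1A in auto)
  have Gd: "(G has_real_derivative G1 x) (at x)" for x
    unfolding G_def G1_def
    by (rule has_real_derivative_piecewise[where I = UNIV and g' = "\<lambda>_. 0" and f' = "\<lambda>x. if x \<le> - A then 0 else M1 x"])
       (use left MA M1A params in auto)
  have c1: "continuous_on {..A} (\<lambda>x. if x \<le> - A then 0 else M1 x)"
  proof (rule continuous_on_cases_le[where h = "\<lambda>x. x" and a = "- A"])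
    show "continuous_on {t \<in> {..A}. - A \<le> t} M1" by (rule continuous_on_subset[OF M1c]) auto
  qed (use M1A in auto)
  have "continuous_on UNIV G1" unfolding G1_def
  proof (rule continuous_on_cases_le[where h = "\<lambda>x. x" and a = A])
    show "continuous_on {t \<in> UNIV. t \<le> A} (\<lambda>x. if x \<le> - A then 0 else M1 x)"
      by (rule continuous_on_subset[OF c1]) auto
  qed (use M1A params in auto)
  moreover have "G x = 0 \<and> G1 x = 0" if "A \<le> \<bar>x\<bar>" for x
    using that MA M1A params by (cases "x = A") (auto simp: G_def G1_def abs_if split: if_splits)
  moreover have "G (X u) = q (psi u) - u" if u: "\<bar>u\<bar> \<le> h" for u
  proof -
    have ui: "u \<in> ?I" using epos u by (auto simp: abs_le_iff)
    have mono: "X s \<le> X t" if "s \<le> t" "s \<in> {-h..h}" "t \<in> {-h..h}" for s t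
    proof -
      have "strict_mono_on ?I X"
        by (rule strict_mono_inverse_derivative(1)[of _ _ X X1]) (rule X_deriv, rule pos)
      then show ?thesis using that sub by (meson strict_mono_on_leD subsetD)
    qed
    have r: "- A \<le> X u" "X u \<le> A" using mono[of "- h" u] mono[of u h] X_h u h_pos by (auto simp: abs_le_iff)
    have "G (X u) = M (X u)" using r MA by (cases "X u = - A") (auto simp: G_def)
    then show ?thesis by (simp add: M_def inv[OF ui])
  qed
  ultimately show ?thesis using Gd by blast
qed

text \<open>The profile of the last vertical shear: the outer arc over \<open>[-B,-A]\<close>, the cubic \<open>q\<close> in the middle, zero beyond \<open>\<plusminus>B\<close>,
extended as an odd function.\<close>

lemma outer_profile:
  "\<exists>f f1. (\<forall>x. (f has_real_derivative f1 x) (at x)) \<and> continuous_on UNIV f1 \<and>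
     (\<forall>x. B \<le> \<bar>x\<bar> \<longrightarrow> f x = 0 \<and> f1 x = 0) \<and> (\<forall>x. f (- x) = - f x) \<and> (\<forall>x. \<bar>x\<bar> \<le> A \<longrightarrow> f x = q x) \<and>
     g ` {0..T} = (\<lambda>x. (x, f x)) ` {-B..-A}"
proof -
  obtain Y Y1 where Y0: "(\<forall>x\<in>{-B..-A}. (Y has_real_derivative Y1 x) (at x)) \<and> continuous_on {-B..-A} Y1 \<and>
     Y (- B) = 0 \<and> Y1 (- B) = 0 \<and> Y (- A) = h \<and> Y1 (- A) = - (\<alpha> - \<beta>) * h / (\<beta> * A + 2 * h) \<and>
     g ` {0..T} = (\<lambda>x. (x, Y x)) ` {-B..-A}"
    using outer_arc by (elim exE)
  then have Y: "\<And>x. x \<in> {-B..-A} \<Longrightarrow> (Y has_real_derivative Y1 x) (at x)" "continuous_on {-B..-A} Y1"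
    "Y (- B) = 0" "Y1 (- B) = 0" "Y (- A) = h" "Y1 (- A) = - (\<alpha> - \<beta>) * h / (\<beta> * A + 2 * h)"
    "g ` {0..T} = (\<lambda>x. (x, Y x)) ` {-B..-A}"
    by (elim conjE; simp)+
  have Y1A: "Y1 (- A) = - rho" using Y(6) by (simp only: rho_def mult_minus_left divide_minus_left)
  have qA: "q (- A) = h" "q' (- A) = - rho" by (simp_all add: q_odd q_A q'_even q'_A)
  define E where "E = (\<lambda>x. if x \<le> - B then 0 else Y x)"
  define E1 where "E1 = (\<lambda>x. if x \<le> - B then 0 else Y1 x)"
  define L where "L = (\<lambda>x. if x \<le> - A then E x else q x)"
  define L1 where "L1 = (\<lambda>x. if x \<le> - A then E1 x else q' x)"
  have AB: "- B < - A" using params by simp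
  have Ed: "(E has_real_derivative E1 x) (at x)" if "x \<in> {..-A}" for x
    unfolding E_def E1_def
    by (rule has_real_derivative_piecewise[where I = "{..-A}" and f' = "\<lambda>_. 0" and g' = Y1]) (use that Y in auto)
  have EA: "E (- A) = h" "E1 (- A) = - rho" using Y Y1A AB by (auto simp: E_def E1_def)
  have Ld: "(L has_real_derivative L1 x) (at x)" for x
    unfolding L_def L1_def
    by (rule has_real_derivative_piecewise[where I = UNIV and f' = E1 and g' = q']) (use Ed EA qA q_deriv in auto)
  have E1c: "continuous_on {..-A} E1" unfolding E1_def
  proof (rule continuous_on_cases_le[where h = "\<lambda>x. x" and a = "- B"])
    show "continuous_on {t \<in> {..-A}. - B \<le> t} Y1" by (rule continuous_on_subset[OF Y(2)]) auto
  qed (use Y in auto)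
  have L1c: "continuous_on UNIV L1" unfolding L1_def
  proof (rule continuous_on_cases_le[where h = "\<lambda>x. x" and a = "- A"])
    show "continuous_on {t \<in> UNIV. t \<le> - A} E1" by (rule continuous_on_subset[OF E1c]) auto
  qed (use EA qA continuous_on_q' in auto)
  define f where "f = (\<lambda>x. if x \<le> A then L x else - L (- x))"
  define f1 where "f1 = (\<lambda>x. if x \<le> A then L1 x else L1 (- x))"
  have nA: "\<not> A \<le> - A" using params by simp
  have LA: "L A = - L (- A)" "L1 A = L1 (- A)" using nA EA by (auto simp: L_def L1_def q_A q'_A)
  have Rd: "((\<lambda>x. - L (- x)) has_real_derivative L1 (- x)) (at x)" for x
    using DERIV_minus[OF DERIV_chain2[OF Ld DERIV_minus[OF DERIV_ident]]] by simp
  have fd: "(f has_real_derivative f1 x) (at x)" for x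
    unfolding f_def f1_def
    by (rule has_real_derivative_piecewise[where I = UNIV and f' = L1 and g' = "\<lambda>x. L1 (- x)"]) (use Ld Rd LA in auto)
  have f1c: "continuous_on UNIV f1" unfolding f1_def
  proof (rule continuous_on_cases_le[where h = "\<lambda>x. x" and a = A])
    show "continuous_on {t \<in> UNIV. A \<le> t} (\<lambda>x. L1 (- x))"
      by (rule continuous_on_compose2[OF L1c]) (auto intro!: continuous_intros)
    show "continuous_on {t \<in> UNIV. t \<le> A} L1" by (rule continuous_on_subset[OF L1c]) auto
  qed (use LA in auto)
  have inner: "f x = q x" if "\<bar>x\<bar> \<le> A" for x
  proof -
    have "x = - A \<or> - A < x" "x \<le> A" using that by auto
    then show ?thesis using EA qA by (auto simp: f_def L_def)
  qed
  have odd: "f (- x) = - f x" for x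
  proof -
    consider "\<bar>x\<bar> \<le> A" | "A < x" | "x < - A" by linarith
    then show ?thesis
    proof cases
      case 1 then show ?thesis using inner[of x] inner[of "- x"] q_odd by simp
    qed (use params in \<open>auto simp: f_def\<close>)
  qed
  have out: "f x = 0 \<and> f1 x = 0" if "B \<le> \<bar>x\<bar>" for x
    using that params by (auto simp: f_def f1_def L_def L1_def E_def E1_def abs_if split: if_splits)
  have "f x = Y x" if "x \<in> {-B..-A}" for x
    using that Y(3) params by (cases "x = - B") (auto simp: f_def L_def E_def)
  then have "g ` {0..T} = (\<lambda>x. (x, f x)) ` {-B..-A}" unfolding Y(7) by (intro image_cong) auto
  then show ?thesis using fd f1c inner odd out by blast
qed

text \<open>One lift of the attracting curve to the closed fundamental strip.\<close>

definition loop :: "real \<Rightarrow> (real \<times> real) set" where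
  "loop D = ({-D..-B} \<union> {B..D}) \<times> {0} \<union> (g ` {0..} \<union> uminus ` g ` {0..} \<union> {0})"

text \<open>Beyond \<open>\<plusminus>A\<close> the first two shears do nothing to the axis and the third lifts it to the outer arcs; in between, the
composition sends \<open>(X u, 0)\<close> to \<open>(psi (-u), -u)\<close>.\<close>

lemma loop_is_sheared_section:
  assumes BD: "B < D"
  shows "\<exists>f f1 G G1. shear_isotopy D f f1 G G1 \<and> (\<lambda>x. shear_isotopy.\<Psi> k f G 1 (x, 0)) ` {-D..D} = loop D"
proof -
  obtain f0 f1 where fp: "\<And>x. (f0 has_real_derivative f1 x) (at x)" "continuous_on UNIV f1"
    "\<And>x. B \<le> \<bar>x\<bar> \<Longrightarrow> f0 x = 0 \<and> f1 x = 0" "\<And>x. f0 (- x) = - f0 x" "\<And>x. \<bar>x\<bar> \<le> A \<Longrightarrow> f0 x = q x"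
    "g ` {0..T} = (\<lambda>x. (x, f0 x)) ` {-B..-A}"
    using outer_profile by blast
  obtain G0 G1 where Gp: "\<And>x. (G0 has_real_derivative G1 x) (at x)" "continuous_on UNIV G1"
    "\<And>x. A \<le> \<bar>x\<bar> \<Longrightarrow> G0 x = 0 \<and> G1 x = 0" "\<And>u. \<bar>u\<bar> \<le> h \<Longrightarrow> G0 (X u) = q (psi u) - u"
    using middle_profile by blast
  have D0: "0 < D" using BD B_pos by simp
  have fD: "f0 D = 0" "f0 (- D) = 0" "f1 D = 0" "f1 (- D) = 0" using fp(3)[of D] fp(3)[of "- D"] BD D0 by auto
  have GD: "G0 D = 0" "G0 (- D) = 0" "G1 D = 0" "G1 (- D) = 0" using Gp(3)[of D] Gp(3)[of "- D"] BD D0 params by auto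
  let ?f = "\<lambda>x. f0 (wrap D x)" and ?G = "\<lambda>x. G0 (wrap D x)"
  interpret shear_isotopy D k ?f "\<lambda>x. f1 (wrap D x)" ?G "\<lambda>x. G1 (wrap D x)"
  proof
    show "0 < D" by (rule D0)
    show "(?f has_real_derivative f1 (wrap D x)) (at x)" for x
      by (rule periodic_has_real_derivative[OF D0 fp(1)]) (simp_all add: fD)
    show "(?G has_real_derivative G1 (wrap D x)) (at x)" for x
      by (rule periodic_has_real_derivative[OF D0 Gp(1)]) (simp_all add: GD)
    show "continuous_on UNIV (\<lambda>x. f1 (wrap D x))" by (rule periodic_continuous[OF D0 fp(2)]) (simp add: fD)
    show "continuous_on UNIV (\<lambda>x. G1 (wrap D x))" by (rule periodic_continuous[OF D0 Gp(2)]) (simp add: GD)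
    show "?f (x + 2 * D) = ?f x" "?G (x + 2 * D) = ?G x" for x using wrap_shift[OF D0, of x 1] by simp_all
  qed
  have wr: "f0 (wrap D x) = f0 x" "G0 (wrap D x) = G0 x" if "x \<in> {-D..D}" for x
  proof -
    have "wrap D x = x \<or> x = D \<and> wrap D x = - D"
      using that wrap_eq[OF D0, of x] wrap_eq[OF D0, of "- D"] wrap_shift[OF D0, of "- D" 1] D0 by (cases "x = D") auto
    then show "f0 (wrap D x) = f0 x" "G0 (wrap D x) = G0 x" using fD GD by auto
  qed
  have outer: "\<Psi> 1 (x, 0) = (x, f0 x)" if "x \<in> {-D..D}" "A \<le> \<bar>x\<bar>" for x
    using that Gp(3)[of x] by (simp add: \<Psi>_axis wr)
  have Xr: "X u \<in> {-A..A} \<and> X u \<in> {-D..D}" if "\<bar>u\<bar> \<le> h" for u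
  proof -
    have mono: "X s \<le> X t" if "s \<le> t" "\<bar>s\<bar> \<le> h" "\<bar>t\<bar> \<le> h" for s t
    proof (rule DERIV_nonneg_imp_nondecreasing[OF that(1)])
      fix r assume "s \<le> r" "r \<le> t"
      then have "\<bar>r\<bar> \<le> h" using that by auto
      then show "\<exists>y. (X has_real_derivative y) (at r) \<and> 0 \<le> y" using X_deriv X1_pos less_imp_le by blast
    qed
    show ?thesis using mono[of "- h" u] mono[of u h] that X_h BD params by (auto simp: abs_le_iff)
  qed
  have middle: "\<Psi> 1 (X u, 0) = (psi (- u), - u)" if u: "\<bar>u\<bar> \<le> h" for u
  proof -
    have e: "X u + k * (q (psi u) - u) = psi (- u)" by (simp add: X_def psi_odd algebra_simps)
    have pb: "\<bar>psi (- u)\<bar> \<le> A" using psi_bound[of "- u"] u by simp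
    then have "psi (- u) \<in> {-D..D}" using BD params by (auto simp: abs_le_iff)
    then show ?thesis using Xr[OF u] pb
      by (simp add: \<Psi>_axis wr Gp(4)[OF u] e fp(5)) (simp add: psi_odd q_odd)
  qed
  have onto: "\<exists>u. \<bar>u\<bar> \<le> h \<and> X u = x" if x: "\<bar>x\<bar> \<le> A" for x
  proof -
    have "continuous_on {-h..h} X" by (rule DERIV_continuous_on) (rule has_field_derivative_at_within[OF X_deriv])
    then have "\<exists>u\<ge>-h. u \<le> h \<and> X u = x" by (intro IVT') (use x X_h h_pos in auto)
    then show ?thesis by (auto simp: abs_le_iff)
  qed
  have arcs: "g ` {0..} = (\<lambda>x. (x, f0 x)) ` {-B..-A} \<union> (\<lambda>y. (psi y, y)) ` {0<..h}"
  proof -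
    have "{0..} = {0..T} \<union> {T..}" using T(1) by auto
    then show ?thesis using fp(6) inner_arc by (simp add: image_Un)
  qed
  have neg: "uminus ` g ` {0..} = (\<lambda>x. (x, f0 x)) ` {A..B} \<union> (\<lambda>y. (psi y, y)) ` {-h..<0}"
  proof -
    have "uminus ` (\<lambda>x. (x, f0 x)) ` {-B..-A} = (\<lambda>x. (x, f0 x)) ` uminus ` {-B..-A}"
      unfolding image_image by (rule image_cong) (simp_all add: fp(4))
    moreover have "uminus ` (\<lambda>y. (psi y, y)) ` {0<..h} = (\<lambda>y. (psi y, y)) ` uminus ` {0<..h}"
      unfolding image_image by (rule image_cong) (simp_all add: psi_odd)
    ultimately show ?thesis unfolding arcs image_Un by simp
  qed
  have psi0: "psi 0 = 0" by (simp add: psi_def)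
  have "(\<lambda>x. \<Psi> 1 (x, 0)) ` {-D..D} = loop D"
  proof (intro equalityI subsetI)
    fix z assume "z \<in> (\<lambda>x. \<Psi> 1 (x, 0)) ` {-D..D}"
    then obtain x where x: "x \<in> {-D..D}" "z = \<Psi> 1 (x, 0)" by blast
    show "z \<in> loop D"
    proof (cases "A \<le> \<bar>x\<bar>")
      case True
      then have z: "z = (x, f0 x)" using x outer by simp
      consider "B \<le> \<bar>x\<bar>" | "x \<in> {-B..-A}" | "x \<in> {A..B}" using True by fastforce
      then show ?thesis
      proof cases
        case 1 then show ?thesis using z fp(3)[of x] x by (auto simp: loop_def abs_if split: if_splits)
      next
        case 2 then show ?thesis using z by (auto simp: loop_def arcs)
      next
        case 3 then show ?thesis using z by (auto simp: loop_def neg)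
      qed
    next
      case False
      then obtain u where u: "\<bar>u\<bar> \<le> h" "X u = x" using onto[of x] by auto
      then have z: "z = (psi (- u), - u)" using middle x by auto
      consider "- u = 0" | "- u \<in> {0<..h}" | "- u \<in> {-h..<0}" using u by fastforce
      then show ?thesis
      proof cases
        case 1 then show ?thesis using z psi0 by (auto simp: loop_def zero_prod_def)
      next
        case 2 then show ?thesis using z by (auto simp: loop_def arcs)
      next
        case 3 then show ?thesis using z unfolding loop_def neg by blast
      qed
    qed
  next
    fix z assume z: "z \<in> loop D"
    have m: "(psi y, y) \<in> (\<lambda>x. \<Psi> 1 (x, 0)) ` {-D..D}" if y: "\<bar>y\<bar> \<le> h" for y
    proof (rule image_eqI)
      show "(psi y, y) = \<Psi> 1 (X (- y), 0)" using middle[of "- y"] y by simp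
      show "X (- y) \<in> {-D..D}" using Xr[of "- y"] y by simp
    qed
    have o: "(x, f0 x) \<in> (\<lambda>x. \<Psi> 1 (x, 0)) ` {-D..D}" if "x \<in> {-D..D}" "A \<le> \<bar>x\<bar>" for x
      by (rule image_eqI[of _ _ x]) (use that outer in auto)
    consider x where "z = (x, 0)" "x \<in> {-D..D}" "B \<le> \<bar>x\<bar>" | x where "z = (x, f0 x)" "x \<in> {-B..-A} \<union> {A..B}"
      | y where "z = (psi y, y)" "\<bar>y\<bar> \<le> h"
      using z h_pos B_pos BD psi0 unfolding loop_def neg unfolding arcs
      by (elim UnE imageE) (force simp: zero_prod_def)+
    then show "z \<in> (\<lambda>x. \<Psi> 1 (x, 0)) ` {-D..D}"
    proof cases
      case (1 x) then show ?thesis using o[of x] fp(3)[of x] params by auto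
    next
      case (2 x) then show ?thesis using o[of x] params BD by auto
    next
      case (3 y) then show ?thesis using m by auto
    qed
  qed
  then show ?thesis using shear_isotopy_axioms by blast
qed

theorem loop_isotopic:
  assumes "B < D"
  shows "isotopic_to_zero_section D (cover D ` loop D)" "C1_submanifold D (cover D ` loop D)" "compact (cover D ` loop D)"
proof -
  obtain f f1 G G1 where s: "shear_isotopy D f f1 G G1" "(\<lambda>x. shear_isotopy.\<Psi> k f G 1 (x, 0)) ` {-D..D} = loop D"
    using loop_is_sheared_section[OF assms] by blast
  show "isotopic_to_zero_section D (cover D ` loop D)" "C1_submanifold D (cover D ` loop D)" "compact (cover D ` loop D)"
    using shear_isotopy.isotopic[OF s(1)] shear_isotopy.submanifold[OF s(1)] shear_isotopy.compact_image[OF s(1)]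
    unfolding s(2)[symmetric] by blast+
qed

text \<open>The orbit crosses the vertical axis when the fast and the slow exponential in \<open>inner_x\<close> cancel, at positive height,
whereas the origin is on the curve too.\<close>

theorem loop_not_graph: "\<not> is_graph (cover D ` loop D)"
proof
  assume "is_graph (cover D ` loop D)"
  then obtain f where f: "cover D ` loop D = (\<lambda>c. (c, f c)) ` sphere 0 1" unfolding is_graph_def by blast
  define hd where "hd = h / slope"
  have hd: "0 < hd" using h_pos slope_pos by (simp add: hd_def)
  \<comment> \<open>The solution of \<open>inner_x t = 0\<close>.\<close>
  define t where "t = ln ((A + hd) / hd) / (2 * \<beta> - \<alpha>)"
  have t0: "0 \<le> t" using hd params unfolding t_def by (intro divide_nonneg_pos ln_ge_zero) (auto simp: pos_le_divide_eq)
  have "(2 * \<beta> - \<alpha>) * t = ln ((A + hd) / hd)" using params by (simp add: t_def)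
  then have e: "exp ((2 * \<beta> - \<alpha>) * t) = (A + hd) / hd" using hd params by (simp add: add_pos_pos)
  have "exp (- (\<alpha> - \<beta>) * t) = exp ((2 * \<beta> - \<alpha>) * t) * exp (- \<beta> * t)"
    unfolding exp_add[symmetric] by (simp add: algebra_simps)
  then have "hd * exp (- (\<alpha> - \<beta>) * t) = (A + hd) * exp (- \<beta> * t)" unfolding e using hd by simp
  then have "inner_x t = 0" by (simp add: inner_x_def hd_def)
  then have "g (T + t) = (0, h * exp (- (\<alpha> - \<beta>) * t))" using g_forward[of "T + t"] t0 by simp
  moreover have "g (T + t) \<in> loop D" using t0 T(1) by (auto simp: loop_def)
  ultimately have 1: "(0, h * exp (- (\<alpha> - \<beta>) * t)) \<in> loop D" by simp
  have 2: "(0, 0) \<in> loop D" by (simp add: loop_def zero_prod_def)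
  have "snd (cover D (0, y)) = f 1" if "(0, y) \<in> loop D" for y
  proof -
    have "cover D (0, y) \<in> (\<lambda>c. (c, f c)) ` sphere 0 1" unfolding f[symmetric] using that by blast
    then show ?thesis by (auto simp: cover_simp)
  qed
  from this[OF 1] this[OF 2] show False using h_pos by (simp add: cover_simp)
qed

end

section \<open>The construction on the circle\<close>

lemma derivative_zero_where_constant:
  fixes f :: "real \<Rightarrow> real"
  assumes d: "\<And>x. (f has_real_derivative f' x) (at x)" and c: "continuous_on UNIV f'"
    and "open S" "\<And>x. x \<in> S \<Longrightarrow> f x = k" and x: "x \<in> closure S"
  shows "f' x = 0"
proof (rule continuous_constant_on_closure[of S f'])
  show "continuous_on (closure S) f'" using c continuous_on_subset by blast
  fix y assume y: "y \<in> S"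
  have "(f has_real_derivative 0) (at y)"
    by (rule has_field_derivative_transform_within_open[of "\<lambda>_. k" _ _ S]) (use assms y in auto)
  then show "f' y = 0" using DERIV_unique d by blast
qed (rule x)

lemma even_derivative_odd:
  fixes f :: "real \<Rightarrow> real"
  assumes d: "\<And>x. (f has_real_derivative f' x) (at x)" and "\<And>x. f (- x) = f x"
  shows "f' (- x) = - f' x"
proof -
  have "((\<lambda>x. f (- x)) has_real_derivative f' (- x) * - 1) (at x)"
    by (intro DERIV_chain2[OF d] DERIV_minus DERIV_ident)
  then have "(f has_real_derivative - f' (- x)) (at x)" using assms(2) by simp
  from DERIV_unique[OF this d] show ?thesis by simp
qed

lemma odd_derivative_even:
  fixes f :: "real \<Rightarrow> real"
  assumes d: "\<And>x. (f has_real_derivative f' x) (at x)" and "\<And>x. f (- x) = - f x"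
  shows "f' (- x) = f' x"
proof -
  have "((\<lambda>x. - f (- x)) has_real_derivative - (f' (- x) * - 1)) (at x)"
    by (intro DERIV_minus DERIV_chain2[OF d] DERIV_ident)
  then have "(f has_real_derivative f' (- x)) (at x)" using assms(2) by simp
  from DERIV_unique[OF this d] show ?thesis .
qed

lemma smooth_derivative:
  assumes "smooth f" shows "((deriv ^^ n) f has_real_derivative (deriv ^^ Suc n) f x) (at x)"
  using assms by (simp add: smooth_def DERIV_deriv_iff_field_differentiable)

text \<open>Two functions that agree on an overlap \<open>B < |x| < R\<close> are spliced at \<open>|x| = C\<close> inside it. The second statement allows
the lemma to be applied again to the derivatives.\<close>

lemma splice_has_derivative:
  fixes u v :: "real \<Rightarrow> real"
  assumes "B < C" "C < R"
    and u: "\<And>x. (u has_real_derivative u' x) (at x)" and v: "\<And>x. (v has_real_derivative v' x) (at x)"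
    and uv: "\<And>x. B < \<bar>x\<bar> \<Longrightarrow> \<bar>x\<bar> < R \<Longrightarrow> u x = v x"
  shows "((\<lambda>x. if \<bar>x\<bar> \<le> C then u x else v x) has_real_derivative (if \<bar>x\<bar> \<le> C then u' x else v' x)) (at x)"
    and "B < \<bar>x\<bar> \<Longrightarrow> \<bar>x\<bar> < R \<Longrightarrow> u' x = v' x"
proof -
  have o: "open {x :: real. B < \<bar>x\<bar> \<and> \<bar>x\<bar> < R}" "open {x :: real. \<bar>x\<bar> < R}" "open {x :: real. B < \<bar>x\<bar>}"
    by (intro open_Collect_conj open_Collect_less continuous_on_rabs continuous_on_id continuous_on_const)+
  show e: "u' x = v' x" if "B < \<bar>x\<bar>" "\<bar>x\<bar> < R" for x
  proof -
    have "(v has_real_derivative u' x) (at x)"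
      by (rule has_field_derivative_transform_within_open[OF u o(1)]) (use that uv in auto)
    then show ?thesis using DERIV_unique v by blast
  qed
  show "((\<lambda>x. if \<bar>x\<bar> \<le> C then u x else v x) has_real_derivative (if \<bar>x\<bar> \<le> C then u' x else v' x)) (at x)"
  proof (cases "\<bar>x\<bar> \<le> C")
    case True
    have "((\<lambda>x. if \<bar>x\<bar> \<le> C then u x else v x) has_real_derivative u' x) (at x)"
      by (rule has_field_derivative_transform_within_open[OF u o(2)]) (use True uv assms(1,2) in auto)
    then show ?thesis using True by simp
  next
    case False
    have "((\<lambda>x. if \<bar>x\<bar> \<le> C then u x else v x) has_real_derivative v' x) (at x)"
      by (rule has_field_derivative_transform_within_open[OF v o(3)]) (use False uv assms(1,2) in auto)
    then show ?thesis using False by simp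
  qed
qed

lemma wrap_minus: "0 < D \<Longrightarrow> wrap D (- x) = (if wrap D x = - D then - D else - wrap D x)"
proof -
  assume D: "0 < D"
  define n where "n = \<lfloor>(x + D) / (2 * D)\<rfloor>"
  have w: "wrap D x = x - 2 * D * of_int n" by (simp add: wrap_def n_def)
  show ?thesis
  proof (cases "wrap D x = - D")
    case True
    have "wrap D (- x) = - x - 2 * D * of_int (1 - n)"
      by (rule wrap_unique[OF D]) (use True w D in \<open>simp_all add: algebra_simps\<close>)
    then show ?thesis using True w by (simp add: algebra_simps)
  next
    case False
    have "wrap D (- x) = - x - 2 * D * of_int (- n)"
      by (rule wrap_unique[OF D]) (use False w wrap_range[OF D, of x] in simp_all)
    then show ?thesis using False w by simp
  qed
qed

lemma wrap_fundamental:
  assumes "0 < D" "f (- D) = f D" "\<bar>x\<bar> \<le> D" shows "f (wrap D x) = f x"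
proof (cases "x = D")
  case True
  then show ?thesis using assms wrap_eq[of D "- D"] wrap_shift[of D "- D" 1] by simp
qed (use assms wrap_eq[of D x] in auto)

lemma periodic_even:
  assumes "0 < D" "\<And>x. f (- x) = f x" shows "f (wrap D (- x)) = f (wrap D x)"
  using assms by (simp add: wrap_minus)

lemma periodic_odd:
  fixes f :: "real \<Rightarrow> real"
  assumes "0 < D" "\<And>x. f (- x) = - f x" "f (- D) = f D" shows "f (wrap D (- x)) = - f (wrap D x)"
  using assms(3) assms(2)[of D] by (simp add: wrap_minus assms)

locale circle_construction =
  fixes \<alpha> \<beta> A B C D :: real and V X \<eta> :: "real \<Rightarrow> real"
  assumes params: "0 < \<beta>" "\<beta> < \<alpha>" "\<alpha> < 2 * \<beta>" "0 < A" "A < B" "B < C" "C < D"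
    and A_large: "12 / (\<beta> * (2 * \<beta> - \<alpha>)) \<le> A\<^sup>2"
    and V: "is_potential A B V" and X: "is_circle_field \<beta> B C D X" and \<eta>: "is_bump \<alpha> \<beta> B C \<eta>"
begin

lemma D_pos: "0 < D" using params by linarith

lemma smooth_chain:
  assumes "smooth f"
  shows "\<And>x. (f has_real_derivative deriv f x) (at x)" "\<And>x. (deriv f has_real_derivative deriv (deriv f) x) (at x)"
    "\<And>x. (deriv (deriv f) has_real_derivative deriv (deriv (deriv f)) x) (at x)"
    "continuous_on S f" "continuous_on S (deriv f)" "continuous_on S (deriv (deriv f))"
proof -
  show d: "\<And>x. (f has_real_derivative deriv f x) (at x)" "\<And>x. (deriv f has_real_derivative deriv (deriv f) x) (at x)"
    "\<And>x. (deriv (deriv f) has_real_derivative deriv (deriv (deriv f)) x) (at x)"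
    using smooth_derivative[OF assms, of 0] smooth_derivative[OF assms, of 1] smooth_derivative[OF assms, of 2]
    by (simp_all add: numeral_2_eq_2)
  show "continuous_on S f" "continuous_on S (deriv f)" "continuous_on S (deriv (deriv f))"
    by (rule DERIV_continuous_on, rule has_field_derivative_at_within, rule d)+
qed

lemma V_smooth: "smooth V" and V_even: "V (- x) = V x" and V_range: "- 1 \<le> V x" "V x \<le> 0"
proof -
  have "range V \<subseteq> {-1..0}" using V unfolding is_potential_def by blast
  then have "V x \<in> {-1..0}" by blast
  then show "- 1 \<le> V x" "V x \<le> 0" by auto
qed (use V in \<open>simp_all add: is_potential_def\<close>)

lemmas V_der = smooth_chain[OF V_smooth]

lemma V_outer: assumes "B \<le> \<bar>x\<bar>" shows "V x = 0" "deriv V x = 0" "deriv (deriv V) x = 0"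
proof -
  let ?S = "{B<..} \<union> {..<- B}"
  have S: "open ?S" by (intro open_Un open_greaterThan open_lessThan)
  have cl: "x \<in> closure ?S" using assms by (auto simp: closure_Un)
  have cl': "y \<in> closure ?S" if "y \<in> ?S" for y by (rule subsetD[OF closure_subset that])
  have supp: "closure {x. V x \<noteq> 0} \<subseteq> {-B..B}" using V unfolding is_potential_def by (elim conjE)
  have z: "V y = 0" if "y \<in> ?S" for y
  proof (rule ccontr)
    assume "V y \<noteq> 0"
    then have "y \<in> closure {x. V x \<noteq> 0}" by (intro subsetD[OF closure_subset]) simp
    then have "y \<in> {-B..B}" using supp by (rule subsetD[rotated])
    then show False using that by auto
  qed
  show "V x = 0" by (rule continuous_constant_on_closure[OF V_der(4) _ cl]) (rule z)
  show 1: "deriv V x = 0" by (rule derivative_zero_where_constant[OF V_der(1,5) S z cl])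
  have "deriv V y = 0" if "y \<in> ?S" for y
    by (rule derivative_zero_where_constant[OF V_der(1,5) S z cl'[OF that]])
  then show "deriv (deriv V) x = 0" by (rule derivative_zero_where_constant[OF V_der(2,6) S _ cl])
qed

lemma V_inner: assumes "\<bar>x\<bar> \<le> A" shows "V x = - 1" "deriv V x = 0"
proof -
  have z: "V y = - 1" if "y \<in> {-A..A}" for y using V that unfolding is_potential_def by blast
  then show "V x = - 1" using assms by (auto simp: abs_le_iff)
  have "x \<in> closure {-A<..<A}" using assms params by (auto simp: abs_le_iff)
  then show "deriv V x = 0" by (intro derivative_zero_where_constant[OF V_der(1,5) open_greaterThanLessThan z]) auto
qed

lemma V1_odd: "deriv V (- x) = - deriv V x"
  by (rule even_derivative_odd[OF V_der(1) V_even])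

lemma V1_sign: assumes "x \<le> - A" shows "deriv V x \<le> 0"
proof -
  consider "x \<le> - B" | "x = - A" | "x \<in> {-B<..<-A}" using assms by fastforce
  then show ?thesis
  proof cases
    case 1 then show ?thesis using V_outer(2)[of x] params by auto
  next
    case 2 then show ?thesis using V_inner(2)[of x] params by auto
  next
    case 3
    have "antimono_on {-B..-A} V" using V unfolding is_potential_def by blast
    then have "mono_on {-B..-A} (\<lambda>x. - V x)" by (auto simp: monotone_on_def)
    moreover have "((\<lambda>x. - V x) has_real_derivative - deriv V x) (at x)" by (intro DERIV_minus V_der(1))
    moreover have "x \<in> interior {-B..-A}" using 3 by simp
    ultimately have "0 \<le> - deriv V x" by (rule mono_on_imp_deriv_nonneg)
    then show ?thesis by simp
  qed
qed

sublocale planar: planar_potential \<alpha> \<beta> A B V "deriv V" "deriv (deriv V)"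
proof
  show "0 < \<beta>" "\<beta> < \<alpha>" "\<alpha> < 2 * \<beta>" "0 < A" "A < B" using params by auto
  show "(V has_real_derivative deriv V x) (at x)" "(deriv V has_real_derivative deriv (deriv V) x) (at x)" for x
    by (rule V_der(1), rule V_der(2))
  show "continuous_on UNIV (deriv (deriv V))" by (rule V_der(6))
  show "deriv V (- x) = - deriv V x" for x by (rule V1_odd)
  show "V x = 0" "deriv V x = 0" if "B \<le> \<bar>x\<bar>" for x by (rule V_outer(1)[OF that], rule V_outer(2)[OF that])
  show "V x = - 1" "deriv V x = 0" if "\<bar>x\<bar> \<le> A" for x by (rule V_inner(1)[OF that], rule V_inner(2)[OF that])
  show "deriv V x \<le> 0" if "x \<le> - A" for x by (rule V1_sign[OF that])
  show "12 / (\<beta> * (2 * \<beta> - \<alpha>)) \<le> A\<^sup>2" by (rule A_large)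
qed

lemma \<eta>_smooth: "smooth \<eta>" and \<eta>_even: "\<eta> (- x) = \<eta> x" and \<eta>_range: "0 \<le> \<eta> x" "\<eta> x \<le> 1"
proof -
  have "range \<eta> \<subseteq> {0..1}" using \<eta> unfolding is_bump_def by blast
  then have "\<eta> x \<in> {0..1}" by blast
  then show "0 \<le> \<eta> x" "\<eta> x \<le> 1" by auto
qed (use \<eta> in \<open>simp_all add: is_bump_def\<close>)

lemmas \<eta>_der = smooth_chain[OF \<eta>_smooth]

lemma \<eta>_outer: assumes "C < \<bar>x\<bar>" shows "\<eta> x = 0" "deriv \<eta> x = 0" "deriv (deriv \<eta>) x = 0"
proof -
  let ?S = "{x :: real. C < \<bar>x\<bar>}"
  have S: "open ?S" by (intro open_Collect_less continuous_intros)
  have cl: "y \<in> closure ?S" if "y \<in> ?S" for y by (rule subsetD[OF closure_subset that])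
  have supp: "closure {x. \<eta> x \<noteq> 0} \<subseteq> {-C..C}" using \<eta> unfolding is_bump_def by (elim conjE)
  have z: "\<eta> y = 0" if "y \<in> ?S" for y
  proof (rule ccontr)
    assume "\<eta> y \<noteq> 0"
    then have "y \<in> closure {x. \<eta> x \<noteq> 0}" by (intro subsetD[OF closure_subset]) simp
    then have "y \<in> {-C..C}" using supp by (rule subsetD[rotated])
    then show False using that by auto
  qed
  have z1: "deriv \<eta> y = 0" if "y \<in> ?S" for y
    by (rule derivative_zero_where_constant[OF \<eta>_der(1,5) S z cl[OF that]])
  have z2: "deriv (deriv \<eta>) y = 0" if "y \<in> ?S" for y
    by (rule derivative_zero_where_constant[OF \<eta>_der(2,6) S z1 cl[OF that]])
  show "\<eta> x = 0" "deriv \<eta> x = 0" "deriv (deriv \<eta>) x = 0" using z z1 z2 assms by auto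
qed

lemma \<eta>_inner: assumes "\<bar>x\<bar> \<le> B" shows "\<eta> x = 1" "deriv \<eta> x = 0"
proof -
  have z: "\<eta> y = 1" if "y \<in> {-B..B}" for y using \<eta> that unfolding is_bump_def by blast
  then show "\<eta> x = 1" using assms by (auto simp: abs_le_iff)
  have "x \<in> closure {-B<..<B}" using assms params by (auto simp: abs_le_iff)
  then show "deriv \<eta> x = 0" by (intro derivative_zero_where_constant[OF \<eta>_der(1,5) open_greaterThanLessThan z]) auto
qed

lemma \<eta>1_bound: assumes "- C \<le> x" "x \<le> - B" shows "0 \<le> deriv \<eta> x \<and> deriv \<eta> x * (\<beta> * (- x)) < 2 * (\<alpha> - \<beta>)"
proof -
  have "0 \<le> deriv \<eta> x \<and> deriv \<eta> x < 2 * (\<alpha> - \<beta>) / (- \<beta> * x)"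
    using \<eta> assms unfolding is_bump_def by auto
  moreover have "0 < \<beta> * (- x)" using assms params by (intro mult_pos_pos) auto
  moreover have "- \<beta> * x = \<beta> * (- x)" by simp
  ultimately show ?thesis by (simp only: pos_less_divide_eq)
qed

lemma X_smooth: "smooth X" and X_odd: "X (- x) = - X x" and X_D: "X (- D) = 0" "X D = 0"
  and X_linear: "B \<le> \<bar>x\<bar> \<Longrightarrow> \<bar>x\<bar> \<le> (C + D) / 2 \<Longrightarrow> X x = - \<beta> * x"
  and X_derivs: "(deriv ^^ n) X (- D) = (deriv ^^ n) X D"
proof -
  show "X x = - \<beta> * x" if x: "B \<le> \<bar>x\<bar>" "\<bar>x\<bar> \<le> (C + D) / 2"
  proof -
    have "x \<in> {- ((D + C) / 2)..-B} \<union> {B..(C + D) / 2}"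
    proof (cases "0 \<le> x")
      case False
      then have "\<bar>x\<bar> = - x" by simp
      then have "B \<le> - x" "- x \<le> (D + C) / 2" using x by (simp_all only: add.commute)
      then have "- ((D + C) / 2) \<le> x" "x \<le> - B" by (simp_all only: minus_le_iff[of x] le_minus_iff[of x])
      then show ?thesis by simp
    qed (use x in simp)
    then show ?thesis using X unfolding is_circle_field_def by blast
  qed
qed (use X in \<open>simp_all add: is_circle_field_def\<close>)

lemmas X_der = smooth_chain[OF X_smooth]

lemma X1_bound: assumes "B \<le> \<bar>x\<bar>" "\<bar>x\<bar> \<le> D" shows "- \<beta> \<le> deriv X x"
proof -
  have "- \<beta> \<le> deriv X (- \<bar>x\<bar>)" using X assms unfolding is_circle_field_def by auto
  moreover have "deriv X (- y) = deriv X y" for y by (rule odd_derivative_even[OF X_der(1) X_odd])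
  ultimately show ?thesis by (cases "0 \<le> x") auto
qed

text \<open>A zero of \<open>X\<close> would be a constant solution, and constant solutions do not come from \<open>-D\<close>.\<close>

lemma X_nonzero: assumes x: "x \<in> {-D<..-B}" shows "X x \<noteq> 0"
proof
  assume X0: "X x = 0"
  have "x \<in> unstable_manifold X (- D)" using X x unfolding is_circle_field_def by blast
  then obtain \<gamma> where g: "\<gamma> 0 = x" "\<And>t. t \<le> 0 \<Longrightarrow> (\<gamma> has_real_derivative X (\<gamma> t)) (at t within {..0})"
    "(\<gamma> \<longlongrightarrow> - D) at_bot"
    unfolding unstable_manifold_def by blast
  have sol: "solves X \<gamma> {..0}" unfolding solves_def using g(2)
    by (auto simp: has_real_derivative_iff_has_vector_derivative)
  have const: "\<gamma> t = x" if t: "t \<le> 0" for t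
  proof -
    have sub: "solves X \<gamma> {t..0}" by (rule solves_subset[OF sol]) auto
    have "compact (\<gamma> ` {t..0})" by (intro compact_continuous_image solves_continuous_on[OF sub] compact_Icc)
    then obtain R where "\<forall>y\<in>\<gamma> ` {t..0}. norm y \<le> R"
      using compact_imp_bounded[of "\<gamma> ` {t..0}"] unfolding bounded_iff by blast
    then have R: "\<bar>\<gamma> s\<bar> \<le> R" if "s \<in> {t..0}" for s using that by simp
    have "compact (deriv X ` {-R..R})" by (intro compact_continuous_image X_der(5) compact_Icc)
    then obtain L where "\<forall>y\<in>deriv X ` {-R..R}. norm y \<le> L"
      using compact_imp_bounded[of "deriv X ` {-R..R}"] unfolding bounded_iff by blast
    then have L: "\<bar>deriv X y\<bar> \<le> L" if "y \<in> {-R..R}" for y using that by simp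
    show ?thesis
    proof (rule solves_unique[OF sub, of "\<lambda>_. x" 0 t L])
      show "solves X (\<lambda>_. x) {t..0}" by (simp add: solves_def X0)
      show "norm (X (\<gamma> s) - X x) \<le> L * norm (\<gamma> s - x)" if "s \<in> {t..0}" for s
        unfolding real_norm_def
        by (rule real_lipschitz_of_derivative_bound[of "{-R..R}" X "deriv X"])
           (use L R[OF that] R[of 0] g(1) t X_der(1) in \<open>auto intro: has_field_derivative_at_within simp: abs_le_iff\<close>)
    qed (use t g(1) in \<open>auto simp: is_interval_cc\<close>)
  qed
  have "eventually (\<lambda>t. \<gamma> t = x) at_bot" using const by (auto simp: eventually_at_bot_linorder)
  then have "(\<gamma> \<longlongrightarrow> x) at_bot" by (rule tendsto_eventually)
  then have "x = - D" by (rule tendsto_unique[OF trivial_limit_at_bot_linorder _ g(3)])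
  then show False using x by simp
qed

lemma X_pos: assumes x: "x \<in> {-D<..-B}" shows "0 < X x"
proof (rule ccontr)
  assume "\<not> 0 < X x"
  then have "X x \<le> 0" by simp
  moreover have "0 < X (- B)" using X_linear[of "- B"] params by simp
  ultimately have "\<exists>y\<ge>x. y \<le> - B \<and> X y = 0" by (intro IVT' X_der(4)) (use x in auto)
  then show False using X_nonzero x by fastforce
qed

text \<open>The coefficient of \<open>y\<close> in \<open>K\<close>, which does not see \<open>X\<close> on \<open>[-B,B]\<close> because \<open>\<eta> = 1\<close> there, and its
successive derivatives. The third one is there to show that the second is continuous after periodisation.\<close>

definition a0 :: "real \<Rightarrow> real" where "a0 x = (if \<bar>x\<bar> \<le> C then - \<beta> * x else X x)"
definition a0' :: "real \<Rightarrow> real" where "a0' x = (if \<bar>x\<bar> \<le> C then - \<beta> else deriv X x)"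
definition a0'' :: "real \<Rightarrow> real" where "a0'' x = (if \<bar>x\<bar> \<le> C then 0 else deriv (deriv X) x)"
definition a0''' :: "real \<Rightarrow> real" where "a0''' x = (if \<bar>x\<bar> \<le> C then 0 else deriv (deriv (deriv X)) x)"

lemma a0_deriv: "(a0 has_real_derivative a0' x) (at x)" "(a0' has_real_derivative a0'' x) (at x)"
  "(a0'' has_real_derivative a0''' x) (at x)"
proof -
  have R: "B < C" "C < (C + D) / 2" using params by auto
  have u: "((\<lambda>x. - \<beta> * x) has_real_derivative - \<beta>) (at x)" for x
    using DERIV_cmult[OF DERIV_ident, of "- \<beta>" x] by simp
  have c: "((\<lambda>_. k) has_real_derivative 0) (at x)" for k x by simp
  have e0: "- \<beta> * x = X x" if "B < \<bar>x\<bar>" "\<bar>x\<bar> < (C + D) / 2" for x using X_linear[of x] that by simp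
  note s1 = splice_has_derivative[where u = "\<lambda>x. - \<beta> * x" and v = X, OF R u X_der(1) e0]
  note s2 = splice_has_derivative[where u = "\<lambda>_. - \<beta>" and v = "deriv X", OF R c X_der(2) s1(2)]
  note s3 = splice_has_derivative[where u = "\<lambda>_. 0" and v = "deriv (deriv X)", OF R c X_der(3) s2(2)]
  show "(a0 has_real_derivative a0' x) (at x)" unfolding a0_def[abs_def] a0'_def by (rule s1(1))
  show "(a0' has_real_derivative a0'' x) (at x)" unfolding a0'_def[abs_def] a0''_def by (rule s2(1))
  show "(a0'' has_real_derivative a0''' x) (at x)" unfolding a0''_def[abs_def] a0'''_def by (rule s3(1))
qed

lemma a0_corner: "a0 (- D) = 0" "a0 D = 0" "a0' (- D) = a0' D" "a0'' (- D) = a0'' D" "a0''' (- D) = a0''' D"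
proof -
  have n: "\<not> \<bar>D\<bar> \<le> C" "\<not> \<bar>- D\<bar> \<le> C" using params by auto
  show "a0 (- D) = 0" "a0 D = 0" using n X_D by (simp_all add: a0_def)
  show "a0' (- D) = a0' D" "a0'' (- D) = a0'' D" "a0''' (- D) = a0''' D"
    using n X_derivs[of 1] X_derivs[of 2] X_derivs[of 3]
    by (simp_all add: a0'_def a0''_def a0'''_def numeral_2_eq_2 numeral_3_eq_3)
qed

definition m where "m x = 1 + \<eta> (wrap D x)"
definition m1 where "m1 x = deriv \<eta> (wrap D x)"
definition m2 where "m2 x = deriv (deriv \<eta>) (wrap D x)"
definition a where "a x = a0 (wrap D x)"
definition a1 where "a1 x = a0' (wrap D x)"
definition a2 where "a2 x = a0'' (wrap D x)"
definition b where "b x = V (wrap D x)"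
definition b1 where "b1 x = deriv V (wrap D x)"
definition b2 where "b2 x = deriv (deriv V) (wrap D x)"

lemma \<eta>_corner: "\<eta> (- D) = \<eta> D" "deriv \<eta> (- D) = deriv \<eta> D" "deriv (deriv \<eta>) (- D) = deriv (deriv \<eta>) D"
  using \<eta>_outer[of D] \<eta>_outer[of "- D"] params by auto

lemma V_corner: "V (- D) = V D" "deriv V (- D) = deriv V D" "deriv (deriv V) (- D) = deriv (deriv V) D"
  using V_outer[of D] V_outer[of "- D"] params by auto

lemma fundamental_domain_values:
  assumes "\<bar>x\<bar> \<le> D"
  shows "m x = 1 + \<eta> x" "m1 x = deriv \<eta> x" "a x = a0 x" "a1 x = a0' x" "b x = V x" "b1 x = deriv V x"
proof -
  note w = wrap_fundamental[OF D_pos _ assms]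
  have "a0 (- D) = a0 D" by (simp add: a0_corner)
  then show "m x = 1 + \<eta> x" "m1 x = deriv \<eta> x" "a x = a0 x" "a1 x = a0' x" "b x = V x" "b1 x = deriv V x"
    unfolding m_def m1_def a_def a1_def b_def b1_def
    by (simp_all only: w[OF \<eta>_corner(1)] w[OF \<eta>_corner(2)] w[OF V_corner(1)] w[OF V_corner(2)]
        w[OF a0_corner(3)] w[of a0])
qed

lemma a0'_even: "a0' (- x) = a0' x"
  using odd_derivative_even[OF X_der(1) X_odd] by (simp add: a0'_def)

sublocale damped_annulus \<alpha> \<beta> B C D m m1 m2 a a1 a2 b b1 b2
proof
  show "0 < \<beta>" "\<beta> < \<alpha>" "\<alpha> < 2 * \<beta>" "0 < B" "B < C" "C < D" using params by auto
  note per = periodic_has_real_derivative[OF D_pos]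
  show "(m has_real_derivative m1 x) (at x)" for x
    unfolding m_def[abs_def] m1_def using DERIV_add[OF DERIV_const per[OF \<eta>_der(1) \<eta>_corner(1,2)]] by simp
  show "(m1 has_real_derivative m2 x) (at x)" for x unfolding m1_def[abs_def] m2_def by (rule per[OF \<eta>_der(2) \<eta>_corner(2,3)])
  show "continuous_on UNIV m2" unfolding m2_def[abs_def] by (rule periodic_continuous[OF D_pos \<eta>_der(6) \<eta>_corner(3)])
  show "(a has_real_derivative a1 x) (at x)" for x unfolding a_def[abs_def] a1_def
    by (rule per[OF a0_deriv(1)]) (simp_all add: a0_corner)
  show "(a1 has_real_derivative a2 x) (at x)" for x unfolding a1_def[abs_def] a2_def
    by (rule per[OF a0_deriv(2)]) (simp_all add: a0_corner)
  have "(a2 has_real_derivative a0''' (wrap D x)) (at x)" for x unfolding a2_def[abs_def]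
    by (rule per[OF a0_deriv(3)]) (simp_all add: a0_corner)
  then show "continuous_on UNIV a2" by (rule DERIV_continuous_on)
  show "(b has_real_derivative b1 x) (at x)" for x unfolding b_def[abs_def] b1_def by (rule per[OF V_der(1) V_corner(1,2)])
  show "(b1 has_real_derivative b2 x) (at x)" for x unfolding b1_def[abs_def] b2_def by (rule per[OF V_der(2) V_corner(2,3)])
  show "continuous_on UNIV b2" unfolding b2_def[abs_def] by (rule periodic_continuous[OF D_pos V_der(6) V_corner(3)])
  have w: "wrap D (x + 2 * D) = wrap D x" for x using wrap_shift[OF D_pos, of x 1] by simp
  show "m (x + 2 * D) = m x" "m1 (x + 2 * D) = m1 x" "m2 (x + 2 * D) = m2 x"
    "a (x + 2 * D) = a x" "a1 (x + 2 * D) = a1 x" "a2 (x + 2 * D) = a2 x"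
    "b (x + 2 * D) = b x" "b1 (x + 2 * D) = b1 x" "b2 (x + 2 * D) = b2 x" for x
    by (simp_all add: m_def m1_def m2_def a_def a1_def a2_def b_def b1_def b2_def w)
  show "m (- x) = m x" "m1 (- x) = - m1 x" for x unfolding m_def m1_def
    using periodic_even[OF D_pos, of \<eta> x, OF \<eta>_even]
      periodic_odd[OF D_pos, of "deriv \<eta>" x, OF even_derivative_odd[OF \<eta>_der(1) \<eta>_even] \<eta>_corner(2)] by simp_all
  have a0_odd: "a0 (- x) = - a0 x" for x by (simp add: a0_def X_odd)
  show "a (- x) = - a x" "a1 (- x) = a1 x" for x unfolding a_def a1_def
    using periodic_odd[OF D_pos, of a0 x, OF a0_odd] periodic_even[OF D_pos, of a0' x, OF a0'_even] a0_corner by simp_all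
  show "b (- x) = b x" "b1 (- x) = - b1 x" for x unfolding b_def b1_def
    using periodic_even[OF D_pos, of V x, OF V_even]
      periodic_odd[OF D_pos, of "deriv V" x, OF V1_odd V_corner(2)] by simp_all
  show "1 \<le> m x" "m x \<le> 2" for x using \<eta>_range[of "wrap D x"] by (simp_all add: m_def)
  show "m x = 2" "m1 x = 0" if "\<bar>x\<bar> \<le> B" for x using fundamental_domain_values(1,2)[of x] \<eta>_inner[OF that] that params by auto
  show "m x = 1" "m1 x = 0" if "C < \<bar>x\<bar>" "\<bar>x\<bar> \<le> D" for x using fundamental_domain_values(1,2)[OF that(2)] \<eta>_outer[OF that(1)] by auto
  show "0 \<le> m1 x \<and> m1 x * (\<beta> * (- x)) < 2 * (\<alpha> - \<beta>)" if "- C \<le> x" "x \<le> - B" for x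
    using \<eta>1_bound[OF that] fundamental_domain_values(2)[of x] that params by auto
  show "a x = - \<beta> * x" "a1 x = - \<beta>" if "\<bar>x\<bar> \<le> C" for x
    using fundamental_domain_values(3,4)[of x] that params by (auto simp: a0_def a0'_def)
  show "- \<beta> \<le> a1 x" if "\<bar>x\<bar> \<le> D" for x
    using fundamental_domain_values(4)[OF that] X1_bound[of x] that params by (auto simp: a0'_def)
  show "0 < a x" if "- D < x" "x < 0" for x
  proof (cases "\<bar>x\<bar> \<le> C")
    case True
    then show ?thesis using fundamental_domain_values(3)[of x] that params by (simp add: a0_def mult_pos_neg)
  next
    case False
    then show ?thesis using fundamental_domain_values(3)[of x] that params X_pos[of x] by (simp add: a0_def)
  qed
  show "a D = 0" using fundamental_domain_values(3)[of D] D_pos a0_corner by simp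
  show "- 1 \<le> b x" "b x \<le> 0" for x using V_range by (auto simp: b_def)
  show "b x = 0" "b1 x = 0" if "B \<le> \<bar>x\<bar>" "\<bar>x\<bar> \<le> D" for x using fundamental_domain_values(5,6)[OF that(2)] V_outer[OF that(1)] by auto
  show "b1 x \<le> 0" if "- D \<le> x" "x \<le> 0" for x
    using fundamental_domain_values(6)[of x] that V1_sign[of x] V_inner(2)[of x] by (cases "x \<le> - A") auto
qed

text \<open>On \<open>B \<le> |x| \<le> C\<close> the two Hamiltonians that are interpolated have the same mixed term, because \<open>X\<close> is
\<open>-\<beta>x\<close> there.\<close>

lemma K_is_periodized: "periodize D (K_plane \<beta> V X \<eta>) = K"
proof
  fix z :: "real \<times> real"
  obtain x y where z: "z = (x, y)" by (cases z)
  let ?w = "wrap D x"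
  consider "\<bar>?w\<bar> \<le> B" | "B < \<bar>?w\<bar>" "\<bar>?w\<bar> \<le> C" | "C < \<bar>?w\<bar>" by linarith
  then have "K_plane \<beta> V X \<eta> (?w, y) = (1 + \<eta> ?w) / 2 * y\<^sup>2 + a0 ?w * y + V ?w"
  proof cases
    case 1
    then show ?thesis using \<eta>_inner[of ?w] params by (simp add: K_plane_def H_def a0_def)
  next
    case 2
    then show ?thesis using V_outer[of ?w] X_linear[of ?w] params
      by (simp add: K_plane_def H_field_def H_def a0_def power2_eq_square field_simps)
  next
    case 3
    then show ?thesis using V_outer[of ?w] \<eta>_outer[of ?w] params
      by (simp add: K_plane_def H_field_def H_def a0_def power2_eq_square field_simps)
  qed
  then show "periodize D (K_plane \<beta> V X \<eta>) z = K z"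
    by (simp add: z periodize_def K_def m_def a_def b_def)
qed

lemma K_section_derivatives:
  "((\<lambda>v. K (x, v)) has_real_derivative speed (x, y)) (at y)"
  "((\<lambda>u. K (u, y)) has_real_derivative Kx (x, y)) (at x)"
proof -
  have "((\<lambda>v. (x, v)) has_derivative (\<lambda>h. (0, h))) (at y)" "((\<lambda>u. (u, y)) has_derivative (\<lambda>h. (h, 0))) (at x)"
    by (auto intro!: derivative_eq_intros)
  from this[THEN has_derivative_compose, OF K_has_derivative]
  show "((\<lambda>v. K (x, v)) has_real_derivative speed (x, y)) (at y)"
    "((\<lambda>u. K (u, y)) has_real_derivative Kx (x, y)) (at x)"
    unfolding has_field_derivative_def by (simp_all add: has_derivative_eq_rhs)
qed

lemma field_is_conformal: "conformal_field \<alpha> K = F"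
  using K_section_derivatives[THEN DERIV_imp_deriv]
  by (auto simp: conformal_field_def F_def fun_eq_iff)

lemma K_tonelli: "tonelli D K"
  unfolding tonelli_def
proof (intro conjI allI)
  show "K (x + 2 * D, y) = K (x, y)" for x y using F_shift(2)[of "(x, y)" 1] by simp
  have C1: "C1_on UNIV (\<lambda>z :: real \<times> real. fst z)" "C1_on UNIV (\<lambda>z :: real \<times> real. snd z)"
    by (intro C1_on_linear bounded_linear_fst bounded_linear_snd)+
  have cont: "continuous_on UNIV m1" "continuous_on UNIV a1"
    by (rule DERIV_continuous_on, rule has_field_derivative_at_within, rule m_deriv a_deriv)+
  have "C1_on UNIV speed" unfolding speed_def[abs_def]
    by (intro C1_on_add C1_on_mult C1 C1_on_real_compose[OF m_deriv(1) cont(1) C1(1)] C1_on_real_compose[OF a_deriv(1) cont(2) C1(1)])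
  moreover have "Kx = (\<lambda>z. (1 / 2) * (m1 (fst z) * (snd z * snd z)) + a1 (fst z) * snd z + b1 (fst z))"
    by (simp add: Kx_def fun_eq_iff power2_eq_square)
  then have "C1_on UNIV Kx"
    by (simp only:) (intro C1_on_add C1_on_mult C1_on_const C1 C1_on_real_compose[OF m_deriv(2,3) C1(1)]
        C1_on_real_compose[OF a_deriv(2,3) C1(1)] C1_on_real_compose[OF b_deriv(2,3) C1(1)])
  ultimately show "C2_on UNIV K" using C2_on_real_plane[OF K_has_derivative] by blast
  fix x y
  have d1: "deriv (\<lambda>v. K (x, v)) = (\<lambda>v. m x * v + a x)"
    using K_section_derivatives(1)[THEN DERIV_imp_deriv] by (simp add: fun_eq_iff speed_def)
  have "((\<lambda>v. m x * v + a x) has_real_derivative m x) (at y)" by (auto intro!: derivative_eq_intros)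
  then have "deriv (\<lambda>v. m x * v + a x) y = m x" by (rule DERIV_imp_deriv)
  then show "0 < (deriv ^^ 2) (\<lambda>v. K (x, v)) y"
    using m_range(1)[of x] by (simp add: numeral_2_eq_2 d1)
next
  fix x
  show "filterlim (\<lambda>y. K (x, y) / \<bar>y\<bar>) at_top at_infinity"
    unfolding filterlim_at_top eventually_at_infinity
  proof
    fix Z :: real
    have "Z \<le> K (x, y) / \<bar>y\<bar>" if y: "2 * (\<bar>Z\<bar> + \<bar>a x\<bar> + 1) \<le> norm y" for y
    proof -
      have y1: "1 \<le> \<bar>y\<bar>" "Z + \<bar>a x\<bar> + 1 \<le> \<bar>y\<bar> / 2" using y by auto
      have "(Z + \<bar>a x\<bar> + 1) * \<bar>y\<bar> \<le> \<bar>y\<bar> / 2 * \<bar>y\<bar>" by (rule mult_right_mono[OF y1(2)]) simp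
      moreover have "\<bar>y\<bar> / 2 * \<bar>y\<bar> \<le> m x / 2 * y\<^sup>2"
        using mult_right_mono[OF m_range(1)[of x], of "y\<^sup>2"] by (simp add: power2_eq_square)
      moreover have "- (\<bar>a x\<bar> * \<bar>y\<bar>) \<le> a x * y" using abs_ge_minus_self[of "a x * y"] by (simp add: abs_mult)
      moreover have "- \<bar>y\<bar> \<le> b x" using y1(1) b_range(1)[of x] by linarith
      ultimately have "Z * \<bar>y\<bar> \<le> K (x, y)" unfolding K_def distrib_right fst_conv snd_conv mult_1 by linarith
      then show ?thesis using y1(1) by (simp add: pos_le_divide_eq)
    qed
    then show "\<exists>r. \<forall>y. r \<le> norm y \<longrightarrow> Z \<le> K (x, y) / \<bar>y\<bar>" by blast
  qed
qed

lemma field_on_strip: assumes "\<bar>fst z\<bar> \<le> B" shows "F z = planar.Fp z"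
proof -
  have x: "\<bar>fst z\<bar> \<le> C" "\<bar>fst z\<bar> \<le> D" using assms params by auto
  show ?thesis
    unfolding F_def planar.Fp_def speed_def Kx_def
    by (simp add: m_inner[OF assms] a_inner[OF x(1)] fundamental_domain_values(6)[OF x(2)] algebra_simps)
qed

text \<open>The motion on the invariant axis, followed backwards from \<open>-B\<close>: it cannot reach the equilibria \<open>-D\<close> and \<open>0\<close>, and
it cannot stop before \<open>-D\<close> because \<open>a\<close> has a positive minimum on each \<open>[x,-B]\<close> with \<open>x > -D\<close>.\<close>

lemma axis_flow:
  "\<exists>\<xi>. \<xi> 0 = - B \<and> (\<forall>t. (\<xi> has_real_derivative a (\<xi> t)) (at t)) \<and> (\<forall>t\<le>0. - D < \<xi> t \<and> \<xi> t \<le> - B) \<and>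
     (\<forall>x. - D < x \<longrightarrow> x \<le> - B \<longrightarrow> (\<exists>t\<le>0. \<xi> t = x))"
proof -
  have "continuous_on UNIV a1" by (rule DERIV_continuous_on) (rule has_field_derivative_at_within[OF a_deriv(2)])
  then obtain L where L: "\<And>x. \<bar>a1 x\<bar> \<le> L" using periodic_bounded[OF D_pos, of a1] a_periodic(2) by blast
  have lip: "norm (a x - a y) \<le> L * norm (x - y)" for x y
    unfolding real_norm_def by (rule real_lipschitz_of_derivative_bound[of UNIV a a1]) (use a_deriv L in auto)
  obtain \<xi> where x0: "\<xi> 0 = - B" and sol: "solves a \<xi> UNIV" using solution_exists[OF lip] by blast
  have d: "(\<xi> has_real_derivative a (\<xi> t)) (at t)" for t
    using sol by (simp add: solves_def has_real_derivative_iff_has_vector_derivative)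
  have cont: "continuous_on S \<xi>" for S by (rule DERIV_continuous_on) (rule has_field_derivative_at_within[OF d])
  have avoid: "\<xi> t \<noteq> c" if c: "a c = 0" "c \<noteq> - B" for c t
  proof
    assume "\<xi> t = c"
    have "\<xi> 0 = c"
    proof (rule solves_unique[OF sol, of "\<lambda>_. c" t 0 L])
      show "solves a (\<lambda>_. c) UNIV" using c by (simp add: solves_def)
      show "norm (a (\<xi> s) - a c) \<le> L * norm (\<xi> s - c)" for s by (rule lip)
    qed (use \<open>\<xi> t = c\<close> in auto)
    then show False using c x0 by simp
  qed
  have aD: "a (- D) = 0" "a 0 = 0" using a_sign(2) parity(3)[of D] parity(3)[of 0] by auto
  have nD: "\<xi> t \<noteq> - D" "\<xi> t \<noteq> 0" for t using avoid[OF aD(1)] avoid[OF aD(2)] params by auto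
  have left: "- D < \<xi> t" if "t \<le> 0" for t
  proof (rule ccontr)
    assume "\<not> - D < \<xi> t"
    then have "\<exists>s\<ge>t. s \<le> 0 \<and> \<xi> s = - D" by (intro IVT' cont) (use that x0 params in auto)
    then show False using nD by blast
  qed
  have right: "\<xi> t < 0" if "t \<le> 0" for t
  proof (rule ccontr)
    assume "\<not> \<xi> t < 0"
    then have "\<exists>s\<ge>t. s \<le> 0 \<and> \<xi> s = 0" by (intro IVT2' cont) (use that x0 params in auto)
    then show False using nD by blast
  qed
  have below: "\<xi> t \<le> - B" if t: "t \<le> 0" for t
  proof -
    have "\<xi> t \<le> \<xi> 0"
    proof (rule DERIV_nonneg_imp_nondecreasing[OF t])
      fix s assume "t \<le> s" "s \<le> 0"
      then have "0 < a (\<xi> s)" using a_sign(1) left right by blast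
      then show "\<exists>y. (\<xi> has_real_derivative y) (at s) \<and> 0 \<le> y" using d less_imp_le by blast
    qed
    then show ?thesis using x0 by simp
  qed
  have onto: "\<exists>t\<le>0. \<xi> t = x" if x: "- D < x" "x \<le> - B" for x
  proof -
    have "\<exists>t\<le>0. \<xi> t \<le> x"
    proof (rule ccontr)
      assume "\<not> (\<exists>t\<le>0. \<xi> t \<le> x)"
      then have gt: "\<And>t. t \<le> 0 \<Longrightarrow> x < \<xi> t" by force
      have ca: "continuous_on {x..-B} a" by (rule DERIV_continuous_on) (rule has_field_derivative_at_within[OF a_deriv(1)])
      obtain y where y: "y \<in> {x..-B}" "\<And>z. z \<in> {x..-B} \<Longrightarrow> a y \<le> a z"
        using continuous_attains_inf[OF compact_Icc _ ca] x by auto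
      have c: "0 < a y" using a_sign(1)[of y] y(1) x params by auto
      \<comment> \<open>Moving back at speed at least \<open>a y\<close> for this long would leave the strip.\<close>
      define t where "t = - D / a y"
      have t0: "t \<le> 0" using c D_pos by (simp add: t_def)
      have "a y * 0 - \<xi> 0 \<le> a y * t - \<xi> t"
      proof (rule nonincreasing_on[where f = "\<lambda>t. a y * t - \<xi> t" and f' = "\<lambda>t. a y - a (\<xi> t)" and S = "{..0}"])
        fix s :: real assume s: "s \<in> {..0}"
        show "((\<lambda>t. a y * t - \<xi> t) has_real_derivative a y - a (\<xi> s)) (at s within {..0})"
          by (auto intro!: derivative_eq_intros has_field_derivative_at_within[OF d])
        have "\<xi> s \<in> {x..-B}" using gt[of s] below[of s] s by auto
        then show "a y - a (\<xi> s) \<le> 0" using y(2) by simp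
      qed (use t0 in \<open>auto simp: is_interval_ic\<close>)
      then have "\<xi> t \<le> - B - D" using x0 c by (simp add: t_def)
      then show False using left[OF t0] params by simp
    qed
    then obtain t where t: "t \<le> 0" "\<xi> t \<le> x" by blast
    then have "\<exists>s\<ge>t. s \<le> 0 \<and> \<xi> s = x" by (intro IVT' cont) (use x x0 in auto)
    then show ?thesis by blast
  qed
  show ?thesis using x0 d left below onto by (intro exI[of _ \<xi>]) auto
qed

text \<open>The axis solution and the planar orbit join at \<open>(-B,0)\<close>. On the axis \<open>K = b = 0\<close>, and \<open>K\<close> stays non-positive
afterwards since it decays.\<close>

lemma complete_orbit:
  "\<exists>G. solves F G UNIV \<and> (\<forall>t. K (G t) \<le> 0) \<and> range G = {-D<..-B} \<times> {0} \<union> planar.g ` {0..}"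
proof -
  obtain \<xi> where x: "\<xi> 0 = - B" "\<And>t. (\<xi> has_real_derivative a (\<xi> t)) (at t)"
    "\<And>t. t \<le> 0 \<Longrightarrow> - D < \<xi> t \<and> \<xi> t \<le> - B" "\<And>x. - D < x \<Longrightarrow> x \<le> - B \<Longrightarrow> \<exists>t\<le>0. \<xi> t = x"
    using axis_flow by blast
  have F_axis: "F (\<xi> t, 0) = (a (\<xi> t), 0) \<and> K (\<xi> t, 0) = 0" if "t \<le> 0" for t
  proof -
    have "B \<le> \<bar>\<xi> t\<bar>" "\<bar>\<xi> t\<bar> \<le> D" using x(3)[OF that] params by auto
    then show ?thesis using b_outer[of "\<xi> t"] by (simp add: F_def K_def speed_def Kx_def)
  qed
  have s1: "solves F (\<lambda>t. (\<xi> t, 0)) {..0}"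
    unfolding solves_def
  proof
    fix t :: real assume t: "t \<in> {..0}"
    have "(\<xi> has_vector_derivative a (\<xi> t)) (at t within {..0})"
      using has_field_derivative_at_within[OF x(2)] by (simp add: has_real_derivative_iff_has_vector_derivative)
    then show "((\<lambda>t. (\<xi> t, 0)) has_vector_derivative F (\<xi> t, 0)) (at t within {..0})"
      using F_axis[of t] t by (auto intro!: has_vector_derivative_Pair derivative_eq_intros)
  qed
  have s2: "solves F planar.g {0..}"
    by (rule solves_cong[OF solves_subset[OF planar.g_solves]]) (use field_on_strip planar.g_strip(1) in auto)
  define G where "G t = (if t \<le> 0 then (\<xi> t, 0) else planar.g t)" for t
  have G: "solves F G UNIV" unfolding G_def[abs_def]
    by (rule solves_glue[OF s1 s2]) (simp add: x(1) planar.g0)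
  have KG: "K (G t) \<le> 0" for t
  proof (cases "t \<le> 0")
    case True
    then show ?thesis using F_axis by (simp add: G_def)
  next
    case False
    have "K (G t) \<le> exp (- \<alpha> * (t - 0)) * K (G 0)" by (rule K_decay[OF G]) (use False in auto)
    also have "K (G 0) = 0" using F_axis[of 0] by (simp add: G_def)
    finally show ?thesis by simp
  qed
  have "range G = {-D<..-B} \<times> {0} \<union> planar.g ` {0..}"
  proof (intro equalityI subsetI)
    fix z assume "z \<in> range G"
    then obtain t where "z = G t" by blast
    then show "z \<in> {-D<..-B} \<times> {0} \<union> planar.g ` {0..}" using x(3)[of t] by (auto simp: G_def)
  next
    fix z assume z: "z \<in> {-D<..-B} \<times> {0} \<union> planar.g ` {0..}"
    have "planar.g t = G t" if "0 \<le> t" for t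
      using that x(1) planar.g0 by (cases "t = 0") (auto simp: G_def)
    moreover have "\<exists>t. (y, 0) = G t" if y: "y \<in> {-D<..-B}" for y
    proof -
      obtain t where "t \<le> 0" "\<xi> t = y" using x(4)[of y] y by auto
      then show ?thesis by (intro exI[of _ t]) (simp add: G_def)
    qed
    ultimately show "z \<in> range G" using z by blast
  qed
  then show ?thesis using G KG by blast
qed

lemma planar_field_eq: "planar_field \<alpha> \<beta> V = planar.Fp"
  by (auto simp: planar_field_def planar.Fp_def fun_eq_iff)

lemma planar_orbits:
  "orbit (planar_field \<alpha> \<beta> V) (- B, 0) = range planar.g"
  "orbit (planar_field \<alpha> \<beta> V) (B, 0) = uminus ` range planar.g"
proof -
  have orb: "orbit planar.Fp (\<gamma> 0) = range \<gamma>" if s: "solves planar.Fp \<gamma> UNIV" for \<gamma>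
  proof (intro equalityI subsetI)
    fix w assume "w \<in> orbit planar.Fp (\<gamma> 0)"
    then obtain \<delta> t where "solves planar.Fp \<delta> UNIV" "\<delta> 0 = \<gamma> 0" "\<delta> t = w"
      unfolding orbit_def solves_def by auto
    then have "w = \<gamma> t" using planar.Fp_unique[OF _ s, of \<delta> 0 t] by simp
    then show "w \<in> range \<gamma>" by simp
  next
    fix w assume "w \<in> range \<gamma>"
    then show "w \<in> orbit planar.Fp (\<gamma> 0)" using s unfolding orbit_def solves_def by auto
  qed
  have odd: "planar.Fp (- z) = - planar.Fp z" for z by (simp add: planar.Fp_def planar.V1_odd)
  have "solves planar.Fp (\<lambda>t. - planar.g t) UNIV"
    using planar.g_solves unfolding solves_def by (auto simp: odd intro!: derivative_eq_intros)
  from orb[OF this] orb[OF planar.g_solves]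
  show "orbit (planar_field \<alpha> \<beta> V) (- B, 0) = range planar.g"
    "orbit (planar_field \<alpha> \<beta> V) (B, 0) = uminus ` range planar.g"
    unfolding planar_field_eq planar.g0 by (simp_all add: image_image)
qed

lemma attracting_curve_eq_loop: "attracting_curve \<alpha> \<beta> B D V = cover D ` planar.loop D"
proof -
  have "range planar.g \<inter> {-B..B} \<times> UNIV = planar.g ` {0..}"
  proof (intro equalityI subsetI)
    fix z assume z: "z \<in> range planar.g \<inter> {-B..B} \<times> UNIV"
    then obtain t where t: "z = planar.g t" by blast
    have "0 \<le> t" using planar.g_strip(2)[of t] z t by (force simp: mem_Times_iff)
    then show "z \<in> planar.g ` {0..}" using t by blast
  next
    fix z assume "z \<in> planar.g ` {0..}"
    then show "z \<in> range planar.g \<inter> {-B..B} \<times> UNIV"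
      using planar.g_strip(1) by (auto simp: mem_Times_iff abs_le_iff) force
  qed
  moreover from this have "uminus ` range planar.g \<inter> {-B..B} \<times> UNIV = uminus ` planar.g ` {0..}"
  proof -
    have "uminus ` S \<inter> R = uminus ` (S \<inter> R)" if R: "\<And>z. z \<in> R \<Longrightarrow> - z \<in> R" for S R :: "(real \<times> real) set"
    proof (intro equalityI subsetI)
      fix z assume "z \<in> uminus ` S \<inter> R"
      then obtain s where s: "s \<in> S" "z = - s" "z \<in> R" by blast
      then have "s \<in> R" using R[of z] by simp
      then show "z \<in> uminus ` (S \<inter> R)" using s by blast
    next
      fix z assume "z \<in> uminus ` (S \<inter> R)"
      then show "z \<in> uminus ` S \<inter> R" using R by blast
    qed
    from this[of "{-B..B} \<times> UNIV" "range planar.g"]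
    have "uminus ` range planar.g \<inter> {-B..B} \<times> UNIV = uminus ` (range planar.g \<inter> {-B..B} \<times> UNIV)"
      by (auto simp: mem_Times_iff)
    then show ?thesis using calculation by simp
  qed
  moreover have "{(0, 0)} \<inter> {-B..B} \<times> UNIV = {0 :: real \<times> real}"
    using params by (auto simp: zero_prod_def)
  ultimately have "\<Gamma> \<alpha> \<beta> B V \<inter> {-B..B} \<times> UNIV = planar.g ` {0..} \<union> uminus ` planar.g ` {0..} \<union> {0}"
    unfolding \<Gamma>_def planar_orbits Int_Un_distrib2 by simp
  then show ?thesis unfolding attracting_curve_def planar.loop_def by simp
qed

theorem loop_is_global_attractor: "is_global_attractor D F (cover D ` planar.loop D)"
proof -
  obtain G where G: "solves F G UNIV" "\<And>t. K (G t) \<le> 0" "range G = {-D<..-B} \<times> {0} \<union> planar.g ` {0..}"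
    using complete_orbit by blast
  interpret damped_annulus_curve \<alpha> \<beta> B C D m m1 m2 a a1 a2 b b1 b2 G
  proof
    show "solves F G UNIV" "K (G t) \<le> 0" for t using G by auto
    show "\<exists>s. G s = (x, 0)" if "- D < x" "x < - C" for x
    proof -
      have "(x, 0) \<in> range G" unfolding G(3) using that params by auto
      then show ?thesis by (metis imageE)
    qed
  qed
  have neg: "uminus ` range G = {B..<D} \<times> {0} \<union> uminus ` planar.g ` {0..}"
  proof -
    have "uminus ` ({-D<..-B} \<times> {0 :: real}) = {B..<D} \<times> {0}"
    proof (intro equalityI subsetI)
      fix z assume z: "z \<in> {B..<D} \<times> {0 :: real}"
      show "z \<in> uminus ` ({-D<..-B} \<times> {0})"
        by (rule image_eqI[of _ _ "- z"]) (use z in \<open>auto simp: mem_Times_iff\<close>)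
    qed auto
    then show ?thesis unfolding G(3) image_Un by simp
  qed
  have "planar.loop D = insert (- D, 0) curve"
  proof -
    have e1: "{-D..-B} \<times> {0 :: real} = insert (- D, 0) ({-D<..-B} \<times> {0})" using params by auto
    have e2: "{B..D} \<times> {0 :: real} = insert (D, 0) ({B..<D} \<times> {0})" using params by auto
    show ?thesis unfolding planar.loop_def curve_def neg unfolding G(3) Times_Un_distrib1 e1 e2 by blast
  qed
  moreover have "cover D (- D, 0) = cover D (D, 0)"
    using cover_eq_iff[OF D_pos, of "(- D, 0)" "(D, 0)"] by (auto intro!: exI[of _ 1])
  ultimately have "cover D ` planar.loop D = cover D ` curve" by (auto simp: curve_def)
  moreover have "compact (cover D ` planar.loop D)" by (rule planar.loop_isotopic(3)) (use params in simp)
  ultimately show ?thesis using curve_is_global_attractor by simp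
qed

theorem circle_construction_integrable:
  "C1_integrable_with D F (cover D ` planar.loop D)"
  unfolding C1_integrable_with_def
  using loop_is_global_attractor planar.loop_isotopic(1,2)[of D] params by auto

end

text \<open>The threshold for \<open>A\<close> is the one that keeps the kick small, see \<open>planar_potential\<close>.\<close>

theorem proposition13:
  fixes \<alpha> \<beta> :: real
  assumes "0 < \<beta>" and "\<beta> < \<alpha>" and "\<alpha> < 2 * \<beta>"
  shows "\<exists>A\<^sub>0>0. \<forall>A B C D :: real. \<forall>V X \<eta> :: real \<Rightarrow> real.
           A\<^sub>0 \<le> A \<longrightarrow> A < B \<longrightarrow> is_potential A B V \<longrightarrow>
           B < C \<longrightarrow> C < D \<longrightarrow> 2 * (\<alpha> - \<beta>) / \<beta> * ln (C / B) > 1 \<longrightarrow>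
           is_circle_field \<beta> B C D X \<longrightarrow> is_bump \<alpha> \<beta> B C \<eta> \<longrightarrow>
           (let K = periodize D (K_plane \<beta> V X \<eta>);
                F = conformal_field \<alpha> K;
                \<C> = attracting_curve \<alpha> \<beta> B D V
            in tonelli D K \<and>
               is_global_attractor D F \<C> \<and>
               C1_integrable D F \<and>
               C1_integrable_with D F \<C> \<and>
               \<not> is_graph \<C>)"
proof (intro exI[of _ "sqrt (12 / (\<beta> * (2 * \<beta> - \<alpha>)))"] conjI allI impI)
  have pos: "0 < 12 / (\<beta> * (2 * \<beta> - \<alpha>))" using assms by simp
  then show "0 < sqrt (12 / (\<beta> * (2 * \<beta> - \<alpha>)))" by (simp only: real_sqrt_gt_zero)
  fix A B C D :: real and V X \<eta> :: "real \<Rightarrow> real"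
  assume A: "sqrt (12 / (\<beta> * (2 * \<beta> - \<alpha>))) \<le> A" and h: "A < B" "is_potential A B V" "B < C" "C < D"
    "is_circle_field \<beta> B C D X" "is_bump \<alpha> \<beta> B C \<eta>"
  have "0 < A" using A \<open>0 < sqrt _\<close> by linarith
  moreover have "12 / (\<beta> * (2 * \<beta> - \<alpha>)) \<le> A\<^sup>2"
    using power_mono[OF A, of 2] pos by simp
  ultimately interpret circle_construction \<alpha> \<beta> A B C D V X \<eta>
    by unfold_locales (use assms h in auto)
  have "C1_integrable_with D F (cover D ` planar.loop D)" by (rule circle_construction_integrable)
  then show "let K = periodize D (K_plane \<beta> V X \<eta>); F = conformal_field \<alpha> K; \<C> = attracting_curve \<alpha> \<beta> B D V
      in tonelli D K \<and> is_global_attractor D F \<C> \<and> C1_integrable D F \<and> C1_integrable_with D F \<C> \<and> \<not> is_graph \<C>"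
    unfolding Let_def K_is_periodized field_is_conformal attracting_curve_eq_loop
    using K_tonelli loop_is_global_attractor planar.loop_not_graph[of D]
    unfolding C1_integrable_def by blast
qed

end
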